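(* Let $\mathbf v_0\in\mathbb S^{n-1}$, let $\mathbf Z\in\bigotimes^k\mathbb R^n$ be a (generic) noise tensor, let $\mathbf X=\beta\,\mathbf v_0^{\otimes k}+\mathbf Z$, and let $\mathbf y\in\mathbb R^n$, $\mathbf y\ne0$. Let $(\mathbf v^t)_{t\ge0}$ be the power iteration $$\mathbf v^0=\frac{\mathbf y}{\|\mathbf y\|_2},\qquad\mathbf v^{t+1}=\frac{\mathbf X\{\mathbf v^t\}}{\|\mathbf X\{\mathbf v^t\}\|_2}.$$ Assume $$\text{(i)}\ \ \beta\ge2e(k-1)\,\|\mathbf Z\|_{op},\qquad\text{(ii)}\ \ \frac{\langle\mathbf y,\mathbf v_0\rangle}{\|\mathbf y\|_2}\ge\Big[\frac{(k-1)\|\mathbf Z\|_{op}}{\beta}\Big]^{1/(k-1)}.$$ Then for all $t\ge t_0(k)$ (a number of iterations depending on $k$ and independent of the dimension $n$), the power iteration estimator satisfies $$\mathrm{Loss}(\mathbf v^t,\mathbf v_0)\le\frac{2e\|\mathbf Z\|_{op}}{\beta}.$$ If $\mathbf Z$ is a symmetric standard normal noise tensor, then conditions (i) and (ii) are satisfied with high probability provided $$\beta\ge2ek\,\mu_k=6\sqrt{k^3\log k}\,\big(1+o_k(1)\big),\qquad\frac{\langle\mathbf y,\mathbf v_0\rangle}{\|\mathbf y\|_2}\ge\Big[\frac{k\mu_k}{\beta}\Big]^{1/(k-1)}=\beta^{-1/(k-1)}\big(1+o_k(1)\big),$$ where $\mu_k$ is the constant defined in the context.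
   Context: $k$ is the order of the tensor; $o_k(1)$ denotes a quantity tending to $0$ as $k\to\infty$; "with high probability" refers to $n\to\infty$. $\mathbb S^{n-1}$ is the unit sphere of $\mathbb R^n$; $\mathbf v^{\otimes k}$ has entries $\mathbf v_{i_1}\cdots\mathbf v_{i_k}$; $\langle\cdot,\cdot\rangle$ is the entrywise inner product. For $\mathbf X\in\bigotimes^k\mathbb R^n$ and $\mathbf v\in\mathbb R^n$, $\mathbf X\{\mathbf v\}\in\mathbb R^n$ is the vector with $\mathbf X\{\mathbf v\}_i=\sum_{j_1,\dots,j_{k-1}\in[n]}\mathbf X_{i,j_1,\dots,j_{k-1}}\mathbf v_{j_1}\cdots\mathbf v_{j_{k-1}}$. The operator norm is $\|\mathbf X\|_{op}=\max\{\langle\mathbf X,\mathbf u_1\otimes\cdots\otimes\mathbf u_k\rangle:\|\mathbf u_i\|_2\le1\ \forall i\in[k]\}$. For unit vectors, $\mathrm{Loss}(\mathbf v,\mathbf v_0)=\min(\|\mathbf v-\mathbf v_0\|_2^2,\|\mathbf v+\mathbf v_0\|_2^2)=2-2|\langle\mathbf v,\mathbf v_0\rangle|$. The symmetric standard normal noise tensor is $$\mathbf Z_{i_1,\dots,i_k}=\frac1{k!}\sqrt{\frac kn}\sum_{\pi\in\mathfrak S_k}\mathbf G_{i_{\pi(1)},\dots,i_{\pi(k)}},$$ with $\mathbf G\in\bigotimes^k\mathbb R^n$ having i.i.d. $\mathsf N(0,1)$ entries and $\mathfrak S_k$ the group of permutations of $\{1,\dots,k\}$. Definition of $\mu_k$: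 for $x\ge\eta_k:=2\sqrt{k-1}$ let $$g_k(x)=\frac12\Big\{\frac{2-k}{k}-\log\Big(\frac{kz^2}{2}\Big)+\frac{k-1}{2}z^2-\frac{2}{k^2z^2}\Big\},\qquad z=\frac{1}{(k-1)\sqrt{2k}}\Big(x-\sqrt{x^2-4(k-1)}\Big).$$ Then $\mu_k$ is the unique root of $g_k(x)=0$ in $[\eta_k,\infty)$.
   Formalization: The loss bound is stated for k ≥ 3 (false for k = 2, meaningless for k = 1) and assumes Z ≠ 0 or X{y} ≠ 0 (else the iteration is 0/0); "= 6√(k³ log k)(1+o(1))" is corrected to constant 2e, with 6 kept as an upper bound. *)

theory Defs
  imports "HOL-Probability.Probability" "HOL-Combinatorics.Combinatorics"
begin

text \<open>
  Since the dimension \<open>n\<close> and the order \<open>k\<close> are quantified over, vectors of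
  \<open>\<real>\<^sup>n\<close> are functions \<open>nat \<Rightarrow> real\<close> of which only the values below \<open>n\<close> matter, and tensors of
  order \<open>k\<close> are functions \<open>nat list \<Rightarrow> real\<close> of which only the values on \<open>tidx n k\<close> matter.
  All indices start at \<open>0\<close>.
\<close>

definition tidx :: "nat \<Rightarrow> nat \<Rightarrow> nat list set" where
  "tidx n k = {is. length is = k \<and> set is \<subseteq> {..<n}}"

definition vinner :: "nat \<Rightarrow> (nat \<Rightarrow> real) \<Rightarrow> (nat \<Rightarrow> real) \<Rightarrow> real" where
  "vinner n u v = (\<Sum>i<n. u i * v i)"

definition vnorm :: "nat \<Rightarrow> (nat \<Rightarrow> real) \<Rightarrow> real" where
  "vnorm n v = L2_set v {..<n}"

definition tinner :: "nat \<Rightarrow> nat \<Rightarrow> (nat list \<Rightarrow> real) \<Rightarrow> (nat list \<Rightarrow> real) \<Rightarrow> real" where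
  "tinner n k X Y = (\<Sum>is\<in>tidx n k. X is * Y is)"

definition outer :: "nat \<Rightarrow> (nat \<Rightarrow> nat \<Rightarrow> real) \<Rightarrow> nat list \<Rightarrow> real" where
  "outer k u is = (\<Prod>l<k. u l (is ! l))"

definition tpow :: "nat \<Rightarrow> (nat \<Rightarrow> real) \<Rightarrow> nat list \<Rightarrow> real" where
  "tpow k v = outer k (\<lambda>_. v)"

text \<open>The supremum is over a nonempty set bounded above and is attained, by compactness.\<close>

definition opnorm :: "nat \<Rightarrow> nat \<Rightarrow> (nat list \<Rightarrow> real) \<Rightarrow> real" where
  "opnorm n k X = Sup {tinner n k X (outer k u) | u. \<forall>l<k. vnorm n (u l) \<le> 1}"

definition contract :: "nat \<Rightarrow> nat \<Rightarrow> (nat list \<Rightarrow> real) \<Rightarrow> (nat \<Rightarrow> real) \<Rightarrow> nat \<Rightarrow> real" where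
  "contract n k X v i = (\<Sum>js\<in>tidx n (k - 1). X (i # js) * tpow (k - 1) v js)"

definition normalize_vec :: "nat \<Rightarrow> (nat \<Rightarrow> real) \<Rightarrow> nat \<Rightarrow> real" where
  "normalize_vec n v i = v i / vnorm n v"

primrec power_iter ::
  "nat \<Rightarrow> nat \<Rightarrow> (nat list \<Rightarrow> real) \<Rightarrow> (nat \<Rightarrow> real) \<Rightarrow> nat \<Rightarrow> nat \<Rightarrow> real" where
  "power_iter n k X y 0 = normalize_vec n y"
| "power_iter n k X y (Suc t) = normalize_vec n (contract n k X (power_iter n k X y t))"

definition spiked :: "nat \<Rightarrow> real \<Rightarrow> (nat \<Rightarrow> real) \<Rightarrow> (nat list \<Rightarrow> real) \<Rightarrow> nat list \<Rightarrow> real" where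
  "spiked k \<beta> v0 Z is = \<beta> * tpow k v0 is + Z is"

definition Loss :: "nat \<Rightarrow> (nat \<Rightarrow> real) \<Rightarrow> (nat \<Rightarrow> real) \<Rightarrow> real" where
  "Loss n v v0 = min ((vnorm n (\<lambda>i. v i - v0 i))\<^sup>2) ((vnorm n (\<lambda>i. v i + v0 i))\<^sup>2)"

definition signal_cond :: "nat \<Rightarrow> nat \<Rightarrow> real \<Rightarrow> (nat list \<Rightarrow> real) \<Rightarrow> bool" where
  "signal_cond n k \<beta> Z \<longleftrightarrow> \<beta> \<ge> 2 * exp 1 * (real k - 1) * opnorm n k Z"

definition init_cond ::
  "nat \<Rightarrow> nat \<Rightarrow> real \<Rightarrow> (nat list \<Rightarrow> real) \<Rightarrow> (nat \<Rightarrow> real) \<Rightarrow> (nat \<Rightarrow> real) \<Rightarrow> bool" where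
  "init_cond n k \<beta> Z v0 y \<longleftrightarrow>
     vinner n y v0 / vnorm n y \<ge> ((real k - 1) * opnorm n k Z / \<beta>) powr (1 / (real k - 1))"

definition iid_std_normal ::
  "'a measure \<Rightarrow> nat \<Rightarrow> nat \<Rightarrow> (nat list \<Rightarrow> 'a \<Rightarrow> real) \<Rightarrow> bool" where
  "iid_std_normal M n k G \<longleftrightarrow> prob_space M \<and>
     prob_space.indep_vars M (\<lambda>_. borel) G (tidx n k) \<and>
     (\<forall>is\<in>tidx n k. distributed M lborel (G is) std_normal_density)"

definition sym_noise :: "nat \<Rightarrow> nat \<Rightarrow> (nat list \<Rightarrow> real) \<Rightarrow> nat list \<Rightarrow> real" where
  "sym_noise n k G is =
     1 / fact k * sqrt (real k / real n) * (\<Sum>\<pi> | \<pi> permutes {..<k}. G (permute_list \<pi> is))"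

definition \<eta> :: "nat \<Rightarrow> real" where
  "\<eta> k = 2 * sqrt (real k - 1)"

definition g_fun :: "nat \<Rightarrow> real \<Rightarrow> real" where
  "g_fun k x =
     (let z = 1 / ((real k - 1) * sqrt (2 * real k)) * (x - sqrt (x\<^sup>2 - 4 * (real k - 1)))
      in 1 / 2 * ((2 - real k) / real k - ln (real k * z\<^sup>2 / 2)
           + (real k - 1) / 2 * z\<^sup>2 - 2 / ((real k)\<^sup>2 * z\<^sup>2)))"

text \<open>
  For \<open>k \<ge> 2\<close> the root exists and is unique: \<open>g_fun k\<close> is continuous and strictly decreasing on
  \<open>{\<eta> k..}\<close>, nonnegative at \<open>\<eta> k\<close> and tends to \<open>-\<infinity>\<close>.
\<close>

definition \<mu> :: "nat \<Rightarrow> real" where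
  "\<mu> k = (THE x. x \<ge> \<eta> k \<and> g_fun k x = 0)"

end

theory Submission
  imports Defs "HOL-Real_Asymp.Real_Asymp"
begin

text \<open>
  Deterministic part. If \<open>\<tau>\<close> is the correlation of a unit vector with the signal, one step of the
  iteration normalises \<open>\<beta> \<tau>\<^sup>k\<^sup>-\<^sup>1 v\<^sub>0 + z\<close> with \<open>|z| \<le> |Z|\<close>, so the sine of the new angle is at most
  \<open>|Z| / (\<beta> \<tau>\<^sup>k\<^sup>-\<^sup>1)\<close>. The initial condition makes this at most \<open>1 / (k - 1)\<close>; from then on
  \<open>\<tau>\<^sup>2\<^sup>(\<^sup>k\<^sup>-\<^sup>1\<^sup>) \<ge> 1 / 2\<close> by Bernoulli's inequality, and two steps suffice for every \<open>k\<close>.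

  Probabilistic part. By Banach's theorem the operator norm of a symmetric tensor is the maximum of
  \<open>|\<langle>Z, v\<^sup>k\<rangle>|\<close> over the sphere. The Gaussian process \<open>\<langle>G, v\<^sup>k\<rangle> + \<surd>(k - 1) N\<close> and the linear process
  \<open>\<surd>k \<langle>g, v\<rangle>\<close> have the same variance \<open>k\<close>, and the first is more correlated because
  \<open>q\<^sup>k + k - 1 \<ge> k q\<close>; so by Slepian's inequality its maximum is stochastically smaller. Dividing
  the chi-square tail of \<open>|g|\<close> by the tail of the independent \<open>N\<close> shows that the norm exceeds \<open>x\<close>
  with exponentially small probability as soon as \<open>x\<^sup>2 > ln (1 / b) (k + k\<^sup>2 b / (1 - b))\<close> for some
  \<open>0 < b < 1\<close>. With \<open>b = k z\<^sup>2 / 2\<close> the equation \<open>g\<^sub>k = 0\<close> is the stationarity condition in \<open>b\<close> of the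
  right-hand side, whose stationary value is \<open>\<mu>\<^sub>k\<^sup>2\<close>.
\<close>

subsection \<open>The constant \<open>\<mu>\<^sub>k\<close>\<close>

text \<open>Slepian's inequality concerns finite families, so the sphere is reached through finite
  subsets of a countable dense set: the tail bound does not depend on their size and survives the
  limit, and the same dense set makes the norm measurable. The comparison needs equal variances, but
  the tensor form has variance 1 and the linear one variance k. The scalar Gaussian fills the gap;
  being independent of the tensor it can be divided out again, at an exponential cost that enters
  the final rate. The level \<open>\<mu> k\<close> is only the boundary of the tail estimate, where
  the exponent vanishes. Strict decay comes from the thresholds, which contain k where the
  conditions on the noise contain k - 1: it is enough to bound the norm by some x below k / (k - 1)
  times \<open>\<mu> k\<close>. The deterministic half has a degenerate case of its own. If the
  noise has norm 0, the initial condition says only that the correlation is nonnegative, and the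
  nondegeneracy assumption excludes a zero signal and an orthogonal start.\<close>

text \<open>\<open>g_fun k x = root_fun k b / 2\<close> with \<open>b = k z\<^sup>2 / 2\<close>, and then \<open>x = root_param k b\<close>.\<close>

definition root_fun :: "real \<Rightarrow> real \<Rightarrow> real" where
  "root_fun K b = - ln b - 1 / (K * b) - (K - 2) / K + (K - 1) * b / K"

text \<open>The numerator is kept factored because its zeros 1 and 1 / (K - 1) delimit the monotone
  branches. The point b = 1 / (K - 1) corresponds to x = \<open>\<eta> k\<close>, the left end of
  the domain of \<open>g_fun\<close>.\<close>

lemma root_fun_deriv:
  assumes "K > 0" "b > 0"
  shows "(root_fun K has_real_derivative ((1 - (K - 1) * b) * (1 - b) / (K * b\<^sup>2))) (at b)"
  unfolding root_fun_def
  using assms by (auto intro!: derivative_eq_intros simp: field_simps power2_eq_square)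

lemma root_fun_less:
  assumes K: "K \<ge> 2" and ab: "0 < a" "a < b" "b \<le> 1 / (K - 1)"
  shows "root_fun K a < root_fun K b"
proof (rule DERIV_pos_imp_increasing_open[OF ab(2)])
  fix x assume x: "a < x" "x < b"
  have "x < 1 / (K - 1)" using x ab by simp
  then have 1: "(K - 1) * x < 1" using K by (simp add: field_simps)
  have "1 * x \<le> (K - 1) * x" using K x ab by (intro mult_right_mono) auto
  then have 2: "x < 1" using 1 by simp
  have "((1 - (K - 1) * x) * (1 - x) / (K * x\<^sup>2)) > 0"
    using 1 2 x ab K by (intro divide_pos_pos mult_pos_pos) auto
  then show "\<exists>y. (root_fun K has_real_derivative y) (at x) \<and> 0 < y"
    using root_fun_deriv[of K x] K x ab by auto
next
  have "continuous (at x) (root_fun K)" if "x \<ge> a" for x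
    using root_fun_deriv[of K x] DERIV_isCont that K ab by fastforce
  then show "continuous_on {a..b} (root_fun K)"
    by (intro continuous_at_imp_continuous_on) auto
qed

text \<open>A Pade bound of the logarithm at 1. With m = K - 1 the difference of the two sides is
  the value of \<open>root_fun K\<close> at 1 / (K - 1), so this supplies the sign at the right end
  for the intermediate value theorem.\<close>

lemma ln_ge_rational:
  fixes m :: real assumes "m \<ge> 1"
  shows "ln m \<ge> 2 * (m - 1) / (m + 1)"
proof -
  let ?f = "\<lambda>m::real. ln m - 2 * (m - 1) / (m + 1)"
  have "?f 1 \<le> ?f m"
  proof (rule DERIV_nonneg_imp_nondecreasing[OF assms])
    fix x :: real assume x: "1 \<le> x" "x \<le> m"
    have "(?f has_real_derivative (1 / x - 4 / (x + 1)\<^sup>2)) (at x)"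
      using x by (auto intro!: derivative_eq_intros simp: field_simps power2_eq_square)
    moreover have "1 / x - 4 / (x + 1)\<^sup>2 = (x - 1)\<^sup>2 / (x * (x + 1)\<^sup>2)"
      using x by (simp add: divide_simps) (simp add: power2_eq_square algebra_simps)
    ultimately show "\<exists>y. (?f has_real_derivative y) (at x) \<and> 0 \<le> y"
      using x by (auto intro!: exI[of _ "(x - 1)\<^sup>2 / (x * (x + 1)\<^sup>2)"])
  qed
  then show ?thesis by simp
qed

lemma root_fun_root:
  assumes K: "K \<ge> 2"
  shows "\<exists>!b. 0 < b \<and> b \<le> 1 / (K - 1) \<and> root_fun K b = 0"
proof -
  define c where "c = 1 / (K - 1)"
  have c: "c > 0" using K by (simp add: c_def)
  have "root_fun K c = ln (K - 1) - 2 * ((K - 1) - 1) / ((K - 1) + 1)"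
    using K by (simp add: root_fun_def c_def ln_div field_simps)
  then have hi: "root_fun K c \<ge> 0" using ln_ge_rational[of "K - 1"] K by simp
  \<comment> \<open>Small enough for the pole to win: at a the term - 1 / (K b) equals - K^2,
    against 3 ln K <= 3 (K - 1) from the logarithm and at most 1/4 from the linear term.\<close>
  define a where "a = 1 / K ^ 3"
  have a0: "a > 0" using K by (simp add: a_def)
  have "(K - 1) * 1 \<le> K * K\<^sup>2" using K by (intro mult_mono one_le_power) auto
  then have ac: "a \<le> c" using K by (simp add: a_def c_def frac_le power3_eq_cube power2_eq_square)
  have "K * a \<le> 1 / 4"
  proof -
    have "2\<^sup>2 \<le> K\<^sup>2" using K by (intro power_mono) auto
    then have "1 / K\<^sup>2 \<le> 1 / 4" using K by (intro divide_left_mono) auto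
    moreover have "K * a = 1 / K\<^sup>2" using K by (simp add: a_def power3_eq_cube power2_eq_square)
    ultimately show ?thesis by simp
  qed
  moreover have "(K - 1) * a / K \<le> K * a"
  proof -
    have "(K - 1) / K \<le> 1" using K by simp
    then have "(K - 1) / K \<le> K" using K by linarith
    then show ?thesis using mult_right_mono[of "(K - 1) / K" K a] a0 by simp
  qed
  moreover have "ln a = - 3 * ln K" using K by (simp add: a_def ln_div ln_realpow)
  moreover have "1 / (K * a) = K\<^sup>2" using K by (simp add: a_def power3_eq_cube power2_eq_square)
  moreover have "ln K \<le> K - 1" using K by (intro ln_le_minus_one) auto
  moreover have "(K - 2) / K \<ge> 0" using K by simp
  moreover have "K\<^sup>2 - 3 * K + 3 \<ge> 3 / 4"
    using zero_le_power2[of "K - 3 / 2"] by (simp add: power2_eq_square algebra_simps)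
  ultimately have "root_fun K a < 0" unfolding root_fun_def by linarith
  note a = this a0 ac
  have cont: "\<forall>x. a \<le> x \<and> x \<le> c \<longrightarrow> isCont (root_fun K) x"
  proof (intro allI impI)
    fix x assume "a \<le> x \<and> x \<le> c"
    then show "isCont (root_fun K) x" using a K by (intro DERIV_isCont[OF root_fun_deriv]) auto
  qed
  have "\<exists>b\<ge>a. b \<le> c \<and> root_fun K b = 0"
    by (rule IVT[OF _ hi _ cont]) (use a in auto)
  then obtain b where b: "a \<le> b" "b \<le> c" "root_fun K b = 0" by auto
  show ?thesis
  proof (rule ex1I[of _ b])
    show "0 < b \<and> b \<le> 1 / (K - 1) \<and> root_fun K b = 0" using a b by (auto simp: c_def)
    fix b' assume b': "0 < b' \<and> b' \<le> 1 / (K - 1) \<and> root_fun K b' = 0"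
    show "b' = b"
      using root_fun_less[OF K, of b b'] root_fun_less[OF K, of b' b] b' b a
      by (cases b b' rule: linorder_cases) (auto simp: c_def)
  qed
qed

text \<open>With r = sqrt b, the equation x = \<open>root_param K b\<close> says that r solves (K -
  1) r^2 - x r + 1 = 0, the quadratic whose discriminant x^2 - 4 (K - 1) stands under the root in
  \<open>g_fun\<close>.\<close>

definition root_param :: "real \<Rightarrow> real \<Rightarrow> real" where
  "root_param K b = 1 / sqrt b + (K - 1) * sqrt b"

lemma g_fun_root_param:
  assumes k: "k \<ge> 2" and b: "0 < b" "b \<le> 1 / (real k - 1)"
  shows "root_param k b \<ge> \<eta> k" "g_fun k (root_param k b) = root_fun k b / 2"
proof -
  define K where "K = real k"
  define r where "r = sqrt b"
  define x where "x = root_param K b"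
  have K: "K \<ge> 2" using k by (simp add: K_def)
  have r: "r > 0" "b = r\<^sup>2" using b by (auto simp: r_def)
  have x: "x = 1 / r + (K - 1) * r" by (simp add: x_def root_param_def r_def)
  have "(K - 1) * r\<^sup>2 \<le> 1" using b r K by (simp add: K_def field_simps)
  \<comment> \<open>This sign is where b <= 1 / (k - 1) enters: it makes r the smaller root of the
    quadratic, so that the square root of the discriminant is 1 / r - (K - 1) r and not its
    negative.\<close>
  then have pos: "1 / r - (K - 1) * r \<ge> 0" using r by (simp add: field_simps power2_eq_square)
  have sq: "x\<^sup>2 - 4 * (K - 1) = (1 / r - (K - 1) * r)\<^sup>2"
    using r by (simp add: x power2_eq_square field_simps)
  then have "x\<^sup>2 \<ge> 4 * (K - 1)" by (metis diff_ge_0_iff_ge zero_le_power2)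
  then have "x \<ge> sqrt (4 * (K - 1))"
    using r K by (intro real_le_lsqrt) (auto simp: x)
  moreover have "sqrt (4 * (K - 1)) = 2 * sqrt (K - 1)"
    by (simp only: real_sqrt_mult real_sqrt_four)
  ultimately show "root_param k b \<ge> \<eta> k" by (simp add: \<eta>_def x_def K_def)
  have s: "sqrt (x\<^sup>2 - 4 * (K - 1)) = 1 / r - (K - 1) * r"
    unfolding sq using pos by simp
  define z where "z = 1 / ((K - 1) * sqrt (2 * K)) * (x - sqrt (x\<^sup>2 - 4 * (K - 1)))"
  have "x - (1 / r - (K - 1) * r) = (K - 1) * (2 * r)" by (simp add: x)
  then have "z = 1 / ((K - 1) * sqrt (2 * K)) * ((K - 1) * (2 * r))" unfolding z_def s by (rule arg_cong)
  also have "\<dots> = 2 * r / sqrt (2 * K)" using K by (simp del: real_sqrt_mult)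
  finally have z: "z = 2 * r / sqrt (2 * K)" .
  have z2: "z\<^sup>2 = 2 * b / K" using K r by (simp add: z power_divide power_mult_distrib)
  have "g_fun k x = 1 / 2 * ((2 - K) / K - ln (K * z\<^sup>2 / 2) + (K - 1) / 2 * z\<^sup>2 - 2 / (K\<^sup>2 * z\<^sup>2))"
    by (simp add: g_fun_def Let_def z_def K_def)
  also have "\<dots> = root_fun K b / 2"
    unfolding z2 root_fun_def using K b by (simp add: field_simps power2_eq_square)
  finally show "g_fun k (root_param k b) = root_fun k b / 2" by (simp add: x_def K_def)
qed

lemma root_param_surj:
  assumes k: "k \<ge> 2" and x: "x \<ge> \<eta> k"
  obtains b where "0 < b" "b \<le> 1 / (real k - 1)" "x = root_param k b"
proof
  define K where "K = real k"
  have K: "K \<ge> 2" using k by (simp add: K_def)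
  define s where "s = sqrt (x\<^sup>2 - 4 * (K - 1))"
  have x2: "x \<ge> 2 * sqrt (K - 1)" using x by (simp add: \<eta>_def K_def)
  have x0: "x > 0" using x2 K by (smt (verit) real_sqrt_gt_0_iff)
  have "(2 * sqrt (K - 1))\<^sup>2 \<le> x\<^sup>2" using x2 K by (intro power_mono) auto
  then have "x\<^sup>2 - 4 * (K - 1) \<ge> 0" using K by (simp add: power_mult_distrib)
  then have s2: "s\<^sup>2 = x\<^sup>2 - 4 * (K - 1)" and s0: "s \<ge> 0" by (simp_all add: s_def)
  have "s\<^sup>2 < x\<^sup>2" using s2 K by simp
  then have sx: "s < x" using x0 s0 by (simp add: power2_less_imp_less)
  define r where "r = (x - s) / (2 * (K - 1))"
  have r0: "r > 0" using sx K by (simp add: r_def)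
  \<comment> \<open>The roots of the quadratic are r and (x + s) / (2 (K - 1)), with product 1 / (K
    - 1); this gives 1 / r without further square roots.\<close>
  have "(x - s) * (x + s) = 4 * (K - 1)" using s2 by (simp add: algebra_simps power2_eq_square)
  then have "r * ((x + s) / 2) = 1" using K by (simp add: r_def field_simps)
  then have r1: "1 / r = (x + s) / 2" using r0 by (simp add: field_simps)
  have r2: "(K - 1) * r = (x - s) / 2"
  proof -
    define c where "c = K - 1"
    have "c \<noteq> 0" using K by (simp add: c_def)
    then show ?thesis unfolding r_def c_def[symmetric] by simp
  qed
  show "0 < r\<^sup>2" using r0 by simp
  have "(K - 1) * r \<le> 1 / r" unfolding r1 r2 using s0 by simp
  then show "r\<^sup>2 \<le> 1 / (real k - 1)" using r0 K by (simp add: K_def field_simps power2_eq_square)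
  show "x = root_param k (r\<^sup>2)"
    using r0 r1 r2 by (simp add: root_param_def K_def)
qed

text \<open>The substitution maps (0, 1 / (k - 1)] onto the domain of \<open>g_fun\<close>, so the
  unique root in b resolves the definite description in \<open>\<mu>\<close>. Later arguments use
  only b.\<close>

lemma mu_root_param:
  assumes k: "k \<ge> 2"
  obtains b where "0 < b" "b \<le> 1 / (real k - 1)" "root_fun k b = 0" "\<mu> k = root_param k b"
proof -
  obtain b where b: "0 < b" "b \<le> 1 / (real k - 1)" "root_fun k b = 0"
    using root_fun_root[of k] k by auto
  have "\<mu> k = root_param k b"
    unfolding \<mu>_def
  proof (rule the_equality)
    show "\<eta> k \<le> root_param k b \<and> g_fun k (root_param k b) = 0"
      using g_fun_root_param[OF k b(1,2)] b by simp
    fix x assume x: "\<eta> k \<le> x \<and> g_fun k x = 0"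
    obtain b' where b': "0 < b'" "b' \<le> 1 / (real k - 1)" "x = root_param k b'"
      using root_param_surj[OF k] x by blast
    then have "root_fun k b' = 0" using g_fun_root_param[OF k b'(1,2)] x by simp
    then have "b' = b" using root_fun_root[of k] k b b' by auto
    then show "x = root_param k b" using b' by simp
  qed
  then show thesis using that b by blast
qed

lemma mu_ge: assumes "k \<ge> 2" shows "\<mu> k \<ge> 2"
proof -
  obtain b where b: "0 < b" "b \<le> 1 / (real k - 1)" "\<mu> k = root_param k b"
    using mu_root_param[OF assms] by blast
  have "2 * 1 \<le> \<eta> k" unfolding \<eta>_def using assms by (intro mult_left_mono) auto
  then show ?thesis using g_fun_root_param(1)[OF assms b(1,2)] b by simp
qed

text \<open>At a root the logarithm can be eliminated: ln (1 / b) = (1 - b) (1 + (K - 1) b) / (K b).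
  The second factor of the rate is K (1 + (K - 1) b) / (1 - b), so 1 - b cancels and a perfect
  square over b remains.\<close>

lemma root_fun_zero_imp_rate:
  assumes K: "K > 0" and b: "0 < b" "b < 1" and z: "root_fun K b = 0"
  shows "ln (1 / b) * (K + K\<^sup>2 * b / (1 - b)) = (root_param K b)\<^sup>2"
proof -
  have "ln (1 / b) = 1 / (K * b) + (K - 2) / K - (K - 1) * b / K"
    using z b unfolding root_fun_def by (simp add: ln_div)
  also have "\<dots> = (1 - b) * (1 + (K - 1) * b) / (K * b)"
    using K b by (simp add: field_simps)
  finally have "ln (1 / b) = (1 - b) * (1 + (K - 1) * b) / (K * b)" .
  moreover have "(K + K\<^sup>2 * b / (1 - b)) = K * (1 + (K - 1) * b) / (1 - b)"
    using b by (simp add: field_simps power2_eq_square)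
  ultimately have "ln (1 / b) * (K + K\<^sup>2 * b / (1 - b)) = (1 + (K - 1) * b)\<^sup>2 / b"
    using b K by (simp add: power2_eq_square)
  also have "\<dots> = (root_param K b)\<^sup>2"
  proof -
    define r where "r = sqrt b"
    have r: "r > 0" "b = r\<^sup>2" using b by (auto simp: r_def)
    have "root_param K b = (1 + (K - 1) * b) / r"
      unfolding root_param_def r_def[symmetric] using r by (simp add: field_simps power2_eq_square)
    then show ?thesis using r by (simp add: power_divide)
  qed
  finally show ?thesis .
qed

lemma rate_below_mu:
  assumes k: "k \<ge> 2"
  obtains b x where "0 < b" "b < 1" "0 < x" "x < real k * \<mu> k / (real k - 1)"
    "ln (1 / b) * (real k + (real k)\<^sup>2 * b / (1 - b)) < x\<^sup>2"
proof -
  define y where "y = real k * \<mu> k / (real k - 1)"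
  have "\<exists>b>0. b < 1 \<and> ln (1 / b) * (real k + (real k)\<^sup>2 * b / (1 - b)) < y\<^sup>2"
  proof (cases "k = 2")
    case True
    \<comment> \<open>For k = 2 the root is b = 1, where the rate has no meaning. Instead b = 1/2
      gives the rate 6 ln 2 <= 6, far below y^2 >= 16.\<close>
    have "(ln 2 :: real) \<le> 2 - 1" using ln_le_minus_one[of "2::real"] by simp
    moreover have "y \<ge> 4" using mu_ge[OF k] True by (simp add: y_def)
    then have "y\<^sup>2 \<ge> 4\<^sup>2" by (intro power_mono) auto
    ultimately show ?thesis using True by (intro exI[of _ "1/2"]) simp
  next
    case False
    then have k3: "k \<ge> 3" using k by simp
    obtain b where b: "0 < b" "b \<le> 1 / (real k - 1)" "root_fun k b = 0" "\<mu> k = root_param k b"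
      using mu_root_param[OF k] by blast
    have "1 / (real k - 1) \<le> 1 / 2" using k3 by (intro divide_left_mono) auto
    then have b1: "b < 1" using b by simp
    have "\<mu> k * (real k - 1) < \<mu> k * real k" using mu_ge[OF k] by (intro mult_strict_left_mono) auto
    then have "\<mu> k < y" using k by (simp add: y_def field_simps)
    then have "(\<mu> k)\<^sup>2 < y\<^sup>2" using mu_ge[OF k] by (intro power_strict_mono) auto
    then show ?thesis
      using root_fun_zero_imp_rate[of k b] b b1 k by auto
  qed
  then obtain b where b: "b > 0" "b < 1" "ln (1 / b) * (real k + (real k)\<^sup>2 * b / (1 - b)) < y\<^sup>2"
    by blast
  define R where "R = ln (1 / b) * (real k + (real k)\<^sup>2 * b / (1 - b))"
  have y: "y > 0" using mu_ge[OF k] k by (simp add: y_def)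
  have R: "R \<ge> 0" unfolding R_def using b by (intro mult_nonneg_nonneg add_nonneg_nonneg) auto
  have "sqrt R < y" using b y R by (intro real_less_lsqrt) (auto simp: R_def)
  then obtain x where x: "sqrt R < x" "x < y" using dense by blast
  have x0: "x > 0" using x(1) R by (smt (verit) real_sqrt_ge_zero)
  have "R < x\<^sup>2" using x(1) x0 R by (smt (verit) real_sqrt_less_iff real_sqrt_unique)
  then show thesis using that[of b x] b x x0 by (simp add: R_def y_def)
qed

section \<open>Growth of \<open>\<mu> k\<close> and of the two thresholds\<close>

lemma mu_asymp: "(\<lambda>k. \<mu> k / sqrt (real k * ln (real k))) \<longlonglongrightarrow> 1"
proof -
  have "\<exists>b. 0 < b \<and> b \<le> 1 / (real k - 1) \<and> root_fun k b = 0 \<and> \<mu> k = root_param k b"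
    if "k \<ge> 2" for k
    using mu_root_param[OF that] by blast
  then obtain b where b: "\<And>k. k \<ge> 2 \<Longrightarrow>
      0 < b k \<and> b k \<le> 1 / (real k - 1) \<and> root_fun k (b k) = 0 \<and> \<mu> k = root_param k (b k)"
    by metis
  \<comment> \<open>In terms of L the root equation reads ln k + ln L = L + O(1), which forces L to
    be asymptotic to ln k; and \<open>\<mu> k\<close> is sqrt (k L) up to the factor 1 + O(1 /
    L).\<close>
  define L where "L k = 1 / (real k * b k)" for k
  have L: "L k \<ge> ln k - 1 - ln 2" "L k \<le> ln k + ln (2 * ln k + 2) + 1" "L k \<ge> 1/2"
    "\<mu> k = sqrt (real k * L k) * (1 + (real k - 1) / real k / L k)" if k: "k \<ge> 2" for k
  proof -
    define K where "K = real k"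
    have K: "K \<ge> 2" using k by (simp add: K_def)
    have bk: "0 < b k" "b k \<le> 1 / (K - 1)" "root_fun K (b k) = 0" "\<mu> k = root_param K (b k)"
      using b[OF k] by (auto simp: K_def)
    have Lpos: "L k > 0" using bk K by (simp add: L_def K_def)
    have bL: "b k = 1 / (K * L k)" using bk K by (simp add: L_def K_def)
    have "(K - 1) * b k \<le> 1" using bk K by (simp add: field_simps)
    then have "(K - 1) * b k / (K * b k) \<le> 1 / (K * b k)"
      using bk K by (intro divide_right_mono) auto
    then have L1: "L k \<ge> (K - 1) / K" using bk by (simp add: L_def K_def)
    also have "(K - 1) / K \<ge> 1 / 2" using K by (simp add: field_simps)
    finally show L2: "L k \<ge> 1 / 2" by simp
    have eq: "ln K + ln (L k) = L k + (K - 2) / K - (K - 1) / K / (K * L k)"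
      using bk(3) K Lpos unfolding root_fun_def bL by (simp add: ln_div ln_mult field_simps)
    have r: "0 \<le> (K - 2) / K" "(K - 2) / K \<le> 1" using K by (auto simp: field_simps)
    have q0: "(K - 1) / K / (K * L k) \<ge> 0" using K Lpos by simp
    have "(K - 1) / K / (K * L k) = ((K - 1) / K / L k) * (1 / K)" by simp
    also have "\<dots> \<le> 1 * 1" using L1 Lpos K by (intro mult_mono) (auto simp: field_simps)
    finally have q1: "(K - 1) / K / (K * L k) \<le> 1" by simp
    have up: "L k \<le> ln K + ln (L k) + 1" using eq r q1 by simp
    have "ln (1 / 2 :: real) \<le> ln (L k)" using L2 by (subst ln_le_cancel_iff) auto
    then show "L k \<ge> ln k - 1 - ln 2" using eq r q0 by (simp add: ln_div K_def)
    \<comment> \<open>Bootstrap: ln L <= L / 2 turns the implicit bound L <= ln K + ln L + 1 into L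
      <= 2 ln K + 2; putting this back under the logarithm leaves an error of order ln ln K
      only.\<close>
    have "ln (L k / 2) \<le> L k / 2 - 1" using Lpos by (intro ln_le_minus_one) auto
    moreover have "ln (2::real) \<le> 1" using ln_le_minus_one[of "2::real"] by simp
    ultimately have "ln (L k) \<le> L k / 2" using Lpos by (simp add: ln_div)
    then have "L k \<le> 2 * ln K + 2" using up by simp
    then have "ln (L k) \<le> ln (2 * ln K + 2)" using Lpos by (subst ln_le_cancel_iff) auto
    then show "L k \<le> ln k + ln (2 * ln k + 2) + 1" using up by (simp add: K_def)
    define r where "r = sqrt (K * L k)"
    have rp: "r > 0" using K Lpos by (simp add: r_def)
    have r2: "K * L k = r\<^sup>2" using K Lpos by (simp add: r_def)
    have "sqrt (b k) = 1 / r" by (simp add: bL r_def real_sqrt_divide)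
    then have "\<mu> k = r + (K - 1) / r" by (simp add: bk(4) root_param_def)
    also have "\<dots> = r * (1 + (K - 1) / r\<^sup>2)" using rp by (simp add: field_simps power2_eq_square)
    finally show "\<mu> k = sqrt (real k * L k) * (1 + (real k - 1) / real k / L k)"
      unfolding r2[symmetric] by (simp add: r_def K_def)
  qed
  have lim: "(\<lambda>k. L k / ln (real k)) \<longlonglongrightarrow> 1"
  proof (rule tendsto_sandwich)
    show "\<forall>\<^sub>F k in sequentially. (ln k - 1 - ln 2) / ln (real k) \<le> L k / ln (real k)"
      using eventually_ge_at_top[of 2]
      by eventually_elim (auto intro!: divide_right_mono L)
    show "\<forall>\<^sub>F k in sequentially. L k / ln (real k) \<le> (ln k + ln (2 * ln k + 2) + 1) / ln (real k)"
      using eventually_ge_at_top[of 2]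
      by eventually_elim (auto intro!: divide_right_mono L)
  qed real_asymp+
  have inv: "(\<lambda>k. (real k - 1) / real k / L k) \<longlonglongrightarrow> 0"
  proof (rule tendsto_sandwich)
    show "\<forall>\<^sub>F k in sequentially. 0 \<le> (real k - 1) / real k / L k"
      using eventually_ge_at_top[of 2]
    proof eventually_elim
      case (elim k)
      then show ?case using L(3)[of k] by simp
    qed
    show "\<forall>\<^sub>F k in sequentially. (real k - 1) / real k / L k \<le> 1 / (ln k - 1 - ln 2)"
    proof -
      have "\<forall>\<^sub>F k in sequentially. ln (real k) - 1 - ln 2 > 0" by real_asymp
      then show ?thesis using eventually_ge_at_top[of 2]
      proof eventually_elim
        case (elim k)
        then show ?case using L(1,3)[of k] by (intro frac_le) auto
      qed
    qed
  qed real_asymp+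
  have "(\<lambda>k. sqrt (L k / ln (real k)) * (1 + (real k - 1) / real k / L k)) \<longlonglongrightarrow> sqrt 1 * (1 + 0)"
    by (intro tendsto_intros lim inv)
  moreover have "\<forall>\<^sub>F k in sequentially. sqrt (L k / ln (real k)) * (1 + (real k - 1) / real k / L k)
      = \<mu> k / sqrt (real k * ln (real k))"
    using eventually_ge_at_top[of 2]
    by eventually_elim (simp add: L(4) real_sqrt_divide real_sqrt_mult)
  ultimately show ?thesis by (simp add: Lim_transform_eventually)
qed

lemma root_k_mu_tendsto: "(\<lambda>k. (real k * \<mu> k) powr (1 / (real k - 1))) \<longlonglongrightarrow> 1"
proof (rule tendsto_sandwich)
  show "\<forall>\<^sub>F k in sequentially. 1 \<le> (real k * \<mu> k) powr (1 / (real k - 1))"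
    using eventually_ge_at_top[of 2]
  proof eventually_elim
    case (elim k)
    have "1 * 1 \<le> real k * \<mu> k" using elim mu_ge[OF elim] by (intro mult_mono) auto
    then show ?case using elim by (intro ge_one_powr_ge_zero) auto
  qed
  have "\<forall>\<^sub>F k in sequentially. \<mu> k / sqrt (real k * ln (real k)) < 2"
    using mu_asymp by (rule order_tendstoD) simp
  then show "\<forall>\<^sub>F k in sequentially. (real k * \<mu> k) powr (1 / (real k - 1))
      \<le> (real k * (2 * sqrt (real k * ln (real k)))) powr (1 / (real k - 1))"
    using eventually_ge_at_top[of 2]
  proof eventually_elim
    case (elim k)
    have "sqrt (real k * ln (real k)) > 0" using elim by simp
    then have "\<mu> k \<le> 2 * sqrt (real k * ln (real k))" using elim by (simp add: field_simps)
    then show ?case using elim mu_ge[of k] by (intro powr_mono2 mult_left_mono) auto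
  qed
qed real_asymp+

text \<open>The exact leading constant is 2 e. The constant 6 is its rounding by e <= 3, hence the
  equation for 2 e and the inequality for 6, with one common error term.\<close>

lemma signal_threshold_asymp:
  "\<exists>\<epsilon> :: nat \<Rightarrow> real. \<epsilon> \<longlonglongrightarrow> 0 \<and> (\<forall>k\<ge>2.
        2 * exp 1 * real k * \<mu> k = 2 * exp 1 * sqrt (real k ^ 3 * ln (real k)) * (1 + \<epsilon> k) \<and>
        2 * exp 1 * real k * \<mu> k \<le> 6 * sqrt (real k ^ 3 * ln (real k)) * (1 + \<epsilon> k))"
proof (intro exI[of _ "\<lambda>k. \<mu> k / sqrt (real k * ln (real k)) - 1"] conjI allI impI)
  show "(\<lambda>k. \<mu> k / sqrt (real k * ln (real k)) - 1) \<longlonglongrightarrow> 0"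
    using tendsto_diff[OF mu_asymp tendsto_const[of 1]] by simp
  fix k :: nat assume k: "2 \<le> k"
  have s: "sqrt (real k ^ 3 * ln (real k)) = real k * sqrt (real k * ln (real k))"
    by (simp add: power3_eq_cube real_sqrt_mult)
  have "sqrt (real k * ln (real k)) > 0" using k by simp
  then have "sqrt (real k * ln (real k)) \<noteq> 0" by linarith
  then have eq: "sqrt (real k ^ 3 * ln (real k)) * (1 + (\<mu> k / sqrt (real k * ln (real k)) - 1)) = real k * \<mu> k"
    unfolding s by (simp add: field_simps del: real_sqrt_eq_0_iff)
  show "2 * exp 1 * real k * \<mu> k = 2 * exp 1 * sqrt (real k ^ 3 * ln (real k)) *
      (1 + (\<mu> k / sqrt (real k * ln (real k)) - 1))"
    unfolding mult.assoc eq by simp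
  have "exp 1 \<le> (3::real)" by (rule exp_le)
  then have "2 * exp 1 * (real k * \<mu> k) \<le> 6 * (real k * \<mu> k)"
    using mu_ge[OF k] by (intro mult_right_mono) auto
  then show "2 * exp 1 * real k * \<mu> k \<le> 6 * sqrt (real k ^ 3 * ln (real k)) *
      (1 + (\<mu> k / sqrt (real k * ln (real k)) - 1))"
    unfolding mult.assoc eq by simp
qed

text \<open>The power of \<beta> splits off exactly, so the error term is (k
  \<open>\<mu> k\<close>)^(1 / (k - 1)) - 1. It depends on k alone, which makes the statement
  uniform in \<beta>.\<close>

lemma init_threshold_asymp:
  "\<exists>\<epsilon> :: nat \<Rightarrow> real. \<epsilon> \<longlonglongrightarrow> 0 \<and> (\<forall>k\<ge>2. \<forall>\<beta>\<ge>2 * exp 1 * real k * \<mu> k.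
        (real k * \<mu> k / \<beta>) powr (1 / (real k - 1)) = \<beta> powr (- 1 / (real k - 1)) * (1 + \<epsilon> k))"
proof (intro exI[of _ "\<lambda>k. (real k * \<mu> k) powr (1 / (real k - 1)) - 1"] conjI allI impI)
  show "(\<lambda>k. (real k * \<mu> k) powr (1 / (real k - 1)) - 1) \<longlonglongrightarrow> 0"
    using tendsto_diff[OF root_k_mu_tendsto tendsto_const[of 1]] by simp
  fix k :: nat and \<beta> :: real assume k: "2 \<le> k" and \<beta>: "2 * exp 1 * real k * \<mu> k \<le> \<beta>"
  have pos: "real k * \<mu> k > 0" using k mu_ge[OF k] by simp
  then have "2 * exp 1 * (real k * \<mu> k) > 0" by simp
  then have "\<beta> > 0" using \<beta> unfolding mult.assoc by linarith
  then show "(real k * \<mu> k / \<beta>) powr (1 / (real k - 1)) =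
      \<beta> powr (- 1 / (real k - 1)) * (1 + ((real k * \<mu> k) powr (1 / (real k - 1)) - 1))"
    using pos by (simp add: powr_divide powr_minus_divide)
qed

subsection \<open>Multilinear forms and the power iteration\<close>

lemma finite_tidx [simp]: "finite (tidx n k)"
  unfolding tidx_def using finite_lists_length_eq[of "{..<n}" k] by (simp add: conj_commute)

lemma tidx_0 [simp]: "tidx n 0 = {[]}"
  by (auto simp: tidx_def)

lemma sum_tidx_Suc: "(\<Sum>is\<in>tidx n (Suc k). f is) = (\<Sum>i<n. \<Sum>js\<in>tidx n k. f (i # js))"
proof -
  have eq: "tidx n (Suc k) = (\<lambda>(i, js). i # js) ` ({..<n} \<times> tidx n k)"
    by (force simp: tidx_def length_Suc_conv)
  have "inj_on (\<lambda>(i, js). i # js) ({..<n} \<times> tidx n k)" by (auto simp: inj_on_def)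
  then have "(\<Sum>is\<in>tidx n (Suc k). f is) = (\<Sum>(i, js)\<in>{..<n} \<times> tidx n k. f (i # js))"
    unfolding eq by (subst sum.reindex) (auto intro!: sum.cong)
  then show ?thesis by (simp add: sum.cartesian_product)
qed

lemma tidx_nth: "is \<in> tidx n k \<Longrightarrow> l < k \<Longrightarrow> is ! l < n"
  by (force simp: tidx_def dest: nth_mem)

lemma outer_Suc: "outer (Suc k) u (i # js) = u 0 i * outer k (\<lambda>l. u (Suc l)) js"
  by (simp add: outer_def prod.lessThan_Suc_shift del: prod.lessThan_Suc)

lemma outer_linear:
  assumes "l < k"
  shows "outer k (u(l := \<lambda>i. a * p i + b * q i)) is = a * outer k (u(l := p)) is + b * outer k (u(l := q)) is"
proof -
  have "outer k (u(l := r)) is = r (is ! l) * (\<Prod>m\<in>{..<k} - {l}. u m (is ! m))" for r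
    using assms by (simp add: outer_def prod.remove[of _ l])
  then show ?thesis by (simp add: algebra_simps)
qed

lemma sum_outer_outer:
  "(\<Sum>is\<in>tidx n k. outer k u is * outer k w is) = (\<Prod>l<k. vinner n (u l) (w l))"
proof (induction k arbitrary: u w)
  case 0
  then show ?case by (simp add: outer_def)
next
  case (Suc k)
  have "(\<Sum>is\<in>tidx n (Suc k). outer (Suc k) u is * outer (Suc k) w is) =
      (\<Sum>i<n. u 0 i * w 0 i * (\<Sum>js\<in>tidx n k. outer k (\<lambda>l. u (Suc l)) js * outer k (\<lambda>l. w (Suc l)) js))"
    by (simp add: sum_tidx_Suc outer_Suc sum_distrib_left mult_ac)
  also have "\<dots> = vinner n (u 0) (w 0) * (\<Prod>l<k. vinner n (u (Suc l)) (w (Suc l)))"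
    by (simp add: Suc.IH vinner_def sum_distrib_right)
  finally show ?case by (simp add: prod.lessThan_Suc_shift del: prod.lessThan_Suc)
qed

lemma sum_tpow_tpow: "(\<Sum>is\<in>tidx n k. tpow k v is * tpow k w is) = vinner n v w ^ k"
  by (simp add: tpow_def sum_outer_outer)

lemma vnorm_nonneg [simp]: "vnorm n v \<ge> 0"
  by (simp add: vnorm_def L2_set_nonneg)

lemma vnorm_power2: "(vnorm n v)\<^sup>2 = vinner n v v"
  by (simp add: vnorm_def L2_set_def vinner_def sum_nonneg power2_eq_square)

lemma vinner_commute: "vinner n u v = vinner n v u"
  by (simp add: vinner_def mult.commute)

lemma vinner_lincomb_left: "vinner n (\<lambda>i. a * u i + b * v i) w = a * vinner n u w + b * vinner n v w"
  by (simp add: vinner_def sum.distrib sum_distrib_left algebra_simps)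

lemma vinner_lincomb_right: "vinner n w (\<lambda>i. a * u i + b * v i) = a * vinner n w u + b * vinner n w v"
  by (simp add: vinner_def sum.distrib sum_distrib_left algebra_simps)

lemma vinner_le_vnorm: "\<bar>vinner n u v\<bar> \<le> vnorm n u * vnorm n v"
proof -
  have "\<bar>vinner n u v\<bar> \<le> (\<Sum>i<n. \<bar>u i\<bar> * \<bar>v i\<bar>)"
    unfolding vinner_def by (rule order_trans[OF sum_abs]) (simp add: abs_mult)
  also have "\<dots> \<le> vnorm n u * vnorm n v" unfolding vnorm_def by (rule L2_set_mult_ineq)
  finally show ?thesis .
qed

lemma vnorm_scale: "vnorm n (\<lambda>i. c * v i) = \<bar>c\<bar> * vnorm n v"
  by (simp add: vnorm_def L2_set_def power_mult_distrib sum_distrib_left[symmetric] real_sqrt_mult)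

lemma vnorm_zero_iff: "vnorm n v = 0 \<longleftrightarrow> (\<forall>i<n. v i = 0)"
  by (auto simp: vnorm_def L2_set_eq_0_iff)

lemma vnorm_lincomb_power2:
  "(vnorm n (\<lambda>i. a * u i + b * v i))\<^sup>2 = a\<^sup>2 * (vnorm n u)\<^sup>2 + 2 * a * b * vinner n u v + b\<^sup>2 * (vnorm n v)\<^sup>2"
  unfolding vnorm_power2 vinner_lincomb_left vinner_lincomb_right
  by (simp add: vinner_commute[of n v u] power2_eq_square algebra_simps)

lemma vnorm_normalize: "vnorm n v \<noteq> 0 \<Longrightarrow> vnorm n (normalize_vec n v) = 1"
  using vnorm_scale[of n "1 / vnorm n v" v] by (simp add: normalize_vec_def[abs_def])

lemma vinner_normalize: "vinner n (normalize_vec n v) w = vinner n v w / vnorm n v"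
  by (simp add: vinner_def normalize_vec_def sum_divide_distrib)

lemma abs_le_vnorm: "i < n \<Longrightarrow> \<bar>v i\<bar> \<le> vnorm n v"
proof -
  assume "i < n"
  then have "\<bar>v i\<bar> \<le> L2_set (\<lambda>i. \<bar>v i\<bar>) {..<n}" by (intro member_le_L2_set) auto
  also have "\<dots> = vnorm n v" by (simp add: vnorm_def L2_set_def)
  finally show ?thesis .
qed

section \<open>The operator norm and the contraction\<close>

lemma tinner_linear:
  assumes "l < k"
  shows "tinner n k X (outer k (u(l := \<lambda>i. a * p i + b * q i))) =
    a * tinner n k X (outer k (u(l := p))) + b * tinner n k X (outer k (u(l := q)))"
  by (simp add: tinner_def outer_linear[OF assms] sum.distrib sum_distrib_left algebra_simps)

lemma tinner_outer_bdd:
  "bdd_above {tinner n k X (outer k u) | u. \<forall>l<k. vnorm n (u l) \<le> 1}"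
proof (rule bdd_aboveI)
  fix x assume "x \<in> {tinner n k X (outer k u) | u. \<forall>l<k. vnorm n (u l) \<le> 1}"
  then obtain u where u: "x = tinner n k X (outer k u)" "\<forall>l<k. vnorm n (u l) \<le> 1" by blast
  have "X is * outer k u is \<le> \<bar>X is\<bar>" if "is \<in> tidx n k" for "is"
  proof -
    have "\<bar>u l (is ! l)\<bar> \<le> 1" if "l < k" for l
      using abs_le_vnorm[OF tidx_nth[OF \<open>is \<in> tidx n k\<close> that], of "u l"] u(2) that
      by fastforce
    then have "\<bar>outer k u is\<bar> \<le> 1" by (auto simp: outer_def abs_prod intro!: prod_le_1)
    then have "\<bar>X is\<bar> * \<bar>outer k u is\<bar> \<le> \<bar>X is\<bar> * 1" by (intro mult_left_mono) auto
    then show ?thesis using abs_ge_self[of "X is * outer k u is"] by (simp add: abs_mult)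
  qed
  then show "x \<le> (\<Sum>is\<in>tidx n k. \<bar>X is\<bar>)" unfolding u(1) tinner_def by (intro sum_mono) auto
qed

lemma opnorm_upper: "(\<And>l. l < k \<Longrightarrow> vnorm n (u l) \<le> 1) \<Longrightarrow> tinner n k X (outer k u) \<le> opnorm n k X"
  unfolding opnorm_def by (rule cSup_upper[OF _ tinner_outer_bdd]) auto

lemma opnorm_least:
  assumes "\<And>u. (\<And>l. l < k \<Longrightarrow> vnorm n (u l) \<le> 1) \<Longrightarrow> tinner n k X (outer k u) \<le> c"
  shows "opnorm n k X \<le> c"
  unfolding opnorm_def
proof (rule cSup_least)
  have "tinner n k X (outer k (\<lambda>l i. 0)) \<in> {tinner n k X (outer k u) | u. \<forall>l<k. vnorm n (u l) \<le> 1}"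
    by (auto simp: vnorm_def L2_set_def)
  then show "{tinner n k X (outer k u) | u. \<forall>l<k. vnorm n (u l) \<le> 1} \<noteq> {}"
    by (metis empty_iff)
next
  fix x assume "x \<in> {tinner n k X (outer k u) | u. \<forall>l<k. vnorm n (u l) \<le> 1}"
  then obtain u where u: "x = tinner n k X (outer k u)" "\<forall>l<k. vnorm n (u l) \<le> 1" by auto
  then show "x \<le> c" using assms[of u] by simp
qed

lemma abs_tinner_le_opnorm:
  assumes k: "k \<ge> 1" and u: "\<And>l. l < k \<Longrightarrow> vnorm n (u l) \<le> 1"
  shows "\<bar>tinner n k X (outer k u)\<bar> \<le> opnorm n k X"
proof -
  let ?w = "u(0 := \<lambda>i. - 1 * u 0 i + 0 * u 0 i)"
  have "vnorm n (?w l) \<le> 1" if "l < k" for l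
    using u[OF that] k vnorm_scale[of n "-1" "u 0"] by (cases "l = 0") auto
  then have "tinner n k X (outer k ?w) \<le> opnorm n k X" by (rule opnorm_upper)
  then have "- tinner n k X (outer k u) \<le> opnorm n k X"
    using k by (subst (asm) tinner_linear) auto
  then show ?thesis using opnorm_upper[of k n u X] u by simp
qed

lemma opnorm_nonneg: assumes "k \<ge> 1" shows "opnorm n k X \<ge> 0"
  using abs_tinner_le_opnorm[OF assms, of n "\<lambda>l i. 0" X]
  by (smt (verit) L2_set_0' vnorm_def)

text \<open>Coordinate vectors pick out single entries of the tensor. The purpose is the degenerate
  case of the iteration: operator norm 0 forces all entries to vanish.\<close>

lemma abs_entry_le_opnorm:
  assumes k: "k \<ge> 1" and "is": "is \<in> tidx n k"
  shows "\<bar>X is\<bar> \<le> opnorm n k X"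
proof -
  define u where "u l i = (if i = is ! l then 1 else 0 :: real)" for l i
  have "vnorm n (u l) \<le> 1" for l
  proof -
    have "(\<Sum>i<n. (u l i)\<^sup>2) = (\<Sum>i<n. if i = is ! l then 1 else 0)"
      by (intro sum.cong) (auto simp: u_def)
    also have "\<dots> \<le> 1" by (simp add: sum.delta)
    finally show ?thesis by (simp add: vnorm_def L2_set_def)
  qed
  then have "\<bar>tinner n k X (outer k u)\<bar> \<le> opnorm n k X" by (intro abs_tinner_le_opnorm k)
  moreover have "outer k u js = (if js = is then 1 else 0)" if "js \<in> tidx n k" for js
  proof (cases "js = is")
    case False
    have "length js = k" "length is = k" using that "is" by (auto simp: tidx_def)
    then obtain l where "l < k" "js ! l \<noteq> is ! l"
      using False by (metis nth_equalityI)
    then show ?thesis using False by (auto simp: outer_def u_def intro!: prod_zero)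
  qed (simp add: outer_def u_def)
  then have "tinner n k X (outer k u) = (\<Sum>js\<in>tidx n k. if js = is then X js else 0)"
    unfolding tinner_def by (intro sum.cong) auto
  then have "tinner n k X (outer k u) = X is" using "is" by (simp add: sum.delta)
  ultimately show ?thesis by simp
qed

lemma tinner_contract:
  assumes "k \<ge> 1"
  shows "tinner n k X (outer k (\<lambda>l. if l = 0 then w else v)) = vinner n w (contract n k X v)"
proof -
  obtain m where m: "k = Suc m" using assms by (cases k) auto
  show ?thesis
    unfolding m tinner_def sum_tidx_Suc outer_Suc vinner_def contract_def
    by (simp add: tpow_def sum_distrib_left mult_ac)
qed

text \<open>The length of the contraction is its inner product with its own direction, that is, the
  multilinear form with this direction in slot 0 and \<open>v\<close> in the other slots.\<close>

lemma vnorm_contract_le: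
  assumes k: "k \<ge> 1" and v: "vnorm n v = 1"
  shows "vnorm n (contract n k X v) \<le> opnorm n k X"
proof (cases "vnorm n (contract n k X v) = 0")
  case True
  then show ?thesis using opnorm_nonneg[OF k] by simp
next
  case False
  define z where "z = contract n k X v"
  have "tinner n k X (outer k (\<lambda>l. if l = 0 then normalize_vec n z else v)) \<le> opnorm n k X"
    using False v by (intro opnorm_upper) (simp add: z_def vnorm_normalize)
  then have "vinner n z z / vnorm n z \<le> opnorm n k X"
    by (simp add: tinner_contract[OF k] vinner_normalize z_def)
  then show ?thesis using False by (simp add: vnorm_power2[symmetric] power2_eq_square z_def)
qed

lemma contract_spiked:
  "contract n k (spiked k \<beta> v0 Z) v = (\<lambda>i. \<beta> * vinner n v v0 ^ (k - 1) * v0 i + 1 * contract n k Z v i)"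
  if k: "k \<ge> 1"
proof
  fix i
  obtain m where m: "k = Suc m" using k by (cases k) auto
  have "tpow k v0 (i # js) = v0 i * tpow (k - 1) v0 js" for js
    unfolding m tpow_def by (simp add: outer_Suc)
  then have "contract n k (spiked k \<beta> v0 Z) v i =
      (\<Sum>js\<in>tidx n (k - 1). \<beta> * v0 i * (tpow (k - 1) v js * tpow (k - 1) v0 js)) + contract n k Z v i"
    by (simp add: contract_def spiked_def sum.distrib algebra_simps)
  then show "contract n k (spiked k \<beta> v0 Z) v i = \<beta> * vinner n v v0 ^ (k - 1) * v0 i + 1 * contract n k Z v i"
    by (simp add: sum_distrib_left[symmetric] sum_tpow_tpow)
qed

section \<open>Convergence of the power iteration\<close>

lemma normalize_perturbed:
  assumes v0: "vnorm n v0 = 1" and P: "P > 0" and z: "vnorm n z \<le> B" and PB: "B < P"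
  defines "r \<equiv> (\<lambda>i. P * v0 i + 1 * z i)"
  shows "vnorm n r \<noteq> 0" "vinner n (normalize_vec n r) v0 > 0"
    "(vinner n (normalize_vec n r) v0)\<^sup>2 \<ge> 1 - (B / P)\<^sup>2"
proof -
  define s where "s = vinner n v0 z"
  define N where "N = (vnorm n z)\<^sup>2"
  have "\<bar>s\<bar> \<le> vnorm n z" using vinner_le_vnorm[of n v0 z] v0 by (simp add: s_def)
  then have sP: "P + s > 0" using z PB by linarith
  have v00: "vinner n v0 v0 = 1" using vnorm_power2[of n v0] v0 by simp
  have rv: "vinner n r v0 = P + s"
    unfolding r_def vinner_lincomb_left v00 by (simp add: s_def vinner_commute)
  have rr: "(vnorm n r)\<^sup>2 = P\<^sup>2 + 2 * P * s + N"
    unfolding r_def vnorm_lincomb_power2 v0 by (simp add: s_def N_def)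
  show r0: "vnorm n r \<noteq> 0"
    using vinner_le_vnorm[of n r v0] rv sP by auto
  then have rpos: "vnorm n r > 0" using vnorm_nonneg[of n r] by linarith
  show "vinner n (normalize_vec n r) v0 > 0" using rpos sP by (simp add: vinner_normalize rv)
  have NB: "N \<le> B\<^sup>2" unfolding N_def by (intro power_mono z) simp
  \<comment> \<open>N - s^2 is the squared length of the part of \<open>z\<close> orthogonal to
    \<open>v0\<close>, so (N - s^2) / |r|^2 is the squared sine of the new angle. The two sides of
    this inequality differ by the square (s P + N)^2.\<close>
  have "(N - s\<^sup>2) * P\<^sup>2 \<le> N * (P\<^sup>2 + 2 * P * s + N)"
    using zero_le_power2[of "s * P + N"] by (simp add: power2_eq_square algebra_simps)
  also have "\<dots> \<le> B\<^sup>2 * (vnorm n r)\<^sup>2" unfolding rr[symmetric] using NB by (intro mult_right_mono) auto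
  finally have "(N - s\<^sup>2) / (vnorm n r)\<^sup>2 \<le> B\<^sup>2 / P\<^sup>2"
    using rpos P by (simp add: field_simps)
  moreover have "(P + s)\<^sup>2 = (vnorm n r)\<^sup>2 - (N - s\<^sup>2)"
    unfolding rr by (simp add: power2_eq_square algebra_simps)
  then have "(vinner n (normalize_vec n r) v0)\<^sup>2 = 1 - (N - s\<^sup>2) / (vnorm n r)\<^sup>2"
    using rpos by (simp add: vinner_normalize rv power_divide diff_divide_distrib)
  ultimately show "(vinner n (normalize_vec n r) v0)\<^sup>2 \<ge> 1 - (B / P)\<^sup>2"
    by (simp add: power_divide)
qed

lemma Loss_le:
  assumes "vnorm n v = 1" "vnorm n v0 = 1" "vinner n v v0 \<ge> 0"
  shows "Loss n v v0 \<le> 2 * (1 - (vinner n v v0)\<^sup>2)"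
proof -
  let ?\<tau> = "vinner n v v0"
  have "?\<tau> \<le> 1" using vinner_le_vnorm[of n v v0] assms by simp
  then have "?\<tau> * ?\<tau> \<le> 1 * ?\<tau>" using assms by (intro mult_right_mono) auto
  moreover have "Loss n v v0 \<le> (vnorm n (\<lambda>i. 1 * v i + (- 1) * v0 i))\<^sup>2"
    by (simp add: Loss_def)
  then have "Loss n v v0 \<le> 2 - 2 * ?\<tau>" unfolding vnorm_lincomb_power2 using assms by simp
  ultimately show ?thesis by (simp add: power2_eq_square)
qed

lemma powr_inverse_power:
  fixes c :: real
  assumes "c > 0" "m > 0"
  shows "(c powr (1 / real m)) ^ m = c"
  using assms by (simp add: powr_power)

text \<open>The invariant from step 1 on is that the correlation is positive with square at least 1
  - 1 / m^2, where m = k - 1. For k >= 3 this bounds the correlation away from 0; for m = 1 it would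
  be empty.\<close>

lemma power_iter_Loss:
  assumes k: "k \<ge> 3" and v0: "vnorm n v0 = 1" and y: "vnorm n y \<noteq> 0"
    and nondeg: "(\<exists>is\<in>tidx n k. Z is \<noteq> 0) \<or> (\<exists>i<n. contract n k (spiked k \<beta> v0 Z) y i \<noteq> 0)"
    and sig: "signal_cond n k \<beta> Z" and init: "init_cond n k \<beta> Z v0 y" and t: "t \<ge> 2"
  shows "Loss n (power_iter n k (spiked k \<beta> v0 Z) y t) v0 \<le> 2 * exp 1 * opnorm n k Z / \<beta>"
proof -
  define B where "B = opnorm n k Z"
  define m where "m = k - 1"
  have m: "m \<ge> 2" "real k - 1 = real m" using k by (auto simp: m_def)
  have k1: "k \<ge> 1" using k by simp
  define v where "v t = power_iter n k (spiked k \<beta> v0 Z) y t" for t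
  define \<tau> where "\<tau> t = vinner n (v t) v0" for t
  have B0: "B \<ge> 0" using opnorm_nonneg[OF k1] by (simp add: B_def)
  have e2: "exp 1 \<ge> (2::real)" using exp_ge_add_one_self[of "1::real"] by simp
  have sig': "\<beta> \<ge> 2 * exp 1 * real m * B" using sig by (simp add: signal_cond_def B_def m)
  have "0 \<le> 2 * exp 1 * real m * B" using B0 by (intro mult_nonneg_nonneg) auto
  then have \<beta>0: "\<beta> \<ge> 0" using sig' by linarith
  have \<tau>0: "(real m * B / \<beta>) powr (1 / real m) \<le> \<tau> 0"
    using init by (simp add: init_cond_def \<tau>_def v_def vinner_normalize B_def m)
  have \<beta>: "\<beta> > 0" and \<tau>0pos: "\<tau> 0 > 0"
  proof -
    have "\<beta> > 0 \<and> \<tau> 0 > 0"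
    \<comment> \<open>For B = 0 the threshold is \<open>0 powr _\<close> = 0, so the initial
      condition gives no strict inequality. With all entries of Z equal to 0, some nonzero entry of
      the first contraction shows that \<beta> and the initial correlation are nonzero.\<close>
    proof (cases "B = 0")
      case True
      then have Z: "Z is = 0" if "is \<in> tidx n k" for "is"
        using abs_entry_le_opnorm[OF k1 that, of Z] by (simp add: B_def)
      have "contract n k Z y i = 0" if "i < n" for i
        unfolding contract_def using that k by (intro sum.neutral ballI) (auto simp: tidx_def intro!: Z)
      then obtain i where "\<beta> * vinner n y v0 ^ (k - 1) * v0 i \<noteq> 0"
        using nondeg Z by (auto simp: contract_spiked[OF k1])
      then have "\<beta> \<noteq> 0" "vinner n y v0 \<noteq> 0" using m by (auto simp: m_def[symmetric])
      moreover have "\<tau> 0 \<ge> 0" using \<tau>0 True by (smt (verit) powr_ge_zero)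
      moreover have "\<tau> 0 = vinner n y v0 / vnorm n y" by (simp add: \<tau>_def v_def vinner_normalize)
      ultimately show ?thesis using \<beta>0 y by (simp add: order_less_le)
    next
      case False
      then have "B > 0" using B0 by simp
      then have "0 < 2 * exp 1 * real m * B" using m by simp
      then have "\<beta> > 0" using sig' by linarith
      then have "(real m * B / \<beta>) powr (1 / real m) > 0" using \<open>B > 0\<close> m by simp
      then show ?thesis using \<tau>0 \<open>\<beta> > 0\<close> by linarith
    qed
    then show "\<beta> > 0" "\<tau> 0 > 0" by auto
  qed
  define b where "b = B / \<beta>"
  have b0: "b \<ge> 0" using B0 \<beta> by (simp add: b_def)
  have mb: "2 * exp 1 * (real m * b) \<le> 1" using sig' \<beta> by (simp add: b_def field_simps)
  have p0: "real m * b \<le> \<tau> 0 ^ m"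
  proof (cases "B = 0")
    case False
    then have c: "real m * B / \<beta> > 0" using B0 \<beta> m by simp
    have "real m * b = ((real m * B / \<beta>) powr (1 / real m)) ^ m"
      using powr_inverse_power[OF c, of m] m by (simp add: b_def)
    also have "\<dots> \<le> \<tau> 0 ^ m" by (intro power_mono \<tau>0) simp
    finally show ?thesis .
  qed (use \<tau>0pos in \<open>simp add: b_def\<close>)
  have advance: "vnorm n (v (Suc t)) = 1 \<and> \<tau> (Suc t) > 0 \<and> (\<tau> (Suc t))\<^sup>2 \<ge> 1 - (b / \<tau> t ^ m)\<^sup>2"
    if "vnorm n (v t) = 1" "\<tau> t > 0" "b < \<tau> t ^ m" for t
  proof -
    define r where "r = (\<lambda>i. \<beta> * \<tau> t ^ m * v0 i + 1 * contract n k Z (v t) i)"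
    have vS: "v (Suc t) = normalize_vec n r"
      by (simp add: v_def r_def contract_spiked[OF k1] \<tau>_def m_def)
    have P: "\<beta> * \<tau> t ^ m > 0" using \<beta> that by simp
    have z: "vnorm n (contract n k Z (v t)) \<le> B"
      unfolding B_def by (rule vnorm_contract_le[OF k1 that(1)])
    have PB: "B < \<beta> * \<tau> t ^ m" using that(3) \<beta> by (simp add: b_def field_simps)
    have "B / (\<beta> * \<tau> t ^ m) = b / \<tau> t ^ m" by (simp add: b_def)
    then show ?thesis
      using normalize_perturbed[OF v0 P z PB] vnorm_normalize[of n r]
      unfolding r_def[symmetric] vS[symmetric] \<tau>_def[symmetric] by auto
  qed
  \<comment> \<open>One induction carries both bounds. The weak one gives \<tau>^(2 m) >= 1/2, and
    then the next squared sine is at most 2 b^2, which is below 1 / m^2 again. Step 1 itself starts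
    from the initial condition, so the strong bound begins at step 2.\<close>
  have far: "vnorm n (v t) = 1 \<and> \<tau> t > 0 \<and> (\<tau> t)\<^sup>2 \<ge> 1 - (1 / real m)\<^sup>2 \<and>
      (t \<ge> 2 \<longrightarrow> (\<tau> t)\<^sup>2 \<ge> 1 - 2 * b\<^sup>2)" if "t \<ge> 1" for t
    using that
  proof (induction t rule: dec_induct)
    case base
    have "b < \<tau> 0 ^ m"
    proof (cases "b = 0")
      case False
      then have "1 * b < real m * b" using b0 m by (intro mult_strict_right_mono) auto
      then show ?thesis using p0 by simp
    qed (use \<tau>0pos in simp)
    moreover have "vnorm n (v 0) = 1" using y by (simp add: v_def vnorm_normalize)
    ultimately have s: "vnorm n (v (Suc 0)) = 1 \<and> \<tau> (Suc 0) > 0 \<and> (\<tau> (Suc 0))\<^sup>2 \<ge> 1 - (b / \<tau> 0 ^ m)\<^sup>2"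
      using advance \<tau>0pos by blast
    have "b / \<tau> 0 ^ m \<le> 1 / real m" using p0 \<tau>0pos m by (simp add: field_simps)
    then have "(b / \<tau> 0 ^ m)\<^sup>2 \<le> (1 / real m)\<^sup>2"
      using b0 \<tau>0pos by (intro power_mono) auto
    then show ?case using s by auto
  next
    case (step t)
    have "real m * (1 / real m)\<^sup>2 \<le> 1 / 2" using m by (simp add: power2_eq_square)
    moreover have "1 + real m * (- (1 / real m)\<^sup>2) \<le> (1 + (- (1 / real m)\<^sup>2)) ^ m"
      using m by (intro Bernoulli_inequality) (simp add: power_divide)
    ultimately have "1 / 2 \<le> (1 - (1 / real m)\<^sup>2) ^ m" by simp
    also have "\<dots> \<le> ((\<tau> t)\<^sup>2) ^ m" using step.IH m
      by (intro power_mono) (auto simp: power_divide)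
    also have "\<dots> = (\<tau> t ^ m)\<^sup>2" by (simp add: power_mult[symmetric] mult.commute)
    finally have p2: "1 / 2 \<le> (\<tau> t ^ m)\<^sup>2" .
    have p: "\<tau> t ^ m > 0" using step.IH by simp
    have "4 * (real m * b) \<le> 2 * exp 1 * (real m * b)"
      using e2 b0 by (intro mult_right_mono) auto
    then have mb4: "real m * b \<le> 1 / 4" using mb by linarith
    have "2 * b \<le> real m * b" using m b0 by (intro mult_right_mono) auto
    then have "b \<le> 1 / 4" using mb4 b0 by linarith
    then have "b\<^sup>2 \<le> (1 / 4)\<^sup>2" using b0 by (intro power_mono) auto
    then have "b\<^sup>2 < (\<tau> t ^ m)\<^sup>2" using p2 by (simp add: power_divide)
    then have bp: "b < \<tau> t ^ m" by (rule power2_less_imp_less) (use p in linarith)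
    have "b\<^sup>2 / (\<tau> t ^ m)\<^sup>2 \<le> b\<^sup>2 / (1 / 2)" using p2 by (intro divide_left_mono mult_pos_pos) (use p2 in \<open>linarith | simp\<close>)+
    then have r: "(b / \<tau> t ^ m)\<^sup>2 \<le> 2 * b\<^sup>2" by (simp add: power_divide)
    have "b \<le> 1 / 4 * (1 / real m)" using mb4 m by (simp add: field_simps)
    then have "b\<^sup>2 \<le> (1 / 4 * (1 / real m))\<^sup>2" using b0 by (intro power_mono) auto
    moreover have "(1 / 4 * (1 / real m))\<^sup>2 = 1 / 16 * (1 / real m)\<^sup>2"
      by (simp add: power_mult_distrib power_divide)
    ultimately have "2 * b\<^sup>2 \<le> (1 / real m)\<^sup>2"
      using zero_le_power2[of "1 / real m"] by linarith
    then show ?case using advance[of t] bp step.IH r by auto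
  qed
  have f: "vnorm n (v t) = 1" "\<tau> t > 0" "(\<tau> t)\<^sup>2 \<ge> 1 - 2 * b\<^sup>2" using far[of t] t by auto
  have "Loss n (v t) v0 \<le> 2 * (1 - (\<tau> t)\<^sup>2)"
    using Loss_le[OF f(1) v0] f(2) by (simp add: \<tau>_def)
  \<comment> \<open>The loss is in fact quadratic in the noise ratio b. The linear form of the claim
    follows since the signal condition keeps 4 b below 2 e.\<close>
  also have "\<dots> \<le> (4 * b) * b" using f(3) by (simp add: power2_eq_square)
  also have "\<dots> \<le> (2 * exp 1) * b"
  proof (rule mult_right_mono[OF _ b0])
    have "2 * b \<le> real m * b" using m b0 by (intro mult_right_mono) auto
    moreover have "4 * (real m * b) \<le> 2 * exp 1 * (real m * b)"
      using e2 b0 by (intro mult_right_mono) auto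
    ultimately show "4 * b \<le> 2 * exp 1" using mb e2 b0 by linarith
  qed
  finally show ?thesis by (simp add: v_def b_def B_def)
qed

subsection \<open>Banach's theorem\<close>

lemma bij_betw_permute_list_tidx:
  assumes "\<sigma> permutes {..<k}"
  shows "bij_betw (permute_list \<sigma>) (tidx n k) (tidx n k)"
proof (rule bij_betw_byWitness[where f' = "permute_list (inv \<sigma>)"])
  have inv: "inv \<sigma> permutes {..<k}" using assms by (rule permutes_inv)
  have c: "permute_list (inv \<sigma>) (permute_list \<sigma> is) = is" "permute_list \<sigma> (permute_list (inv \<sigma>) is) = is"
    if "length is = k" for "is" :: "nat list"
    using assms inv that
    by (simp_all add: permute_list_compose[symmetric] permutes_inv_o)
  show "\<forall>is\<in>tidx n k. permute_list (inv \<sigma>) (permute_list \<sigma> is) = is"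
    "\<forall>is\<in>tidx n k. permute_list \<sigma> (permute_list (inv \<sigma>) is) = is"
    using c by (auto simp: tidx_def)
  show "permute_list \<sigma> ` tidx n k \<subseteq> tidx n k" "permute_list (inv \<sigma>) ` tidx n k \<subseteq> tidx n k"
    using assms inv by (auto simp: tidx_def)
qed

lemma outer_permute_list:
  assumes "\<sigma> permutes {..<k}" "length is = k"
  shows "outer k (u \<circ> \<sigma>) (permute_list \<sigma> is) = outer k u is"
proof -
  have "outer k (u \<circ> \<sigma>) (permute_list \<sigma> is) = (\<Prod>l<k. u (\<sigma> l) (is ! \<sigma> l))"
    using assms by (simp add: outer_def permute_list_nth)
  also have "\<dots> = outer k u is"
    unfolding outer_def using prod.permute[OF assms(1), of "\<lambda>l. u l (is ! l)"] by (simp add: o_def)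
  finally show ?thesis .
qed

lemma tinner_permute:
  assumes sym: "\<And>is. is \<in> tidx n k \<Longrightarrow> Z (permute_list \<sigma> is) = Z is" and \<sigma>: "\<sigma> permutes {..<k}"
  shows "tinner n k Z (outer k (u \<circ> \<sigma>)) = tinner n k Z (outer k u)"
proof -
  have "tinner n k Z (outer k (u \<circ> \<sigma>)) =
      (\<Sum>is\<in>tidx n k. Z (permute_list \<sigma> is) * outer k (u \<circ> \<sigma>) (permute_list \<sigma> is))"
    unfolding tinner_def by (rule sum.reindex_bij_betw[OF bij_betw_permute_list_tidx[OF \<sigma>], symmetric])
  also have "\<dots> = tinner n k Z (outer k u)"
    unfolding tinner_def
    by (intro sum.cong refl) (simp add: sym outer_permute_list[OF \<sigma>] tidx_def)
  finally show ?thesis .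
qed

text \<open>Tychonoff's theorem in the function topology. It is the source of compactness here
  because vectors are functions on all of \<open>nat\<close>, not elements of a Euclidean space of
  fixed dimension.\<close>

lemma compact_fun_box:
  fixes C :: "'i \<Rightarrow> 'a::topological_space set"
  assumes "\<And>i. compact (C i)"
  shows "compact {f. \<forall>i. f i \<in> C i}"
proof -
  have "compactin (product_topology (\<lambda>_. euclidean) UNIV) (PiE UNIV C)"
    using assms by (simp add: compactin_PiE)
  then show ?thesis
    by (simp add: euclidean_product_topology PiE_UNIV_domain Pi_def)
qed

text \<open>Unit tuples with all irrelevant coordinates pinned to 0. The pinning makes the set
  compact in the product topology; the bounds -1 and 1 follow from the unit norm and only exhibit
  the surrounding box.\<close>

definition unit_tuples :: "nat \<Rightarrow> nat \<Rightarrow> (nat \<Rightarrow> nat \<Rightarrow> real) set" where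
  "unit_tuples n k = {u. \<forall>l i. u l i \<in> (if l < k \<and> i < n then {-1..1} else {0})} \<inter>
     (\<Inter>l\<in>{..<k}. {u. vinner n (u l) (u l) = 1})"

lemma continuous_on_coord [continuous_intros]:
  "continuous_on A (\<lambda>u :: nat \<Rightarrow> nat \<Rightarrow> real. u l i)"
  by (rule continuous_on_product_then_coordinatewise
      [OF continuous_on_subset[OF continuous_on_product_coordinates subset_UNIV]])

lemma compact_unit_tuples: "compact (unit_tuples n k)"
  unfolding unit_tuples_def
proof (rule compact_Int_closed)
  have "compact {u. \<forall>l. u l \<in> {f. \<forall>i. f i \<in> (if l < k \<and> i < n then {-1..1} else {0 :: real})}}"
    by (intro compact_fun_box) auto
  then show "compact {u. \<forall>l i. u l i \<in> (if l < k \<and> i < n then {-1..1} else {0 :: real})}" by simp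
  show "closed (\<Inter>l\<in>{..<k}. {u. vinner n (u l) (u l) = 1})"
    unfolding vinner_def by (intro closed_INT ballI closed_Collect_eq continuous_intros)
qed

lemma continuous_on_tinner_outer: "continuous_on A (\<lambda>u. tinner n k Z (outer k u))"
  unfolding tinner_def outer_def by (intro continuous_intros)

lemma in_unit_tuples_iff:
  "u \<in> unit_tuples n k \<longleftrightarrow> (\<forall>l<k. vnorm n (u l) = 1) \<and> (\<forall>l i. l < k \<and> i < n \<or> u l i = 0)"
proof -
  have 1: "vinner n v v = 1 \<longleftrightarrow> vnorm n v = 1" for v
    using vnorm_power2[of n v] vnorm_nonneg[of n v] power2_eq_iff_nonneg[of "vnorm n v" 1] by auto
  have "u l i \<in> {-1..1}" if "vnorm n (u l) = 1" "i < n" for l i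
    using abs_le_vnorm[OF that(2), of "u l"] that by (simp add: abs_le_iff)
  then show ?thesis unfolding unit_tuples_def by (auto simp: 1 split: if_splits)
qed

lemma tinner_outer_le:
  assumes M: "\<And>u. u \<in> unit_tuples n k \<Longrightarrow> \<bar>tinner n k Z (outer k u)\<bar> \<le> M"
  shows "\<bar>tinner n k Z (outer k u)\<bar> \<le> M * (\<Prod>l<k. vnorm n (u l))"
proof (cases "\<exists>l<k. vnorm n (u l) = 0")
  case True
  then obtain l where l: "l < k" "vnorm n (u l) = 0" by blast
  have "outer k u is = 0" if "is \<in> tidx n k" for "is"
    unfolding outer_def using l tidx_nth[OF that] by (intro prod_zero) (auto simp: vnorm_zero_iff)
  then have t: "tinner n k Z (outer k u) = 0" by (simp add: tinner_def)
  have p: "(\<Prod>l<k. vnorm n (u l)) = 0" using l by (intro prod_zero) auto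
  show ?thesis unfolding t p by simp
next
  case False
  define w where "w l i = (if l < k \<and> i < n then u l i / vnorm n (u l) else 0)" for l i
  have "vnorm n (w l) = 1" if "l < k" for l
  proof -
    have "vnorm n (w l) = vnorm n (normalize_vec n (u l))"
      unfolding vnorm_def using that by (intro L2_set_cong) (auto simp: w_def normalize_vec_def)
    then show ?thesis using False that by (simp add: vnorm_normalize)
  qed
  then have w: "w \<in> unit_tuples n k" by (auto simp: in_unit_tuples_iff w_def)
  have "outer k u is = (\<Prod>l<k. vnorm n (u l)) * outer k w is" if "is \<in> tidx n k" for "is"
    unfolding outer_def prod.distrib[symmetric] using False tidx_nth[OF that]
    by (intro prod.cong) (auto simp: w_def)
  then have "tinner n k Z (outer k u) = (\<Prod>l<k. vnorm n (u l)) * tinner n k Z (outer k w)"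
    by (simp add: tinner_def sum_distrib_left mult_ac)
  moreover have "(\<Prod>l<k. vnorm n (u l)) \<ge> 0" by (intro prod_nonneg) auto
  ultimately show ?thesis
    using mult_left_mono[OF M[OF w], of "\<Prod>l<k. vnorm n (u l)"] by (simp add: abs_mult mult.commute)
qed

text \<open>Polarisation against the parallelogram law. For w = u_i + s u_j and d = u_i - s u_j,
  symmetry gives b(w, w) - b(d, d) = 4 s b(u_i, u_j), of modulus 4 M, while |w|^2 + |d|^2 = 4. Since
  |b(d, d)| <= M |d|^2, the pair (w, w) must reach M |w|^2, so its normalisation is again a
  maximiser.\<close>

lemma symmetrize_slots:
  assumes sym: "\<And>\<sigma> is. \<sigma> permutes {..<k} \<Longrightarrow> is \<in> tidx n k \<Longrightarrow> Z (permute_list \<sigma> is) = Z is"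
    and M: "\<And>u. u \<in> unit_tuples n k \<Longrightarrow> \<bar>tinner n k Z (outer k u)\<bar> \<le> M"
    and u: "u \<in> unit_tuples n k" "\<bar>tinner n k Z (outer k u)\<bar> = M"
    and ij: "i < k" "j < k" "i \<noteq> j" and s: "s = 1 \<or> s = (- 1 :: real)"
  defines "w \<equiv> \<lambda>x. 1 * u i x + s * u j x"
  assumes w0: "vnorm n w \<noteq> 0"
  shows "u(i := normalize_vec n w, j := normalize_vec n w) \<in> unit_tuples n k"
    "\<bar>tinner n k Z (outer k (u(i := normalize_vec n w, j := normalize_vec n w)))\<bar> = M"
proof -
  define b where "b p q = tinner n k Z (outer k (u(i := p, j := q)))" for p q
  define d where "d = (\<lambda>x. 1 * u i x + (- s) * u j x)"
  have un: "vnorm n (u l) = 1" if "l < k" for l using u(1) that by (simp add: in_unit_tuples_iff)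
  have u0: "u l x = 0" if "\<not> (l < k \<and> x < n)" for l x using u(1) that by (auto simp: in_unit_tuples_iff)
  have lin1: "b (\<lambda>x. \<alpha> * p x + \<beta> * p' x) q = \<alpha> * b p q + \<beta> * b p' q" for \<alpha> \<beta> p p' q
    unfolding b_def using tinner_linear[OF ij(1), of n Z "u(j := q)" \<alpha> p \<beta> p'] ij(3)
    by (simp add: fun_upd_twist)
  have lin2: "b q (\<lambda>x. \<alpha> * p x + \<beta> * p' x) = \<alpha> * b q p + \<beta> * b q p'" for \<alpha> \<beta> p p' q
    unfolding b_def using tinner_linear[OF ij(2), of n Z "u(i := q)" \<alpha> p \<beta> p'] by simp
  have comm: "b p q = b q p" for p q
  proof -
    have "u(i := p, j := q) \<circ> Transposition.transpose i j = u(i := q, j := p)"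
      using ij by (auto simp: fun_eq_iff Transposition.transpose_def)
    moreover have "Transposition.transpose i j permutes {..<k}" using ij by (intro permutes_swap_id) auto
    ultimately show ?thesis
      using tinner_permute[of n k Z "Transposition.transpose i j" "u(i := p, j := q)"] sym by (simp add: b_def)
  qed
  have bM: "\<bar>b p q\<bar> \<le> M * (vnorm n p * vnorm n q)" for p q
  proof -
    have "(\<Prod>l<k. vnorm n ((u(i := p, j := q)) l)) = (\<Prod>l\<in>{i, j}. vnorm n ((u(i := p, j := q)) l))"
      using ij un by (intro prod.mono_neutral_right) auto
    also have "\<dots> = vnorm n p * vnorm n q" using ij by simp
    finally show ?thesis using tinner_outer_le[OF M, of "u(i := p, j := q)"] by (simp add: b_def)
  qed
  have bu: "\<bar>b (u i) (u j)\<bar> = M" using u(2) by (simp add: b_def)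
  have s2: "s * s = 1" using s by auto
  have "b w w - b d d = 4 * s * b (u i) (u j)"
    unfolding w_def d_def lin1 lin2 comm[of "u j" "u i"] using s2 by (simp add: algebra_simps)
  then have "4 * M \<le> \<bar>b w w\<bar> + \<bar>b d d\<bar>" using bu s by (auto simp: abs_if split: if_splits)
  moreover have "\<bar>b d d\<bar> \<le> M * (vnorm n d)\<^sup>2" using bM[of d d] by (simp add: power2_eq_square)
  moreover have "(vnorm n w)\<^sup>2 + (vnorm n d)\<^sup>2 = 4"
    unfolding w_def d_def vnorm_lincomb_power2 using s2 un ij by (simp add: power2_eq_square)
  then have "(vnorm n d)\<^sup>2 = 4 - (vnorm n w)\<^sup>2" by simp
  ultimately have low: "M * (vnorm n w)\<^sup>2 \<le> \<bar>b w w\<bar>" by (simp add: algebra_simps)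
  define c where "c = 1 / vnorm n w"
  have nw: "normalize_vec n w = (\<lambda>x. c * w x + 0 * w x)" by (simp add: normalize_vec_def[abs_def] c_def)
  have "b (normalize_vec n w) (normalize_vec n w) = c\<^sup>2 * b w w"
    unfolding nw lin1 lin2 by (simp add: power2_eq_square)
  moreover have "c\<^sup>2 * (M * (vnorm n w)\<^sup>2) \<le> c\<^sup>2 * \<bar>b w w\<bar>" using low by (intro mult_left_mono) auto
  moreover have "c\<^sup>2 * (M * (vnorm n w)\<^sup>2) = M" using w0 by (simp add: c_def power_divide)
  ultimately have "M \<le> \<bar>b (normalize_vec n w) (normalize_vec n w)\<bar>" by (simp add: abs_mult)
  moreover have "\<bar>b (normalize_vec n w) (normalize_vec n w)\<bar> \<le> M"
    using bM[of "normalize_vec n w" "normalize_vec n w"] w0 by (simp add: vnorm_normalize)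
  ultimately show "\<bar>tinner n k Z (outer k (u(i := normalize_vec n w, j := normalize_vec n w)))\<bar> = M"
    by (simp add: b_def)
  have "normalize_vec n w x = 0" if "\<not> x < n" for x
    using u0[of i x] u0[of j x] that by (simp add: normalize_vec_def w_def)
  then show "u(i := normalize_vec n w, j := normalize_vec n w) \<in> unit_tuples n k"
    using un u0 ij w0 by (auto simp: in_unit_tuples_iff vnorm_normalize)
qed

text \<open>
  Among the maximisers of the multilinear form choose one that is most aligned
  with a fixed unit vector; replacing two slots by their normalised sum would increase the alignment
  unless they agree up to sign.
\<close>

lemma opnorm_symmetric_le:
  assumes k: "k \<ge> 1" and n: "n \<ge> 1"
    and sym: "\<And>\<sigma> is. \<sigma> permutes {..<k} \<Longrightarrow> is \<in> tidx n k \<Longrightarrow> Z (permute_list \<sigma> is) = Z is"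
    and c: "\<And>v. vnorm n v = 1 \<Longrightarrow> \<bar>tinner n k Z (tpow k v)\<bar> \<le> c"
  shows "opnorm n k Z \<le> c"
proof -
  define m where "m u = tinner n k Z (outer k u)" for u
  have cont: "continuous_on A (\<lambda>u. \<bar>m u\<bar>)" for A
    unfolding m_def by (intro continuous_on_rabs continuous_on_tinner_outer)
  have "(\<lambda>l i. if l < k \<and> i = 0 then 1 else 0) \<in> unit_tuples n k"
  proof -
    have "vnorm n (\<lambda>i. if i = 0 then 1 else 0 :: real) = 1"
    proof -
      have "(\<Sum>i<n. (if i = 0 then 1 else 0 :: real)\<^sup>2) = (\<Sum>i<n. if i = 0 then 1 else 0)"
        by (intro sum.cong) auto
      then show ?thesis using n by (simp add: vnorm_def L2_set_def sum.delta)
    qed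
    then show ?thesis using n by (auto simp: in_unit_tuples_iff)
  qed
  then have ne: "unit_tuples n k \<noteq> {}" by auto
  obtain u0 where u0: "u0 \<in> unit_tuples n k" "\<And>u. u \<in> unit_tuples n k \<Longrightarrow> \<bar>m u\<bar> \<le> \<bar>m u0\<bar>"
    using continuous_attains_sup[OF compact_unit_tuples ne cont] by blast
  define M where "M = \<bar>m u0\<bar>"
  have M: "\<bar>tinner n k Z (outer k u)\<bar> \<le> M" if "u \<in> unit_tuples n k" for u
    using u0(2)[OF that] by (simp add: M_def m_def)
  \<comment> \<open>Aligning with a slot of a maximiser makes the largest total alignment at least
    1, so the chosen \<open>u\<close> has a slot that is not orthogonal to \<open>e\<close>. That
    slot is the reference for all others.\<close>
  define e where "e = u0 0"
  have e1: "vnorm n e = 1" using u0(1) k by (simp add: in_unit_tuples_iff e_def)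
  define K where "K = unit_tuples n k \<inter> {u. \<bar>m u\<bar> = M}"
  have "compact K" unfolding K_def
    by (intro compact_Int_closed compact_unit_tuples closed_Collect_eq cont continuous_on_const)
  moreover have "K \<noteq> {}" using u0(1) by (auto simp: K_def M_def)
  moreover have "continuous_on K (\<lambda>u. \<Sum>l<k. \<bar>vinner n (u l) e\<bar>)"
    unfolding vinner_def by (intro continuous_intros)
  ultimately obtain u where u: "u \<in> K"
      "\<And>u'. u' \<in> K \<Longrightarrow> (\<Sum>l<k. \<bar>vinner n (u' l) e\<bar>) \<le> (\<Sum>l<k. \<bar>vinner n (u l) e\<bar>)"
    using continuous_attains_sup[of K "\<lambda>u. \<Sum>l<k. \<bar>vinner n (u l) e\<bar>"] by blast
  have uK: "u \<in> unit_tuples n k" "\<bar>tinner n k Z (outer k u)\<bar> = M" using u(1) by (auto simp: K_def m_def)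
  have un: "vnorm n (u l) = 1" if "l < k" for l using uK(1) that by (simp add: in_unit_tuples_iff)
  have us: "u l x = 0" if "\<not> (l < k \<and> x < n)" for l x using uK(1) that by (auto simp: in_unit_tuples_iff)
  have "1 \<le> (\<Sum>l<k. \<bar>vinner n (u0 l) e\<bar>)"
  proof -
    have "\<bar>vinner n (u0 0) e\<bar> \<le> (\<Sum>l<k. \<bar>vinner n (u0 l) e\<bar>)" using k by (intro member_le_sum) auto
    then show ?thesis using e1 vnorm_power2[of n e] by (simp add: e_def)
  qed
  also have "\<dots> \<le> (\<Sum>l<k. \<bar>vinner n (u l) e\<bar>)" using u0(1) by (intro u(2)) (auto simp: K_def M_def)
  finally have "(\<Sum>l<k. \<bar>vinner n (u l) e\<bar>) \<noteq> 0" by linarith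
  then obtain i where i: "i < k" "vinner n (u i) e \<noteq> 0"
    by (metis (no_types, lifting) abs_zero lessThan_iff sum.neutral)
  have agree: "\<exists>s. u j = (\<lambda>x. s * u i x)" if j: "j < k" for j
  proof (cases "j = i")
    case True
    then show ?thesis by (intro exI[of _ 1]) simp
  next
    case False
    define \<alpha> where "\<alpha> = vinner n (u i) e"
    define \<beta> where "\<beta> = vinner n (u j) e"
    \<comment> \<open>The sign makes the two alignments add up, so that w is not 0 and its alignment
      is the full sum of absolute values.\<close>
    define s where "s = (if \<alpha> * \<beta> \<ge> 0 then 1 else - 1 :: real)"
    have s: "s = 1 \<or> s = -1" by (simp add: s_def)
    have \<alpha>0: "\<alpha> \<noteq> 0" using i by (simp add: \<alpha>_def)
    have "0 \<le> \<alpha> * (s * \<beta>)" by (simp add: s_def)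
    then have "\<bar>\<alpha> + s * \<beta>\<bar> = \<bar>\<alpha>\<bar> + \<bar>s * \<beta>\<bar>" by (auto simp: zero_le_mult_iff)
    moreover have "\<bar>s * \<beta>\<bar> = \<bar>\<beta>\<bar>" using s by auto
    ultimately have abs: "\<bar>\<alpha> + s * \<beta>\<bar> = \<bar>\<alpha>\<bar> + \<bar>\<beta>\<bar>" by simp
    define w where "w = (\<lambda>x. 1 * u i x + s * u j x)"
    have we: "vinner n w e = \<alpha> + s * \<beta>" unfolding w_def vinner_lincomb_left by (simp add: \<alpha>_def \<beta>_def)
    have w0: "vnorm n w \<noteq> 0"
    proof
      assume "vnorm n w = 0"
      then have "vinner n w e = 0" using vinner_le_vnorm[of n w e] by simp
      then show False using we abs \<alpha>0 by auto
    qed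
    then have wpos: "vnorm n w > 0" using vnorm_nonneg[of n w] by linarith
    define u' where "u' = u(i := normalize_vec n w, j := normalize_vec n w)"
    have "u' \<in> K"
      using symmetrize_slots[OF sym M uK i(1) j False[symmetric] s] w0
      unfolding u'_def K_def m_def w_def by auto
    then have le: "(\<Sum>l<k. \<bar>vinner n (u' l) e\<bar>) \<le> (\<Sum>l<k. \<bar>vinner n (u l) e\<bar>)" by (rule u(2))
    have split: "(\<Sum>l<k. f l) = f i + f j + (\<Sum>l\<in>{..<k} - {i} - {j}. f l)" for f :: "nat \<Rightarrow> real"
      using i(1) j False by (simp add: sum.remove[of _ i] sum.remove[of _ j])
    have "(\<Sum>l\<in>{..<k} - {i} - {j}. \<bar>vinner n (u' l) e\<bar>) = (\<Sum>l\<in>{..<k} - {i} - {j}. \<bar>vinner n (u l) e\<bar>)"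
      by (intro sum.cong) (auto simp: u'_def)
    then have "2 * (\<bar>vinner n w e\<bar> / vnorm n w) \<le> \<bar>\<alpha>\<bar> + \<bar>\<beta>\<bar>"
      using le False wpos unfolding split by (simp add: u'_def vinner_normalize \<alpha>_def \<beta>_def)
    then have "2 * (\<bar>\<alpha>\<bar> + \<bar>\<beta>\<bar>) \<le> (\<bar>\<alpha>\<bar> + \<bar>\<beta>\<bar>) * vnorm n w"
      unfolding we abs using wpos by (simp add: field_simps)
    then have "(\<bar>\<alpha>\<bar> + \<bar>\<beta>\<bar>) * 2 \<le> (\<bar>\<alpha>\<bar> + \<bar>\<beta>\<bar>) * vnorm n w" by (simp only: mult.commute[of 2])
    moreover have "\<bar>\<alpha>\<bar> + \<bar>\<beta>\<bar> > 0" using \<alpha>0 by linarith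
    ultimately have "2 \<le> vnorm n w" by (simp only: mult_le_cancel_left_pos)
    \<comment> \<open>Maximal alignment forces |w| >= 2, the largest length a sum of two unit
      vectors can have; the parallelogram law then leaves no room for the difference d.\<close>
    then have "2\<^sup>2 \<le> (vnorm n w)\<^sup>2" by (intro power_mono) auto
    then have w4: "4 \<le> (vnorm n w)\<^sup>2" by simp
    define d where "d = (\<lambda>x. 1 * u j x + (- s) * u i x)"
    have "(vnorm n w)\<^sup>2 + (vnorm n d)\<^sup>2 = 4"
      unfolding w_def d_def vnorm_lincomb_power2 using s un i(1) j
      by (auto simp: vinner_commute[of n "u j"])
    then have "(vnorm n d)\<^sup>2 \<le> 0" using w4 by linarith
    then have "vnorm n d = 0" by simp
    then have "\<forall>x<n. u j x = s * u i x" by (simp add: vnorm_zero_iff d_def)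
    then have "u j = (\<lambda>x. s * u i x)" using us by (metis mult_zero_right)
    then show ?thesis by blast
  qed
  then obtain s where s: "\<And>j. j < k \<Longrightarrow> u j = (\<lambda>x. s j * u i x)" by metis
  have s1: "\<bar>s j\<bar> = 1" if "j < k" for j
    using un[OF that] un[OF i(1)] unfolding s[OF that] vnorm_scale by simp
  have "outer k u is = (\<Prod>l<k. s l) * tpow k (u i) is" for "is"
    unfolding tpow_def outer_def prod.distrib[symmetric]
    by (intro prod.cong refl) (subst s, auto)
  then have "tinner n k Z (outer k u) = (\<Prod>l<k. s l) * tinner n k Z (tpow k (u i))"
    by (simp add: tinner_def sum_distrib_left mult_ac)
  then have "M = \<bar>tinner n k Z (tpow k (u i))\<bar>"
    using uK(2) s1 by (simp add: abs_mult abs_prod)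
  then have Mc: "M \<le> c" using c[OF un[OF i(1)]] by simp
  show ?thesis
  proof (rule opnorm_least)
    fix w assume w: "\<And>l. l < k \<Longrightarrow> vnorm n (w l) \<le> 1"
    have "tinner n k Z (outer k w) \<le> M * (\<Prod>l<k. vnorm n (w l))"
      using tinner_outer_le[OF M, of w] by simp
    also have "\<dots> \<le> M * 1"
      using w by (intro mult_left_mono prod_le_1) (auto simp: M_def)
    finally show "tinner n k Z (outer k w) \<le> c" using Mc by simp
  qed
qed

subsection \<open>Slepian's inequality\<close>

definition std_gauss :: "real measure" where
  "std_gauss = density lborel std_normal_density"

definition gauss :: "'i set \<Rightarrow> ('i \<Rightarrow> real) measure" where
  "gauss I = PiM I (\<lambda>_. std_gauss)"

lemma sets_std_gauss [simp, measurable_cong]: "sets std_gauss = sets borel"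
  by (simp add: std_gauss_def)

lemma space_std_gauss [simp]: "space std_gauss = UNIV"
  by (simp add: std_gauss_def)

lemma sets_gauss [measurable_cong]: "sets (gauss I) = sets (PiM I (\<lambda>_. borel))"
  unfolding gauss_def by (intro sets_PiM_cong) auto

lemma prob_space_std_gauss: "prob_space std_gauss"
  unfolding std_gauss_def by (rule prob_space_normal_density) simp

lemma prob_space_gauss: "prob_space (gauss I)"
  unfolding gauss_def by (intro prob_space_PiM prob_space_std_gauss)

section \<open>Gaussian integration by parts\<close>

lemma integral_std_gauss:
  "f \<in> borel_measurable borel \<Longrightarrow> integral\<^sup>L std_gauss f = (\<integral>x. std_normal_density x * f x \<partial>lborel)"
  for f :: "real \<Rightarrow> real"
  unfolding std_gauss_def by (intro integral_real_density) auto

lemma integrable_std_gauss_iff: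
  "f \<in> borel_measurable borel \<Longrightarrow> integrable std_gauss f \<longleftrightarrow> integrable lborel (\<lambda>x. std_normal_density x * f x)"
  for f :: "real \<Rightarrow> real"
  unfolding std_gauss_def by (intro integrable_real_density) auto

lemma integrable_abs_std_gauss: "integrable std_gauss (\<lambda>x. \<bar>x\<bar>)"
  using integrable_std_normal_moment_abs[of 1] by (simp add: integrable_std_gauss_iff)

lemma std_normal_density_bounded_tendsto_0:
  fixes f :: "real \<Rightarrow> real"
  assumes "\<And>x. \<bar>f x\<bar> \<le> K"
  shows "((\<lambda>x. std_normal_density x * f x) \<longlongrightarrow> 0) at_top" "((\<lambda>x. std_normal_density x * f x) \<longlongrightarrow> 0) at_bot"
proof -
  have 1: "(std_normal_density \<longlongrightarrow> 0) at_top" "(std_normal_density \<longlongrightarrow> 0) at_bot"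
    unfolding std_normal_density_def[abs_def] by real_asymp+
  have "norm (std_normal_density x * f x) \<le> std_normal_density x * K" for x
    unfolding norm_mult using assms[of x] by (simp add: mult_left_mono)
  then have 2: "eventually (\<lambda>x. norm (std_normal_density x * f x) \<le> std_normal_density x * K) F" for F
    by simp
  show "((\<lambda>x. std_normal_density x * f x) \<longlongrightarrow> 0) at_top" "((\<lambda>x. std_normal_density x * f x) \<longlongrightarrow> 0) at_bot"
    by (rule Lim_null_comparison[OF 2 tendsto_mult_left_zero[OF 1(1)]],
        rule Lim_null_comparison[OF 2 tendsto_mult_left_zero[OF 1(2)]])
qed

lemma bounded_borel_integrable:
  fixes f :: "'a \<Rightarrow> real"
  assumes "prob_space M" "f \<in> borel_measurable M" "\<And>x. \<bar>f x\<bar> \<le> K"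
  shows "integrable M f"
proof -
  interpret prob_space M by fact
  show ?thesis using assms by (intro integrable_const_bound[of _ K]) auto
qed

text \<open>The density satisfies \<phi>' = - x \<phi>, so \<phi> f' - x \<phi> f is the derivative
  of \<phi> f. Its integral over the line is a difference of limits at infinity, both 0 because f is
  bounded.\<close>

lemma stein_std_gauss:
  fixes f f' :: "real \<Rightarrow> real"
  assumes f: "\<And>x. (f has_real_derivative f' x) (at x)" and c: "continuous_on UNIV f'"
    and K: "\<And>x. \<bar>f x\<bar> \<le> K" and K': "\<And>x. \<bar>f' x\<bar> \<le> K'"
  shows "(\<integral>x. x * f x \<partial>std_gauss) = (\<integral>x. f' x \<partial>std_gauss)"
proof -
  let ?\<phi> = std_normal_density
  have cf: "continuous_on UNIV f" using f by (meson DERIV_continuous_on UNIV_I has_field_derivative_at_within)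
  have [measurable]: "f \<in> borel_measurable borel" "f' \<in> borel_measurable borel"
    using cf c by (auto intro: borel_measurable_continuous_onI)
  have i1: "integrable std_gauss (\<lambda>x. x * f x)"
  proof (rule Bochner_Integration.integrable_bound)
    show "integrable std_gauss (\<lambda>x. K * \<bar>x\<bar>)" using integrable_abs_std_gauss by simp
    have "\<bar>x\<bar> * \<bar>f x\<bar> \<le> \<bar>x\<bar> * K" for x by (intro mult_left_mono K) auto
    then show "AE x in std_gauss. norm (x * f x) \<le> norm (K * \<bar>x\<bar>)"
      using order_trans[OF abs_ge_zero K] by (auto simp: abs_mult mult.commute)
  qed auto
  have i2: "integrable std_gauss f'"
    using K' by (intro bounded_borel_integrable prob_space_std_gauss) auto
  let ?F = "\<lambda>x. ?\<phi> x * f x" and ?f = "\<lambda>x. ?\<phi> x * f' x - ?\<phi> x * (x * f x)"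
  have \<phi>': "(?\<phi> has_real_derivative (- x * ?\<phi> x)) (at x)" for x
  proof -
    have "((\<lambda>x. c * exp (- x\<^sup>2 / 2)) has_real_derivative (- x * (c * exp (- x\<^sup>2 / 2)))) (at x)" for c
      by (auto intro!: derivative_eq_intros simp: power2_eq_square)
    then show ?thesis unfolding std_normal_density_def[abs_def] .
  qed
  have c\<phi>: "isCont ?\<phi> x" for x using \<phi>' by (rule DERIV_isCont)
  have "(LBINT x=-\<infinity>..\<infinity>. ?f x) = 0 - 0"
  proof (rule interval_integral_FTC_integrable)
    fix x :: real
    have "(?F has_real_derivative ?f x) (at x)"
      by (rule derivative_eq_intros \<phi>' f refl)+ (simp add: algebra_simps)
    then show "(?F has_vector_derivative ?f x) (at x)" by (simp add: has_real_derivative_iff_has_vector_derivative)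
    show "isCont ?f x"
      using cf c c\<phi>[of x] by (intro continuous_intros) (auto simp: continuous_on_eq_continuous_at)
  next
    have "integrable lborel ?f"
      using i1 i2 by (intro Bochner_Integration.integrable_diff) (simp_all add: integrable_std_gauss_iff)
    then show "set_integrable lborel (einterval (-\<infinity>) \<infinity>) ?f" by (simp add: set_integrable_def)
  next
    show "((?F \<circ> real_of_ereal) \<longlongrightarrow> 0) (at_right (-\<infinity>))" "((?F \<circ> real_of_ereal) \<longlongrightarrow> 0) (at_left \<infinity>)"
      unfolding ereal_tendsto_simps1 using std_normal_density_bounded_tendsto_0[of f K] K by auto
  qed auto
  then have "(\<integral>x. ?f x \<partial>lborel) = 0"
    by (simp add: interval_lebesgue_integral_def set_lebesgue_integral_def)
  then show ?thesis using i1 i2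
    by (simp add: integrable_std_gauss_iff integral_std_gauss)
qed

lemma gauss_measurable_coord: "i \<in> I \<Longrightarrow> (\<lambda>g. g i) \<in> borel_measurable (gauss I)"
  by (simp add: measurable_cong_sets[OF sets_gauss refl])

lemma gauss_integrable_coord:
  assumes "i \<in> I"
  shows "integrable (gauss I) (\<lambda>g. \<bar>g i\<bar>)"
proof -
  have "distr (gauss I) std_gauss (\<lambda>g. g i) = std_gauss"
    unfolding gauss_def using assms by (intro distr_PiM_component prob_space_std_gauss)
  then have "integrable (distr (gauss I) std_gauss (\<lambda>g. g i)) (\<lambda>x. \<bar>x\<bar>)"
    using integrable_abs_std_gauss by simp
  then show ?thesis
    using assms by (subst (asm) integrable_distr_eq) (auto intro: gauss_measurable_coord simp: measurable_cong_sets[OF refl sets_std_gauss])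
qed

lemma gauss_integrable_mult_bounded:
  fixes F :: "('i \<Rightarrow> real) \<Rightarrow> real"
  assumes i: "i \<in> I" and F: "F \<in> borel_measurable (gauss I)" "\<And>g. \<bar>F g\<bar> \<le> K"
  shows "integrable (gauss I) (\<lambda>g. g i * F g)"
proof (rule Bochner_Integration.integrable_bound)
  show "integrable (gauss I) (\<lambda>g. K * \<bar>g i\<bar>)" using gauss_integrable_coord[OF i] by simp
  have "\<bar>g i\<bar> * \<bar>F g\<bar> \<le> \<bar>g i\<bar> * K" for g by (intro mult_left_mono F) auto
  then show "AE g in gauss I. norm (g i * F g) \<le> norm (K * \<bar>g i\<bar>)"
    using order_trans[OF abs_ge_zero F(2)] by (auto simp: abs_mult mult.commute)
qed (use F gauss_measurable_coord[OF i] in measurable)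

text \<open>Fubini isolates coordinate i, and the one-dimensional identity applies to the inner
  integral with the other coordinates frozen.\<close>

lemma stein_gauss:
  fixes F F' :: "('i \<Rightarrow> real) \<Rightarrow> real"
  assumes I: "finite I" "i \<in> I"
    and F: "F \<in> borel_measurable (gauss I)" "\<And>g. \<bar>F g\<bar> \<le> K"
    and F': "F' \<in> borel_measurable (gauss I)" "\<And>g. \<bar>F' g\<bar> \<le> K'"
    and der: "\<And>g x. ((\<lambda>x. F (g(i := x))) has_real_derivative F' (g(i := x))) (at x)"
    and cont: "\<And>g. continuous_on UNIV (\<lambda>x. F' (g(i := x)))"
  shows "(\<integral>g. g i * F g \<partial>gauss I) = (\<integral>g. F' g \<partial>gauss I)"
proof -
  interpret product_sigma_finite "\<lambda>_::'i. std_gauss"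
    using prob_space_std_gauss by (simp add: product_sigma_finite_def prob_space_imp_sigma_finite)
  define J where "J = I - {i}"
  have J: "I = insert i J" "finite J" "i \<notin> J" using I by (auto simp: J_def)
  have "(\<integral>g. g i * F g \<partial>gauss I) = (\<integral>g. (\<integral>x. (g(i := x)) i * F (g(i := x)) \<partial>std_gauss) \<partial>gauss J)"
    using gauss_integrable_mult_bounded[OF I(2) F] unfolding gauss_def J(1)
    by (intro product_integral_insert J)
  also have "\<dots> = (\<integral>g. (\<integral>x. F' (g(i := x)) \<partial>std_gauss) \<partial>gauss J)"
    using stein_std_gauss[OF der cont F(2) F'(2)] by simp
  also have "\<dots> = (\<integral>g. F' g \<partial>gauss I)"
    using bounded_borel_integrable[OF prob_space_gauss F'] unfolding gauss_def J(1)
    by (intro product_integral_insert[symmetric] J)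
  finally show ?thesis .
qed

text \<open>Differentiation under the integral. The mean value bound puts every difference quotient
  below \<open>w\<close>, and dominated convergence is applied along an arbitrary null sequence of
  increments.\<close>

lemma has_real_derivative_integral_dominated:
  fixes u u' :: "real \<Rightarrow> 'a \<Rightarrow> real"
  assumes der: "\<And>\<theta> x. ((\<lambda>t. u t x) has_real_derivative u' \<theta> x) (at \<theta>)"
    and bound: "\<And>\<theta> x. \<bar>u' \<theta> x\<bar> \<le> w x" and w: "integrable M w"
    and int: "\<And>\<theta>. integrable M (u \<theta>)" and meas: "\<And>\<theta>. u' \<theta> \<in> borel_measurable M"
  shows "((\<lambda>t. \<integral>x. u t x \<partial>M) has_real_derivative (\<integral>x. u' \<theta> x \<partial>M)) (at \<theta>)"
  unfolding DERIV_def tendsto_at_iff_sequentially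
proof (intro allI impI)
  fix X :: "nat \<Rightarrow> real"
  assume X: "\<forall>i. X i \<in> UNIV - {0}" "X \<longlonglongrightarrow> 0"
  have "(\<lambda>i. \<integral>x. (u (\<theta> + X i) x - u \<theta> x) / X i \<partial>M) \<longlonglongrightarrow> (\<integral>x. u' \<theta> x \<partial>M)"
  proof (rule integral_dominated_convergence[OF meas _ w])
    show "(\<lambda>x. (u (\<theta> + X i) x - u \<theta> x) / X i) \<in> borel_measurable M" for i
      using int[THEN borel_measurable_integrable] by measurable
    have "(\<lambda>i. (u (\<theta> + X i) x - u \<theta> x) / X i) \<longlonglongrightarrow> u' \<theta> x" for x
      using der[where \<theta> = \<theta> and x = x] X unfolding DERIV_def tendsto_at_iff_sequentially by (auto simp: o_def)
    then show "AE x in M. (\<lambda>i. (u (\<theta> + X i) x - u \<theta> x) / X i) \<longlonglongrightarrow> u' \<theta> x" by simp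
    have "\<bar>(u (\<theta> + X i) x - u \<theta> x) / X i\<bar> \<le> w x" for i x
    proof -
      have "norm (u (\<theta> + X i) x - u \<theta> x) \<le> w x * norm (\<theta> + X i - \<theta>)"
        by (rule field_differentiable_bound[of UNIV "\<lambda>t. u t x" "\<lambda>t. u' t x"])
          (use der bound in auto)
      then show ?thesis using X by (simp add: field_simps)
    qed
    then show "AE x in M. norm ((u (\<theta> + X i) x - u \<theta> x) / X i) \<le> w x" for i by simp
  qed
  then show "((\<lambda>h. ((\<integral>x. u (\<theta> + h) x \<partial>M) - (\<integral>x. u \<theta> x \<partial>M)) / h) \<circ> X) \<longlonglongrightarrow> (\<integral>x. u' \<theta> x \<partial>M)"
    using int by (simp add: o_def)
qed

lemma prod_unit_interval:
  fixes f :: "'a \<Rightarrow> real"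
  assumes "\<And>x. x \<in> A \<Longrightarrow> 0 \<le> f x \<and> f x \<le> 1"
  shows "0 \<le> prod f A" "prod f A \<le> 1"
  using assms by (auto intro!: prod_nonneg prod_le_1)

text \<open>
  Gaussian interpolation: along \<open>cos \<theta> A + sin \<theta> B\<close> the derivative is, by Stein's identity,
  a combination of the mixed second derivatives of the product, which are nonnegative, with
  coefficients proportional to the covariance differences.
\<close>

lemma slepian_smooth:
  fixes A B :: "'v \<Rightarrow> 'i \<Rightarrow> real" and \<psi> \<psi>' \<psi>'' :: "real \<Rightarrow> real"
  assumes I: "finite I" and W: "finite W"
    and orth: "\<And>v w. v \<in> W \<Longrightarrow> w \<in> W \<Longrightarrow> (\<Sum>i\<in>I. A v i * B w i) = 0"
    and var: "\<And>v. v \<in> W \<Longrightarrow> (\<Sum>i\<in>I. A v i * A v i) = (\<Sum>i\<in>I. B v i * B v i)"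
    and cov: "\<And>v w. v \<in> W \<Longrightarrow> w \<in> W \<Longrightarrow> (\<Sum>i\<in>I. B v i * B w i) \<le> (\<Sum>i\<in>I. A v i * A w i)"
    and \<psi>: "\<And>x. (\<psi> has_real_derivative \<psi>' x) (at x)" and \<psi>': "\<And>x. (\<psi>' has_real_derivative \<psi>'' x) (at x)"
    and \<psi>'': "continuous_on UNIV \<psi>''"
    and b: "\<And>x. 0 \<le> \<psi> x \<and> \<psi> x \<le> 1" and b': "\<And>x. \<psi>' x \<le> 0 \<and> \<bar>\<psi>' x\<bar> \<le> K" and b'': "\<And>x. \<bar>\<psi>'' x\<bar> \<le> K"
  shows "(\<integral>g. (\<Prod>v\<in>W. \<psi> (\<Sum>i\<in>I. B v i * g i)) \<partial>gauss I) \<le> (\<integral>g. (\<Prod>v\<in>W. \<psi> (\<Sum>i\<in>I. A v i * g i)) \<partial>gauss I)"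
proof -
  \<comment> \<open>Both processes are linear forms in one Gaussian vector, and orthogonality of the
    coefficients expresses their independence. The rotation runs from \<open>A\<close> at 0 to
    \<open>B\<close> at pi / 2; \<open>D\<close> is the derivative of \<open>C\<close> in
    \<theta>.\<close>
  define C where "C \<theta> v i = cos \<theta> * A v i + sin \<theta> * B v i" for \<theta> v i
  define D where "D \<theta> v i = cos \<theta> * B v i - sin \<theta> * A v i" for \<theta> v i
  define L where "L \<theta> v g = (\<Sum>i\<in>I. C \<theta> v i * g i)" for \<theta> v and g :: "'i \<Rightarrow> real"
  define F where "F \<theta> v g = \<psi>' (L \<theta> v g) * (\<Prod>w\<in>W - {v}. \<psi> (L \<theta> w g))" for \<theta> v g
  \<comment> \<open>\<open>P\<close> and \<open>Q\<close> are the pure and the mixed second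
    derivatives of the product. Only \<open>Q\<close> has a sign, as a product of two nonpositive
    slopes; \<open>P\<close> has none and must drop out through the equal variances.\<close>
  define P where "P \<theta> v g = \<psi>'' (L \<theta> v g) * (\<Prod>w\<in>W - {v}. \<psi> (L \<theta> w g))" for \<theta> v g
  define Q where "Q \<theta> v w g = \<psi>' (L \<theta> v g) * (\<psi>' (L \<theta> w g) * (\<Prod>x\<in>W - {v} - {w}. \<psi> (L \<theta> x g)))" for \<theta> v w g
  define u where "u \<theta> g = (\<Prod>v\<in>W. \<psi> (L \<theta> v g))" for \<theta> g
  define u' where "u' \<theta> g = (\<Sum>v\<in>W. \<Sum>i\<in>I. D \<theta> v i * (g i * F \<theta> v g))" for \<theta> g
  have b'2: "\<bar>\<psi>' x\<bar> \<le> K" for x by (rule b'[THEN conjunct2])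
  have K0: "K \<ge> 0" using b'[of 0] by linarith
  have [measurable]: "\<psi> \<in> borel_measurable borel" "\<psi>' \<in> borel_measurable borel" "\<psi>'' \<in> borel_measurable borel"
    using \<psi> \<psi>' \<psi>'' by (auto intro!: borel_measurable_continuous_onI
      intro: DERIV_continuous_on has_field_derivative_at_within)
  have Lm [measurable]: "L \<theta> v \<in> borel_measurable (gauss I)" for \<theta> v
    unfolding L_def using gauss_measurable_coord by (intro borel_measurable_sum borel_measurable_times) auto
  have Fm [measurable]: "F \<theta> v \<in> borel_measurable (gauss I)" for \<theta> v unfolding F_def by measurable
  have Pm [measurable]: "P \<theta> v \<in> borel_measurable (gauss I)" for \<theta> v unfolding P_def by measurable
  have Qm [measurable]: "Q \<theta> v w \<in> borel_measurable (gauss I)" for \<theta> v w unfolding Q_def by measurable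
  have um [measurable]: "u \<theta> \<in> borel_measurable (gauss I)" for \<theta> unfolding u_def by measurable
  have u'm [measurable]: "u' \<theta> \<in> borel_measurable (gauss I)" for \<theta>
    unfolding u'_def using gauss_measurable_coord Fm
    by (intro borel_measurable_sum borel_measurable_times) auto
  have pb: "0 \<le> (\<Prod>w\<in>V. \<psi> (L \<theta> w g))" "(\<Prod>w\<in>V. \<psi> (L \<theta> w g)) \<le> 1" for V \<theta> g
    using b by (auto intro!: prod_unit_interval)
  have ub: "\<bar>u \<theta> g\<bar> \<le> 1" for \<theta> g using pb[of \<theta> g W] by (simp add: u_def)
  have Fb: "\<bar>F \<theta> v g\<bar> \<le> K" for \<theta> v g
    using mult_mono[OF b'[THEN conjunct2] pb(2) K0 pb(1)] pb(1) by (simp add: F_def abs_mult)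
  have Pb: "\<bar>P \<theta> v g\<bar> \<le> K" for \<theta> v g
    using mult_mono[OF b'' pb(2) K0 pb(1)] pb(1) by (simp add: P_def abs_mult)
  have Qb: "\<bar>Q \<theta> v w g\<bar> \<le> K * K" for \<theta> v w g
  proof -
    have "\<bar>\<psi>' (L \<theta> w g)\<bar> * (\<Prod>x\<in>W - {v} - {w}. \<psi> (L \<theta> x g)) \<le> K * 1"
      by (intro mult_mono) (simp_all add: b'2 pb K0)
    then have "\<bar>\<psi>' (L \<theta> v g)\<bar> * (\<bar>\<psi>' (L \<theta> w g)\<bar> * (\<Prod>x\<in>W - {v} - {w}. \<psi> (L \<theta> x g))) \<le> K * (K * 1)"
      by (intro mult_mono) (simp_all add: b'2 pb K0)
    then show ?thesis using pb(1)[of \<theta> g "W - {v} - {w}"] by (simp add: Q_def abs_mult)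
  qed
  have Qn: "Q \<theta> v w g \<ge> 0" for \<theta> v w g
  proof -
    have "\<psi>' (L \<theta> v g) * \<psi>' (L \<theta> w g) \<ge> 0" using b' by (intro mult_nonpos_nonpos) auto
    then show ?thesis using pb(1)[of \<theta> g "W - {v} - {w}"]
      by (simp add: Q_def mult.assoc[symmetric])
  qed
  have Lder: "((\<lambda>t. L t v g) has_real_derivative (\<Sum>i\<in>I. D \<theta> v i * g i)) (at \<theta>)" for \<theta> v g
    unfolding L_def C_def D_def by (auto intro!: derivative_eq_intros sum.cong simp: algebra_simps)
  have uder: "((\<lambda>t. u t g) has_real_derivative u' \<theta> g) (at \<theta>)" for \<theta> g
  proof -
    have "((\<lambda>t. \<psi> (L t v g)) has_real_derivative \<psi>' (L \<theta> v g) * (\<Sum>i\<in>I. D \<theta> v i * g i)) (at \<theta>)" for v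
      using DERIV_chain2[OF \<psi> Lder] .
    then have "((\<lambda>t. u t g) has_real_derivative
        (\<Sum>v\<in>W. \<psi>' (L \<theta> v g) * (\<Sum>i\<in>I. D \<theta> v i * g i) * (\<Prod>w\<in>W - {v}. \<psi> (L \<theta> w g)))) (at \<theta>)"
      unfolding u_def by (intro has_field_derivative_prod) auto
    then show ?thesis by (simp add: u'_def F_def sum_distrib_left sum_distrib_right mult_ac)
  qed
  \<comment> \<open>A majorant of the derivative that is free of \<theta>: sine and cosine are at
    most 1, and the Gaussian coordinates have finite first absolute moments.\<close>
  define bd where "bd g = (\<Sum>v\<in>W. \<Sum>i\<in>I. (\<bar>A v i\<bar> + \<bar>B v i\<bar>) * (\<bar>g i\<bar> * K))" for g :: "'i \<Rightarrow> real"
  have "integrable (gauss I) bd"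
    unfolding bd_def
    by (intro Bochner_Integration.integrable_sum integrable_mult_right integrable_mult_left gauss_integrable_coord)
  moreover have "\<bar>u' \<theta> g\<bar> \<le> bd g" for \<theta> g
  proof -
    have "\<bar>D \<theta> v i\<bar> \<le> \<bar>A v i\<bar> + \<bar>B v i\<bar>" for v i
    proof -
      have "\<bar>cos \<theta> * B v i\<bar> \<le> 1 * \<bar>B v i\<bar>" "\<bar>sin \<theta> * A v i\<bar> \<le> 1 * \<bar>A v i\<bar>"
        unfolding abs_mult by (intro mult_right_mono; simp)+
      then show ?thesis unfolding D_def by linarith
    qed
    then have "\<bar>D \<theta> v i * (g i * F \<theta> v g)\<bar> \<le> (\<bar>A v i\<bar> + \<bar>B v i\<bar>) * (\<bar>g i\<bar> * K)" for v i
      unfolding abs_mult using Fb by (intro mult_mono) auto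
    then show ?thesis
      unfolding u'_def bd_def by (intro order_trans[OF sum_abs] sum_mono)
  qed
  ultimately have phider: "((\<lambda>t. \<integral>g. u t g \<partial>gauss I) has_real_derivative (\<integral>g. u' \<theta> g \<partial>gauss I)) (at \<theta>)" for \<theta>
    by (intro has_real_derivative_integral_dominated[where w = bd] uder u'm
      bounded_borel_integrable[OF prob_space_gauss um ub])
  have stein: "(\<integral>g. g i * F \<theta> v g \<partial>gauss I) =
      C \<theta> v i * (\<integral>g. P \<theta> v g \<partial>gauss I) + (\<Sum>w\<in>W - {v}. C \<theta> w i * (\<integral>g. Q \<theta> v w g \<partial>gauss I))"
    if i: "i \<in> I" for i \<theta> v
  proof -
    define F' where "F' g = C \<theta> v i * P \<theta> v g + (\<Sum>w\<in>W - {v}. C \<theta> w i * Q \<theta> v w g)" for g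
    have F'm: "F' \<in> borel_measurable (gauss I)" unfolding F'_def by measurable
    have Lup: "L \<theta> w (g(i := x)) = C \<theta> w i * x + (\<Sum>j\<in>I - {i}. C \<theta> w j * g j)" for w g x
    proof -
      have "L \<theta> w (g(i := x)) = C \<theta> w i * x + (\<Sum>j\<in>I - {i}. C \<theta> w j * (g(i := x)) j)"
        unfolding L_def using I i by (subst sum.remove[of _ i]) auto
      also have "(\<Sum>j\<in>I - {i}. C \<theta> w j * (g(i := x)) j) = (\<Sum>j\<in>I - {i}. C \<theta> w j * g j)"
        by (intro sum.cong) auto
      finally show ?thesis .
    qed
    have Li: "((\<lambda>x. L \<theta> w (g(i := x))) has_real_derivative C \<theta> w i) (at x)" for w g x
      unfolding Lup by (auto intro!: derivative_eq_intros)
    have "(\<integral>g. g i * F \<theta> v g \<partial>gauss I) = (\<integral>g. F' g \<partial>gauss I)"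
    proof (rule stein_gauss[OF I i Fm Fb F'm])
      have "\<bar>F' g\<bar> \<le> \<bar>C \<theta> v i\<bar> * K + (\<Sum>w\<in>W - {v}. \<bar>C \<theta> w i\<bar> * (K * K))" for g
      proof -
        have "\<bar>F' g\<bar> \<le> \<bar>C \<theta> v i * P \<theta> v g\<bar> + \<bar>\<Sum>w\<in>W - {v}. C \<theta> w i * Q \<theta> v w g\<bar>"
          unfolding F'_def by (rule abs_triangle_ineq)
        also have "\<dots> \<le> \<bar>C \<theta> v i\<bar> * \<bar>P \<theta> v g\<bar> + (\<Sum>w\<in>W - {v}. \<bar>C \<theta> w i\<bar> * \<bar>Q \<theta> v w g\<bar>)"
          using sum_abs[of "\<lambda>w. C \<theta> w i * Q \<theta> v w g" "W - {v}"] by (simp add: abs_mult)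
        also have "\<dots> \<le> \<bar>C \<theta> v i\<bar> * K + (\<Sum>w\<in>W - {v}. \<bar>C \<theta> w i\<bar> * (K * K))"
          by (intro add_mono sum_mono mult_left_mono Pb Qb) auto
        finally show ?thesis .
      qed
      then show "\<bar>F' g\<bar> \<le> \<bar>C \<theta> v i\<bar> * K + (\<Sum>w\<in>W - {v}. \<bar>C \<theta> w i\<bar> * (K * K))" for g .
      fix g :: "'i \<Rightarrow> real"
      have "continuous_on UNIV (\<lambda>x. L \<theta> w (g(i := x)))" for w
        unfolding Lup by (intro continuous_intros)
      then have "continuous_on UNIV (\<lambda>x. f (L \<theta> w (g(i := x))))" if "continuous_on UNIV f" for w and f :: "real \<Rightarrow> real"
        using continuous_on_compose2[OF that] by auto
      moreover have "continuous_on UNIV \<psi>" "continuous_on UNIV \<psi>'"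
        using \<psi> \<psi>' by (auto intro: DERIV_continuous_on has_field_derivative_at_within)
      ultimately show "continuous_on UNIV (\<lambda>x. F' (g(i := x)))"
        unfolding F'_def P_def Q_def using \<psi>'' by (intro continuous_intros) auto
      fix x :: real
      have d1: "((\<lambda>x. \<psi>' (L \<theta> v (g(i := x)))) has_real_derivative \<psi>'' (L \<theta> v (g(i := x))) * C \<theta> v i) (at x)"
        by (rule DERIV_chain2[OF \<psi>' Li])
      have d2: "((\<lambda>x. \<psi> (L \<theta> w (g(i := x)))) has_real_derivative \<psi>' (L \<theta> w (g(i := x))) * C \<theta> w i) (at x)" for w
        by (rule DERIV_chain2[OF \<psi> Li])
      have "((\<lambda>x. F \<theta> v (g(i := x))) has_real_derivative
          \<psi>'' (L \<theta> v (g(i := x))) * C \<theta> v i * (\<Prod>w\<in>W - {v}. \<psi> (L \<theta> w (g(i := x)))) +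
          (\<Sum>w\<in>W - {v}. \<psi>' (L \<theta> w (g(i := x))) * C \<theta> w i * (\<Prod>y\<in>W - {v} - {w}. \<psi> (L \<theta> y (g(i := x))))) *
            \<psi>' (L \<theta> v (g(i := x)))) (at x)"
        unfolding F_def by (rule DERIV_mult[OF d1 has_field_derivative_prod]) (rule d2)
      then show "((\<lambda>x. F \<theta> v (g(i := x))) has_real_derivative F' (g(i := x))) (at x)"
        by (rule DERIV_cong, unfold F'_def P_def Q_def sum_distrib_right)
          (intro arg_cong2[where f = "(+)"] sum.cong refl; simp only: mult_ac)
    qed
    also have "\<dots> = C \<theta> v i * (\<integral>g. P \<theta> v g \<partial>gauss I) + (\<Sum>w\<in>W - {v}. C \<theta> w i * (\<integral>g. Q \<theta> v w g \<partial>gauss I))"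
    proof -
      have "integrable (gauss I) (P \<theta> v)" "\<And>w. integrable (gauss I) (Q \<theta> v w)"
        by (rule bounded_borel_integrable[OF prob_space_gauss Pm Pb] bounded_borel_integrable[OF prob_space_gauss Qm Qb])+
      then show ?thesis unfolding F'_def by simp
    qed
    finally show ?thesis .
  qed
  \<comment> \<open>Orthogonality kills the cos^2 and sin^2 terms. What remains is the covariance
    difference, which is 0 on the diagonal, times sin \<theta> cos \<theta>, which is nonnegative on
    the quarter turn from 0 to pi / 2.\<close>
  have DC: "(\<Sum>i\<in>I. D \<theta> v i * C \<theta> w i) = sin \<theta> * cos \<theta> * ((\<Sum>i\<in>I. B v i * B w i) - (\<Sum>i\<in>I. A v i * A w i))"
    if "v \<in> W" "w \<in> W" for v w \<theta>
  proof -
    have "(\<Sum>i\<in>I. D \<theta> v i * C \<theta> w i) = sin \<theta> * cos \<theta> * (\<Sum>i\<in>I. B v i * B w i) - sin \<theta> * cos \<theta> * (\<Sum>i\<in>I. A v i * A w i)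
        + cos \<theta> * cos \<theta> * (\<Sum>i\<in>I. A w i * B v i) - sin \<theta> * sin \<theta> * (\<Sum>i\<in>I. A v i * B w i)"
      unfolding C_def D_def sum_distrib_left sum.distrib[symmetric] sum_subtractf[symmetric]
      by (intro sum.cong) (auto simp: algebra_simps)
    then show ?thesis using orth that by (simp add: algebra_simps)
  qed
  have neg: "(\<integral>g. u' \<theta> g \<partial>gauss I) \<le> 0" if \<theta>: "0 \<le> \<theta>" "\<theta> \<le> pi / 2" for \<theta>
  proof -
    have sc: "sin \<theta> * cos \<theta> \<ge> 0" using \<theta> by (intro mult_nonneg_nonneg sin_ge_zero cos_ge_zero) auto
    have int: "integrable (gauss I) (\<lambda>g. g i * F \<theta> v g)" if "i \<in> I" for i v
      by (rule gauss_integrable_mult_bounded[OF that Fm Fb])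
    have "(\<integral>g. u' \<theta> g \<partial>gauss I) = (\<Sum>v\<in>W. \<Sum>i\<in>I. D \<theta> v i * (\<integral>g. g i * F \<theta> v g \<partial>gauss I))"
      unfolding u'_def using int by (subst Bochner_Integration.integral_sum | simp)+
    also have "\<dots> = (\<Sum>v\<in>W. (\<Sum>i\<in>I. D \<theta> v i * C \<theta> v i) * (\<integral>g. P \<theta> v g \<partial>gauss I) +
        (\<Sum>w\<in>W - {v}. (\<Sum>i\<in>I. D \<theta> v i * C \<theta> w i) * (\<integral>g. Q \<theta> v w g \<partial>gauss I)))"
    proof (intro sum.cong refl)
      fix v
      have "(\<Sum>i\<in>I. D \<theta> v i * (\<integral>g. g i * F \<theta> v g \<partial>gauss I)) =
          (\<Sum>i\<in>I. D \<theta> v i * C \<theta> v i * (\<integral>g. P \<theta> v g \<partial>gauss I) +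
            (\<Sum>w\<in>W - {v}. D \<theta> v i * C \<theta> w i * (\<integral>g. Q \<theta> v w g \<partial>gauss I)))"
        by (intro sum.cong refl) (simp add: stein sum_distrib_left algebra_simps)
      also have "\<dots> = (\<Sum>i\<in>I. D \<theta> v i * C \<theta> v i) * (\<integral>g. P \<theta> v g \<partial>gauss I) +
          (\<Sum>w\<in>W - {v}. (\<Sum>i\<in>I. D \<theta> v i * C \<theta> w i) * (\<integral>g. Q \<theta> v w g \<partial>gauss I))"
        by (simp add: sum.distrib sum_distrib_right sum.swap[of _ "W - {v}" I])
      finally show "(\<Sum>i\<in>I. D \<theta> v i * (\<integral>g. g i * F \<theta> v g \<partial>gauss I)) =
          (\<Sum>i\<in>I. D \<theta> v i * C \<theta> v i) * (\<integral>g. P \<theta> v g \<partial>gauss I) +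
          (\<Sum>w\<in>W - {v}. (\<Sum>i\<in>I. D \<theta> v i * C \<theta> w i) * (\<integral>g. Q \<theta> v w g \<partial>gauss I))" .
    qed
    also have "\<dots> \<le> 0"
    proof (rule sum_nonpos)
      fix v assume v: "v \<in> W"
      have "(\<Sum>i\<in>I. D \<theta> v i * C \<theta> v i) = 0" using DC[OF v v] var[OF v] by simp
      moreover have "(\<Sum>w\<in>W - {v}. (\<Sum>i\<in>I. D \<theta> v i * C \<theta> w i) * (\<integral>g. Q \<theta> v w g \<partial>gauss I)) \<le> 0"
      proof (rule sum_nonpos)
        fix w assume w: "w \<in> W - {v}"
        have "(\<Sum>i\<in>I. D \<theta> v i * C \<theta> w i) \<le> 0"
          using DC[OF v, of w \<theta>] w cov[OF v, of w] sc by (auto intro: mult_nonneg_nonpos)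
        moreover have "0 \<le> (\<integral>g. Q \<theta> v w g \<partial>gauss I)" using Qn by simp
        ultimately show "(\<Sum>i\<in>I. D \<theta> v i * C \<theta> w i) * (\<integral>g. Q \<theta> v w g \<partial>gauss I) \<le> 0"
          by (rule mult_nonpos_nonneg)
      qed
      ultimately show "(\<Sum>i\<in>I. D \<theta> v i * C \<theta> v i) * (\<integral>g. P \<theta> v g \<partial>gauss I) +
          (\<Sum>w\<in>W - {v}. (\<Sum>i\<in>I. D \<theta> v i * C \<theta> w i) * (\<integral>g. Q \<theta> v w g \<partial>gauss I)) \<le> 0" by simp
    qed
    finally show ?thesis .
  qed
  have "(\<integral>g. u (pi / 2) g \<partial>gauss I) \<le> (\<integral>g. u 0 g \<partial>gauss I)"
    by (rule DERIV_nonpos_imp_nonincreasing[of 0 "pi / 2"]) (use phider neg in \<open>auto intro!: exI\<close>)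
  then show ?thesis by (simp add: u_def L_def C_def)
qed

text \<open>A smooth decreasing substitute for the indicator of x < t, with steepness m. All its
  derivatives are polynomials in the function itself, which makes the bounds for the interpolation
  immediate.\<close>

definition logistic :: "real \<Rightarrow> real \<Rightarrow> real \<Rightarrow> real" where
  "logistic t m x = 1 / (1 + exp (m * (x - t)))"

lemma logistic_bounds: "0 < logistic t m x" "logistic t m x < 1"
  by (auto simp: logistic_def add_pos_pos)

lemma logistic_deriv:
  "(logistic t m has_real_derivative - m * (logistic t m x * (1 - logistic t m x))) (at x)"
proof -
  have 1: "1 + exp (m * (x - t)) \<noteq> 0" by (smt (verit) exp_gt_zero)
  have "(logistic t m has_real_derivative - (exp (m * (x - t)) * m) / (1 + exp (m * (x - t)))\<^sup>2) (at x)"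
    unfolding logistic_def[abs_def] using 1
    by (auto intro!: derivative_eq_intros simp: power2_eq_square)
  also have "- (exp (m * (x - t)) * m) / (1 + exp (m * (x - t)))\<^sup>2 = - m * (logistic t m x * (1 - logistic t m x))"
    using 1 by (simp add: logistic_def field_simps power2_eq_square)
  finally show ?thesis .
qed

lemma logistic_tendsto:
  "(\<lambda>j. logistic t (real (Suc j)) x) \<longlonglongrightarrow> (if x < t then 1 else if x = t then 1 / 2 else 0)"
proof -
  define c where "c = x - t"
  consider "c < 0" | "c = 0" | "c > 0" by linarith
  then have "(\<lambda>j. 1 / (1 + exp (real (Suc j) * c))) \<longlonglongrightarrow> (if c < 0 then 1 else if c = 0 then 1 / 2 else 0)"
  proof cases
    case 1
    then have "(\<lambda>j. 1 / (1 + exp (real (Suc j) * c))) \<longlonglongrightarrow> 1" by real_asymp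
    then show ?thesis using 1 by simp
  next
    case 3
    then have "(\<lambda>j. 1 / (1 + exp (real (Suc j) * c))) \<longlonglongrightarrow> 0" by real_asymp
    then show ?thesis using 3 by simp
  qed simp
  moreover have "(if c < 0 then 1 else if c = 0 then 1 / 2 else 0 :: real) =
      (if x < t then 1 else if x = t then 1 / 2 else 0)" by (simp add: c_def)
  ultimately show ?thesis unfolding logistic_def c_def by simp
qed

lemma gauss_measurable_linear:
  "(\<lambda>g. \<Sum>i\<in>I. a i * g i) \<in> borel_measurable (gauss I)"
  using gauss_measurable_coord by (intro borel_measurable_sum borel_measurable_times) auto

text \<open>As the steepness grows, the smooth product tends to one whose factors are 1 below t, 1/2
  at t and 0 above. It lies between the indicators of the strict and the weak event, which is why
  the two sides carry < and <=.\<close>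

lemma slepian:
  fixes A B :: "'v \<Rightarrow> 'i \<Rightarrow> real"
  assumes I: "finite I" and W: "finite W"
    and orth: "\<And>v w. v \<in> W \<Longrightarrow> w \<in> W \<Longrightarrow> (\<Sum>i\<in>I. A v i * B w i) = 0"
    and var: "\<And>v. v \<in> W \<Longrightarrow> (\<Sum>i\<in>I. A v i * A v i) = (\<Sum>i\<in>I. B v i * B v i)"
    and cov: "\<And>v w. v \<in> W \<Longrightarrow> w \<in> W \<Longrightarrow> (\<Sum>i\<in>I. B v i * B w i) \<le> (\<Sum>i\<in>I. A v i * A w i)"
  shows "measure (gauss I) {g \<in> space (gauss I). \<forall>v\<in>W. (\<Sum>i\<in>I. B v i * g i) < t} \<le>
    measure (gauss I) {g \<in> space (gauss I). \<forall>v\<in>W. (\<Sum>i\<in>I. A v i * g i) \<le> t}"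
proof -
  interpret prob_space "gauss I" by (rule prob_space_gauss)
  define h where "h x = (if x < t then 1 else if x = t then 1 / 2 else 0 :: real)" for x
  have hm [measurable]: "h \<in> borel_measurable borel" unfolding h_def[abs_def] by measurable
  have sm [measurable]: "logistic t m \<in> borel_measurable borel" for m
    unfolding logistic_def[abs_def] by measurable
  have h01: "0 \<le> h x \<and> h x \<le> 1" for x by (simp add: h_def)
  have lim: "(\<lambda>j. \<integral>g. (\<Prod>v\<in>W. logistic t (real (Suc j)) (\<Sum>i\<in>I. C v i * g i)) \<partial>gauss I)
      \<longlonglongrightarrow> (\<integral>g. (\<Prod>v\<in>W. h (\<Sum>i\<in>I. C v i * g i)) \<partial>gauss I)" for C :: "'v \<Rightarrow> 'i \<Rightarrow> real"
  proof (rule integral_dominated_convergence[where w = "\<lambda>_. 1"])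
    note [measurable] = gauss_measurable_linear
    show "(\<lambda>g. \<Prod>v\<in>W. h (\<Sum>i\<in>I. C v i * g i)) \<in> borel_measurable (gauss I)" by measurable
    show "(\<lambda>g. \<Prod>v\<in>W. logistic t (real (Suc j)) (\<Sum>i\<in>I. C v i * g i)) \<in> borel_measurable (gauss I)" for j
      by measurable
    show "AE g in gauss I. (\<lambda>j. \<Prod>v\<in>W. logistic t (real (Suc j)) (\<Sum>i\<in>I. C v i * g i))
        \<longlonglongrightarrow> (\<Prod>v\<in>W. h (\<Sum>i\<in>I. C v i * g i))"
      unfolding h_def by (intro AE_I2 tendsto_prod logistic_tendsto)
    have "0 \<le> (\<Prod>v\<in>W. logistic t (real (Suc j)) (\<Sum>i\<in>I. C v i * g i))"
      "(\<Prod>v\<in>W. logistic t (real (Suc j)) (\<Sum>i\<in>I. C v i * g i)) \<le> 1" for j g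
      by (intro prod_unit_interval conjI less_imp_le logistic_bounds)+
    then show "AE g in gauss I. norm (\<Prod>v\<in>W. logistic t (real (Suc j)) (\<Sum>i\<in>I. C v i * g i)) \<le> 1" for j
      by simp
  qed simp
  have le: "(\<integral>g. (\<Prod>v\<in>W. h (\<Sum>i\<in>I. B v i * g i)) \<partial>gauss I) \<le> (\<integral>g. (\<Prod>v\<in>W. h (\<Sum>i\<in>I. A v i * g i)) \<partial>gauss I)"
  proof (rule LIMSEQ_le[OF lim lim], intro exI allI impI)
    fix j :: nat
    define m where "m = real (Suc j)"
    let ?s = "logistic t m"
    have m: "m > 0" by (simp add: m_def)
    have sb: "0 \<le> ?s x * (1 - ?s x)" "?s x * (1 - ?s x) \<le> 1" for x
      using logistic_bounds[of t m x] mult_mono[of "?s x" 1 "1 - ?s x" 1] by auto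
    have sc: "continuous_on UNIV ?s"
      by (rule DERIV_continuous_on[OF has_field_derivative_at_within[OF logistic_deriv]])
    show "(\<integral>g. (\<Prod>v\<in>W. logistic t (real (Suc j)) (\<Sum>i\<in>I. B v i * g i)) \<partial>gauss I)
        \<le> (\<integral>g. (\<Prod>v\<in>W. logistic t (real (Suc j)) (\<Sum>i\<in>I. A v i * g i)) \<partial>gauss I)"
      unfolding m_def[symmetric]
    \<comment> \<open>With \<sigma> the logistic function, \<sigma>' = - m \<sigma> (1 - \<sigma>)
      gives \<sigma>'' = m^2 \<sigma> (1 - \<sigma>) (1 - 2 \<sigma>); the sum m + m^2 bounds both
      in modulus.\<close>
    proof (rule slepian_smooth[OF I W orth var cov logistic_deriv,
          where \<psi>'' = "\<lambda>x. m\<^sup>2 * (?s x * (1 - ?s x)) * (1 - 2 * ?s x)" and K = "m + m\<^sup>2"])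
      fix x
      show "((\<lambda>x. - m * (?s x * (1 - ?s x))) has_real_derivative m\<^sup>2 * (?s x * (1 - ?s x)) * (1 - 2 * ?s x)) (at x)"
        by (rule derivative_eq_intros logistic_deriv refl)+ (simp add: algebra_simps power2_eq_square)
      show "continuous_on UNIV (\<lambda>x. m\<^sup>2 * (?s x * (1 - ?s x)) * (1 - 2 * ?s x))"
        by (intro continuous_intros sc)
      show "0 \<le> ?s x \<and> ?s x \<le> 1" using logistic_bounds[of t m x] by simp
      have "m * (?s x * (1 - ?s x)) \<le> m * 1" by (rule mult_left_mono[OF sb(2)]) (use m in simp)
      moreover have "0 \<le> m * (?s x * (1 - ?s x))" by (rule mult_nonneg_nonneg[OF _ sb(1)]) (use m in simp)
      moreover have "0 \<le> m\<^sup>2" by simp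
      ultimately show "- m * (?s x * (1 - ?s x)) \<le> 0 \<and> \<bar>- m * (?s x * (1 - ?s x))\<bar> \<le> m + m\<^sup>2"
        unfolding mult_minus_left by linarith
      have "\<bar>m\<^sup>2 * (?s x * (1 - ?s x)) * (1 - 2 * ?s x)\<bar> = m\<^sup>2 * (?s x * (1 - ?s x)) * \<bar>1 - 2 * ?s x\<bar>"
        unfolding abs_mult[of "m\<^sup>2 * (?s x * (1 - ?s x))"]
        by (subst abs_of_nonneg[OF mult_nonneg_nonneg[OF zero_le_power2 sb(1)]]) (rule refl)
      also have "\<dots> \<le> m\<^sup>2 * 1 * 1"
      proof (intro mult_mono order_refl)
        show "\<bar>1 - 2 * ?s x\<bar> \<le> 1" using logistic_bounds[of t m x] by linarith
      qed (use sb[of x] in \<open>assumption | simp\<close>)+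
      finally show "\<bar>m\<^sup>2 * (?s x * (1 - ?s x)) * (1 - 2 * ?s x)\<bar> \<le> m + m\<^sup>2" using m by simp
    qed auto
  qed
  have int: "integrable (gauss I) (\<lambda>g. \<Prod>v\<in>W. h (\<Sum>i\<in>I. C v i * g i))" for C :: "'v \<Rightarrow> 'i \<Rightarrow> real"
  proof (rule bounded_borel_integrable[OF prob_space_gauss, of _ _ 1])
    note [measurable] = gauss_measurable_linear
    show "(\<lambda>g. \<Prod>v\<in>W. h (\<Sum>i\<in>I. C v i * g i)) \<in> borel_measurable (gauss I)" by measurable
    show "\<bar>\<Prod>v\<in>W. h (\<Sum>i\<in>I. C v i * g i)\<bar> \<le> 1" for g
      using prod_unit_interval[of W "\<lambda>v. h (\<Sum>i\<in>I. C v i * g i)"] h01 by auto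
  qed
  have meas: "{g \<in> space (gauss I). \<forall>v\<in>W. (\<Sum>i\<in>I. C v i * g i) < t} \<in> sets (gauss I)"
    "{g \<in> space (gauss I). \<forall>v\<in>W. (\<Sum>i\<in>I. C v i * g i) \<le> t} \<in> sets (gauss I)" for C :: "'v \<Rightarrow> 'i \<Rightarrow> real"
  proof -
    note [measurable] = gauss_measurable_linear
    show "{g \<in> space (gauss I). \<forall>v\<in>W. (\<Sum>i\<in>I. C v i * g i) < t} \<in> sets (gauss I)"
      "{g \<in> space (gauss I). \<forall>v\<in>W. (\<Sum>i\<in>I. C v i * g i) \<le> t} \<in> sets (gauss I)"
      using W by measurable
  qed
  have ind: "(\<integral>g. indicator S g \<partial>gauss I) = measure (gauss I) S"
    and inti: "integrable (gauss I) (indicator S :: _ \<Rightarrow> real)" if "S \<in> sets (gauss I)" for S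
  proof -
    show "(\<integral>g. indicator S g \<partial>gauss I) = measure (gauss I) S" using that by (simp add: sets.Int_space_eq2)
    show "integrable (gauss I) (indicator S :: _ \<Rightarrow> real)"
      using that by (intro integrable_real_indicator) (simp_all add: less_top[symmetric])
  qed
  have "measure (gauss I) {g \<in> space (gauss I). \<forall>v\<in>W. (\<Sum>i\<in>I. B v i * g i) < t} =
      (\<integral>g. indicator {g \<in> space (gauss I). \<forall>v\<in>W. (\<Sum>i\<in>I. B v i * g i) < t} g \<partial>gauss I)"
    by (rule ind[OF meas(1), symmetric])
  also have "\<dots> \<le> (\<integral>g. (\<Prod>v\<in>W. h (\<Sum>i\<in>I. B v i * g i)) \<partial>gauss I)"
  proof (rule integral_mono[OF _ int])
    show "integrable (gauss I) (indicator {g \<in> space (gauss I). \<forall>v\<in>W. (\<Sum>i\<in>I. B v i * g i) < t} :: _ \<Rightarrow> real)"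
      by (rule inti[OF meas(1)])
    fix g
    have "(\<Prod>v\<in>W. h (\<Sum>i\<in>I. B v i * g i)) = 1" if "\<forall>v\<in>W. (\<Sum>i\<in>I. B v i * g i) < t"
      using that by (intro prod.neutral) (simp add: h_def)
    moreover have "0 \<le> (\<Prod>v\<in>W. h (\<Sum>i\<in>I. B v i * g i))" using h01 by (intro prod_nonneg) auto
    ultimately show "indicator {g \<in> space (gauss I). \<forall>v\<in>W. (\<Sum>i\<in>I. B v i * g i) < t} g
        \<le> (\<Prod>v\<in>W. h (\<Sum>i\<in>I. B v i * g i))"
      by (auto simp: indicator_def)
  qed
  also note le
  also have "(\<integral>g. (\<Prod>v\<in>W. h (\<Sum>i\<in>I. A v i * g i)) \<partial>gauss I) \<le>
      (\<integral>g. indicator {g \<in> space (gauss I). \<forall>v\<in>W. (\<Sum>i\<in>I. A v i * g i) \<le> t} g \<partial>gauss I)"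
  proof (rule integral_mono[OF int])
    show "integrable (gauss I) (indicator {g \<in> space (gauss I). \<forall>v\<in>W. (\<Sum>i\<in>I. A v i * g i) \<le> t} :: _ \<Rightarrow> real)"
      by (rule inti[OF meas(2)])
    fix g assume g: "g \<in> space (gauss I)"
    have "(\<Prod>v\<in>W. h (\<Sum>i\<in>I. A v i * g i)) = 0" if "\<not> (\<forall>v\<in>W. (\<Sum>i\<in>I. A v i * g i) \<le> t)"
      using that W by (intro prod_zero) (auto simp: h_def)
    moreover have "(\<Prod>v\<in>W. h (\<Sum>i\<in>I. A v i * g i)) \<le> 1" using h01 by (intro prod_le_1) auto
    ultimately show "(\<Prod>v\<in>W. h (\<Sum>i\<in>I. A v i * g i)) \<le>
        indicator {g \<in> space (gauss I). \<forall>v\<in>W. (\<Sum>i\<in>I. A v i * g i) \<le> t} g"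
      using g by (auto simp: indicator_def)
  qed
  also have "\<dots> = measure (gauss I) {g \<in> space (gauss I). \<forall>v\<in>W. (\<Sum>i\<in>I. A v i * g i) \<le> t}"
    by (rule ind[OF meas(2)])
  finally show ?thesis .
qed

section \<open>Independent blocks and one-dimensional Gaussian tails\<close>

lemma gauss_union_prob:
  assumes I: "finite I" "finite J" "I \<inter> J = {}" and X: "X \<in> sets (gauss I)" and Y: "Y \<in> sets (gauss J)"
  shows "measure (gauss (I \<union> J)) {g \<in> space (gauss (I \<union> J)). restrict g I \<in> X \<and> restrict g J \<in> Y} =
    measure (gauss I) X * measure (gauss J) Y"
proof -
  interpret product_sigma_finite "\<lambda>_::'a. std_gauss"
    using prob_space_std_gauss by (simp add: product_sigma_finite_def prob_space_imp_sigma_finite)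
  interpret J: prob_space "gauss J" by (rule prob_space_gauss)
  have d: "distr (gauss I \<Otimes>\<^sub>M gauss J) (gauss (I \<union> J)) (merge I J) = gauss (I \<union> J)"
    unfolding gauss_def by (rule distr_merge[OF I(3,1,2)])
  have mm: "merge I J \<in> measurable (gauss I \<Otimes>\<^sub>M gauss J) (gauss (I \<union> J))"
    unfolding gauss_def by (rule measurable_merge)
  let ?S = "{g \<in> space (gauss (I \<union> J)). restrict g I \<in> X \<and> restrict g J \<in> Y}"
  have rm: "(\<lambda>g. restrict g I) \<in> measurable (gauss (I \<union> J)) (gauss I)"
    "(\<lambda>g. restrict g J) \<in> measurable (gauss (I \<union> J)) (gauss J)"
    unfolding gauss_def by (auto intro: measurable_restrict_subset)
  have "?S = ((\<lambda>g. restrict g I) -` X \<inter> space (gauss (I \<union> J))) \<inter> ((\<lambda>g. restrict g J) -` Y \<inter> space (gauss (I \<union> J)))"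
    by auto
  then have S: "?S \<in> sets (gauss (I \<union> J))"
    using sets.Int[OF measurable_sets[OF rm(1) X] measurable_sets[OF rm(2) Y]] by simp
  have "merge I J -` ?S \<inter> space (gauss I \<Otimes>\<^sub>M gauss J) = X \<times> Y"
  proof (intro set_eqI iffI)
    fix p assume p: "p \<in> merge I J -` ?S \<inter> space (gauss I \<Otimes>\<^sub>M gauss J)"
    obtain x y where xy: "p = (x, y)" by (cases p)
    have sp: "x \<in> space (gauss I)" "y \<in> space (gauss J)" using p by (auto simp: xy space_pair_measure)
    then have "restrict x I = x" "restrict y J = y"
      by (auto simp: gauss_def space_PiM intro!: extensional_restrict)
    then show "p \<in> X \<times> Y" using p I(3) by (auto simp: xy)
  next
    fix p assume p: "p \<in> X \<times> Y"
    obtain x y where xy: "p = (x, y)" by (cases p)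
    have sp: "x \<in> space (gauss I)" "y \<in> space (gauss J)"
      using p X Y by (auto simp: xy dest: sets.sets_into_space)
    then have "restrict x I = x" "restrict y J = y"
      by (auto simp: gauss_def space_PiM intro!: extensional_restrict)
    moreover have "merge I J p \<in> space (gauss (I \<union> J))"
      using measurable_space[OF mm] sp by (simp add: xy space_pair_measure)
    ultimately show "p \<in> merge I J -` ?S \<inter> space (gauss I \<Otimes>\<^sub>M gauss J)"
      using p sp I(3) by (auto simp: xy space_pair_measure)
  qed
  then have "emeasure (gauss (I \<union> J)) ?S = emeasure (gauss I) X * emeasure (gauss J) Y"
    using emeasure_distr[OF mm S] J.emeasure_pair_measure_Times[OF X Y] by (simp add: d)
  then show ?thesis by (simp add: measure_def enn2real_mult)
qed

text \<open>On [s, s + 1] the density is at least its value at s + 1. Against the true tail this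
  loses a factor exponential in s only, harmless later because s is of order sqrt n while the rates
  are linear in n.\<close>

lemma std_gauss_lower_tail:
  assumes "s \<ge> 0"
  shows "exp (- (s + 1)\<^sup>2 / 2) / sqrt (2 * pi) \<le> measure std_gauss {s..}"
proof -
  interpret prob_space std_gauss by (rule prob_space_std_gauss)
  have "exp (- (s + 1)\<^sup>2 / 2) / sqrt (2 * pi) = (\<integral>x. exp (- (s + 1)\<^sup>2 / 2) / sqrt (2 * pi) * indicator {s..s+1} x \<partial>lborel)"
    by simp
  also have "\<dots> \<le> (\<integral>x. std_normal_density x * indicator {s..} x \<partial>lborel)"
  proof (rule integral_mono)
    show "integrable lborel (\<lambda>x. std_normal_density x * indicator {s..} x)"
      by (intro integrable_mult_indicator[of "{s..}" lborel "std_normal_density", simplified mult.commute[of "indicator _ _"] real_scaleR_def]) auto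
    fix x :: real
    show "exp (- (s + 1)\<^sup>2 / 2) / sqrt (2 * pi) * indicator {s..s+1} x \<le> std_normal_density x * indicator {s..} x"
    proof (cases "x \<in> {s..s+1}")
      case True
      then have "x\<^sup>2 \<le> (s + 1)\<^sup>2" using assms by (intro power_mono) auto
      then show ?thesis using True by (simp add: std_normal_density_def divide_right_mono)
    qed (simp add: indicator_def)
  qed simp
  also have "\<dots> = (\<integral>x. indicator {s..} x \<partial>std_gauss)" 
    by (rule integral_std_gauss[symmetric]) simp
  also have "\<dots> = measure std_gauss {s..}" by simp
  finally show ?thesis .
qed

lemma std_gauss_exp_square:
  assumes b: "0 < b"
  shows "integrable std_gauss (\<lambda>x. exp ((1 - b) / 2 * x\<^sup>2))" "(\<integral>x. exp ((1 - b) / 2 * x\<^sup>2) \<partial>std_gauss) = 1 / sqrt b"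
proof -
  have "std_normal_density x * exp ((1 - b) / 2 * x\<^sup>2) = 1 / sqrt b * normal_density 0 (1 / sqrt b) x" for x
  proof -
    have "exp (- x\<^sup>2 / 2) * exp ((1 - b) / 2 * x\<^sup>2) = exp (- (b * x\<^sup>2) / 2)"
      unfolding exp_add[symmetric] by (simp add: field_simps)
    then show ?thesis using b
      by (simp add: normal_density_def real_sqrt_mult real_sqrt_divide power_divide field_simps)
  qed
  then show "integrable std_gauss (\<lambda>x. exp ((1 - b) / 2 * x\<^sup>2))" "(\<integral>x. exp ((1 - b) / 2 * x\<^sup>2) \<partial>std_gauss) = 1 / sqrt b"
    using b integrable_normal_density[of "1 / sqrt b" 0] integral_normal_density[of "1 / sqrt b" 0]
    by (simp_all add: integrable_std_gauss_iff integral_std_gauss)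
qed

text \<open>Exponential Markov inequality with parameter (1 - b) / 2: this tilt turns the standard
  density into a multiple of the normal density of variance 1 / b, so each square contributes 1 /
  sqrt b. The b of the final rate is this free parameter.\<close>

lemma gauss_chi_square_tail:
  assumes I: "finite I" "S \<subseteq> I" and b: "0 < b" "b < 1"
  shows "measure (gauss I) {g \<in> space (gauss I). r \<le> (\<Sum>i\<in>S. (g i)\<^sup>2)} \<le>
    exp (- ((1 - b) / 2 * r)) * (1 / sqrt b) ^ card S"
proof -
  interpret product_sigma_finite "\<lambda>_::'a. std_gauss"
    using prob_space_std_gauss by (simp add: product_sigma_finite_def prob_space_imp_sigma_finite)
  interpret P: prob_space std_gauss by (rule prob_space_std_gauss)
  define f where "f i x = (if i \<in> S then exp ((1 - b) / 2 * x\<^sup>2) else 1 :: real)" for i x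
  have fi: "integrable std_gauss (f i)" for i
    using std_gauss_exp_square[OF b(1)] by (cases "i \<in> S") (simp_all add: f_def[abs_def])
  have fI: "integral\<^sup>L std_gauss (f i) = (if i \<in> S then 1 / sqrt b else 1)" for i
    using std_gauss_exp_square[OF b(1)] P.prob_space by (cases "i \<in> S") (simp_all add: f_def[abs_def])
  have fS: "(\<Prod>i\<in>I. f i (g i)) = exp ((1 - b) / 2 * (\<Sum>i\<in>S. (g i)\<^sup>2))" for g
  proof -
    have "(\<Prod>i\<in>I. f i (g i)) = (\<Prod>i\<in>S. f i (g i))"
      using I by (intro prod.mono_neutral_right) (auto simp: f_def)
    also have "\<dots> = (\<Prod>i\<in>S. exp ((1 - b) / 2 * (g i)\<^sup>2))" by (intro prod.cong) (auto simp: f_def)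
    also have "\<dots> = exp ((1 - b) / 2 * (\<Sum>i\<in>S. (g i)\<^sup>2))"
      using finite_subset[OF I(2,1)] by (simp add: exp_sum[symmetric] sum_distrib_left)
    finally show ?thesis .
  qed
  have int: "integrable (gauss I) (\<lambda>g. exp ((1 - b) / 2 * (\<Sum>i\<in>S. (g i)\<^sup>2)))"
    unfolding fS[symmetric] gauss_def using fi I by (intro product_integrable_prod) auto
  have "(\<integral>g. exp ((1 - b) / 2 * (\<Sum>i\<in>S. (g i)\<^sup>2)) \<partial>gauss I) = (\<Prod>i\<in>I. if i \<in> S then 1 / sqrt b else 1)"
    unfolding fS[symmetric] gauss_def using fi I by (subst product_integral_prod) (auto simp: fI)
  also have "\<dots> = (\<Prod>i\<in>S. 1 / sqrt b)" using I by (intro prod.mono_neutral_cong_right) auto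
  finally have val: "(\<integral>g. exp ((1 - b) / 2 * (\<Sum>i\<in>S. (g i)\<^sup>2)) \<partial>gauss I) = (1 / sqrt b) ^ card S" by simp
  have "{g \<in> space (gauss I). r \<le> (\<Sum>i\<in>S. (g i)\<^sup>2)} =
      {g \<in> space (gauss I). exp ((1 - b) / 2 * r) \<le> exp ((1 - b) / 2 * (\<Sum>i\<in>S. (g i)\<^sup>2))}"
    using b by (simp add: mult_le_cancel_left_pos)
  then show ?thesis
    using integral_Markov_inequality_measure[OF int sets.empty_sets, of "exp ((1 - b) / 2 * r)"]
    unfolding val by (simp add: exp_minus field_simps)
qed

subsection \<open>The norm of the noise tensor\<close>

text \<open>
  The auxiliary Gaussians are indexed by lists of length \<open>k + 1\<close>, so that they are disjoint from the
  entries \<open>tidx n k\<close> of the tensor: \<open>0 # replicate k 0\<close> is the scalar added to the tensor form,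
  the lists \<open>Suc i # replicate k 0\<close> are the coordinates of the vector it is compared with.
\<close>

lemma tensor_sup_tail_finite:
  fixes W :: "(nat \<Rightarrow> real) set"
  assumes k: "k \<ge> 2" and W: "finite W" "\<And>v. v \<in> W \<Longrightarrow> vnorm n v = 1" and s: "s = 1 \<or> s = (- 1 :: real)"
    and b: "0 < b" "b < 1" and t: "t > 0"
  shows "measure (gauss (tidx n k)) {g \<in> space (gauss (tidx n k)). \<exists>v\<in>W. t - \<tau> < s * (\<Sum>is\<in>tidx n k. tpow k v is * g is)} *
      measure std_gauss {\<tau> / sqrt (real k - 1)..} \<le> exp (- ((1 - b) / 2 * (t\<^sup>2 / real k))) * (1 / sqrt b) ^ n"
proof -
  define T where "T = tidx n k"
  define e :: "nat \<Rightarrow> nat list" where "e i = i # replicate k 0" for i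
  define E where "E = e ` {..n}"
  define A where "A v is = (if length is = k then s * tpow k v is else if hd is = 0 then sqrt (real k - 1) else 0)"
    for v and "is" :: "nat list"
  define B where "B v is = (if length is = k then 0 else case hd is of 0 \<Rightarrow> 0 | Suc i \<Rightarrow> sqrt (real k) * v i)"
    for v :: "nat \<Rightarrow> real" and "is"
  let ?I = "T \<union> E"
  have fin: "finite T" "finite E" by (auto simp: T_def E_def)
  have lenT: "length is = k" if "is \<in> T" for "is" using that by (simp add: T_def tidx_def)
  have lenE: "length (e i) = Suc k" "hd (e i) = i" for i by (simp_all add: e_def)
  have "e j \<notin> T" for j using lenT[of "e j"] lenE(1)[of j] by auto
  then have disj: "T \<inter> E = {}" by (auto simp: E_def)
  have inj: "inj_on e S" for S by (auto simp: inj_on_def e_def)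
  have sumI: "(\<Sum>i\<in>?I. f i) = (\<Sum>i\<in>T. f i) + (f (e 0) + (\<Sum>i<n. f (e (Suc i))))" for f :: "nat list \<Rightarrow> real"
    using sum.union_disjoint[OF fin disj, of f]
    by (simp add: E_def sum.reindex[OF inj] sum.atMost_shift)
  have AT: "A v is = s * tpow k v is" "B v is = 0" if "is \<in> T" for v "is"
    using lenT[OF that] by (simp_all add: A_def B_def)
  have Ae: "A v (e 0) = sqrt (real k - 1)" "B v (e 0) = 0" "A v (e (Suc i)) = 0" "B v (e (Suc i)) = sqrt (real k) * v i" for v i
    by (simp_all add: A_def B_def lenE)
  have s2: "s * s = 1" using s by auto
  have AA: "(\<Sum>i\<in>?I. A v i * A w i) = vinner n v w ^ k + (real k - 1)" for v w
  proof -
    have "(\<Sum>i\<in>T. A v i * A w i) = (\<Sum>i\<in>T. (s * s) * (tpow k v i * tpow k w i))"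
      by (intro sum.cong) (auto simp: AT)
    also have "\<dots> = vinner n v w ^ k" unfolding s2 by (simp add: T_def sum_tpow_tpow)
    finally show ?thesis using k by (simp add: sumI Ae)
  qed
  have BB: "(\<Sum>i\<in>?I. B v i * B w i) = real k * vinner n v w" for v w
  proof -
    have "(\<Sum>i<n. sqrt (real k) * v i * (sqrt (real k) * w i)) = (\<Sum>i<n. (sqrt (real k) * sqrt (real k)) * (v i * w i))"
      by (intro sum.cong) (simp_all only: mult_ac)
    then show ?thesis by (simp add: sumI AT Ae vinner_def sum_distrib_left)
  qed
  have AB: "(\<Sum>i\<in>?I. A v i * B w i) = 0" for v w by (simp add: sumI AT Ae)
  have v1: "vinner n v v = 1" if "v \<in> W" for v using W(2)[OF that] vnorm_power2[of n v] by simp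
  have slep: "measure (gauss ?I) {g \<in> space (gauss ?I). \<forall>v\<in>W. (\<Sum>i\<in>?I. B v i * g i) < t} \<le>
    measure (gauss ?I) {g \<in> space (gauss ?I). \<forall>v\<in>W. (\<Sum>i\<in>?I. A v i * g i) \<le> t}"
  proof (rule slepian)
    fix v w assume vw: "v \<in> W" "w \<in> W"
    \<comment> \<open>With q the inner product, Bernoulli's inequality covers q >= 0. For negative q
      the left side is at most 1 - k <= -1, and q^k >= -1 since |q| <= 1.\<close>
    have "1 + real k * (vinner n v w - 1) \<le> (1 + (vinner n v w - 1)) ^ k"
    proof (cases "vinner n v w \<ge> 0")
      case True
      then show ?thesis by (intro Bernoulli_inequality) simp
    next
      case False
      have "\<bar>vinner n v w\<bar> \<le> 1" using vinner_le_vnorm[of n v w] W vw by simp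
      then have "\<bar>vinner n v w ^ k\<bar> \<le> 1" by (simp add: power_abs power_le_one)
      moreover have "real k * vinner n v w \<le> 0" using False by (intro mult_nonneg_nonpos) auto
      moreover have "2 \<le> real k" using k by simp
      ultimately show ?thesis by (simp add: algebra_simps)
    qed
    then show "(\<Sum>i\<in>?I. B v i * B w i) \<le> (\<Sum>i\<in>?I. A v i * A w i)" by (simp add: AA BB algebra_simps)
  qed (use fin W AB in \<open>auto simp: AA BB v1\<close>)
  define X where "X = {g \<in> space (gauss T). \<exists>v\<in>W. t - \<tau> < s * (\<Sum>is\<in>T. tpow k v is * g is)}"
  define Y where "Y = {g \<in> space (gauss E). \<tau> / sqrt (real k - 1) \<le> g (e 0)}"
  interpret I: prob_space "gauss ?I" by (rule prob_space_gauss)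
  note [measurable] = gauss_measurable_linear
  have Xs: "X \<in> sets (gauss T)" unfolding X_def using W(1) by measurable
  have e0: "e 0 \<in> E" by (auto simp: E_def)
  have Ys: "Y \<in> sets (gauss E)" unfolding Y_def using gauss_measurable_coord[OF e0] by measurable
  have Ym: "measure (gauss E) Y = measure std_gauss {\<tau> / sqrt (real k - 1)..}"
  proof -
    have "distr (gauss E) std_gauss (\<lambda>g. g (e 0)) = std_gauss"
      unfolding gauss_def using e0 by (intro distr_PiM_component prob_space_std_gauss)
    then have "measure std_gauss {\<tau> / sqrt (real k - 1)..} =
        measure (distr (gauss E) std_gauss (\<lambda>g. g (e 0))) {\<tau> / sqrt (real k - 1)..}" by simp
    also have "\<dots> = measure (gauss E) ((\<lambda>g. g (e 0)) -` {\<tau> / sqrt (real k - 1)..} \<inter> space (gauss E))"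
      using gauss_measurable_coord[OF e0]
      by (intro measure_distr) (auto simp: measurable_cong_sets[OF refl sets_std_gauss])
    also have "(\<lambda>g. g (e 0)) -` {\<tau> / sqrt (real k - 1)..} \<inter> space (gauss E) = Y" by (auto simp: Y_def)
    finally show ?thesis by simp
  qed
  let ?U = "{g \<in> space (gauss ?I). \<forall>v\<in>W. (\<Sum>i\<in>?I. A v i * g i) \<le> t}"
  let ?V = "{g \<in> space (gauss ?I). \<forall>v\<in>W. (\<Sum>i\<in>?I. B v i * g i) < t}"
  let ?S = "(\<lambda>i. e (Suc i)) ` {..<n}"
  have U: "?U \<in> sets (gauss ?I)" and V: "?V \<in> sets (gauss ?I)" using W(1) by measurable
  \<comment> \<open>If the tensor form exceeds t - \<tau> and the scalar term is at least \<tau>,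
    their sum exceeds t. The two events live on disjoint index blocks, so their probabilities
    multiply; Slepian is then applied to the complement.\<close>
  have "measure (gauss T) X * measure (gauss E) Y =
      measure (gauss ?I) {g \<in> space (gauss ?I). restrict g T \<in> X \<and> restrict g E \<in> Y}"
    by (rule gauss_union_prob[OF fin disj Xs Ys, symmetric])
  also have "\<dots> \<le> measure (gauss ?I) (space (gauss ?I) - ?U)"
  proof (rule I.finite_measure_mono)
    show "{g \<in> space (gauss ?I). restrict g T \<in> X \<and> restrict g E \<in> Y} \<subseteq> space (gauss ?I) - ?U"
    proof safe
      fix g assume g: "restrict g T \<in> X" "restrict g E \<in> Y" and le: "\<forall>v\<in>W. (\<Sum>i\<in>?I. A v i * g i) \<le> t"
      obtain v where v: "v \<in> W" "t - \<tau> < s * (\<Sum>is\<in>T. tpow k v is * restrict g T is)"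
        using g(1) by (auto simp: X_def)
      have "(\<Sum>is\<in>T. tpow k v is * restrict g T is) = (\<Sum>is\<in>T. tpow k v is * g is)" by (intro sum.cong) auto
      then have 1: "t - \<tau> < (\<Sum>i\<in>T. A v i * g i)" using v(2) by (simp add: AT sum_distrib_left mult_ac)
      have "\<tau> / sqrt (real k - 1) \<le> g (e 0)" using g(2) e0 by (simp add: Y_def)
      then have "\<tau> \<le> sqrt (real k - 1) * g (e 0)" using k by (simp add: field_simps)
      then have "t < (\<Sum>i\<in>?I. A v i * g i)" using 1 by (simp add: sumI Ae)
      then show False using le v(1) by (meson not_le)
    qed
    show "space (gauss ?I) - ?U \<in> sets (gauss ?I)" using U by auto
  qed
  also have "\<dots> = 1 - measure (gauss ?I) ?U" by (rule I.prob_compl[OF U])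
  also have "\<dots> \<le> 1 - measure (gauss ?I) ?V" using slep by simp
  also have "\<dots> = measure (gauss ?I) (space (gauss ?I) - ?V)" by (rule I.prob_compl[OF V, symmetric])
  also have "\<dots> \<le> measure (gauss ?I) {g \<in> space (gauss ?I). t\<^sup>2 / real k \<le> (\<Sum>i\<in>?S. (g i)\<^sup>2)}"
  proof (rule I.finite_measure_mono)
    show "space (gauss ?I) - ?V \<subseteq> {g \<in> space (gauss ?I). t\<^sup>2 / real k \<le> (\<Sum>i\<in>?S. (g i)\<^sup>2)}"
    proof safe
      fix g v assume g: "v \<in> W" "\<not> (\<Sum>i\<in>?I. B v i * g i) < t"
      define h where "h i = g (e (Suc i))" for i
      have "t \<le> sqrt (real k) * vinner n v h"
        using g(2) by (simp add: sumI AT Ae vinner_def h_def sum_distrib_left mult_ac not_less)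
      also have "\<dots> \<le> sqrt (real k) * vnorm n h"
        using vinner_le_vnorm[of n v h] W(2)[OF g(1)] by (intro mult_left_mono) auto
      finally have "t\<^sup>2 \<le> (sqrt (real k) * vnorm n h)\<^sup>2" using t by (intro power_mono) auto
      also have "\<dots> = real k * vinner n h h" by (simp add: power_mult_distrib vnorm_power2)
      finally have "t\<^sup>2 / real k \<le> vinner n h h" using k by (simp add: field_simps)
      also have "\<dots> = (\<Sum>i\<in>?S. (g i)\<^sup>2)"
        by (subst sum.reindex) (auto simp: inj_on_def e_def h_def vinner_def power2_eq_square)
      finally show "t\<^sup>2 / real k \<le> (\<Sum>i\<in>?S. (g i)\<^sup>2)" .
    qed
    have "(\<lambda>g. \<Sum>i\<in>?S. (g i)\<^sup>2) \<in> borel_measurable (gauss ?I)"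
      by (intro borel_measurable_sum borel_measurable_power gauss_measurable_coord) (auto simp: E_def)
    then show "{g \<in> space (gauss ?I). t\<^sup>2 / real k \<le> (\<Sum>i\<in>?S. (g i)\<^sup>2)} \<in> sets (gauss ?I)" by measurable
  qed
  also have "\<dots> \<le> exp (- ((1 - b) / 2 * (t\<^sup>2 / real k))) * (1 / sqrt b) ^ card ?S"
    using fin b by (intro gauss_chi_square_tail) (auto simp: E_def)
  also have "card ?S = n" by (subst card_image) (auto simp: inj_on_def e_def)
  finally show ?thesis unfolding Ym X_def T_def .
qed

text \<open>Continuity from below along an enumeration of \<open>D\<close>: the right-hand side of
  the finite bound does not mention the number of vectors.\<close>

lemma tensor_sup_tail:
  fixes D :: "(nat \<Rightarrow> real) set"
  assumes k: "k \<ge> 2" and D: "countable D" "\<And>v. v \<in> D \<Longrightarrow> vnorm n v = 1" and s: "s = 1 \<or> s = (- 1 :: real)"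
    and b: "0 < b" "b < 1" and t: "t > 0"
  shows "measure (gauss (tidx n k)) {g \<in> space (gauss (tidx n k)). \<exists>v\<in>D. t - \<tau> < s * (\<Sum>is\<in>tidx n k. tpow k v is * g is)} *
      measure std_gauss {\<tau> / sqrt (real k - 1)..} \<le> exp (- ((1 - b) / 2 * (t\<^sup>2 / real k))) * (1 / sqrt b) ^ n"
proof (cases "D = {}")
  case True
  then show ?thesis using b by simp
next
  case False
  interpret prob_space "gauss (tidx n k)" by (rule prob_space_gauss)
  define W where "W m = from_nat_into D ` {..m}" for m
  define X where "X V = {g \<in> space (gauss (tidx n k)). \<exists>v\<in>V. t - \<tau> < s * (\<Sum>is\<in>tidx n k. tpow k v is * g is)}"
    for V :: "(nat \<Rightarrow> real) set"
  note [measurable] = gauss_measurable_linear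
  have "X (W m) \<in> sets (gauss (tidx n k))" for m unfolding X_def W_def by measurable
  moreover have "incseq (\<lambda>m. X (W m))" by (auto simp: incseq_def X_def W_def)
  ultimately have "(\<lambda>m. measure (gauss (tidx n k)) (X (W m))) \<longlonglongrightarrow> measure (gauss (tidx n k)) (\<Union>m. X (W m))"
    by (intro finite_Lim_measure_incseq) auto
  moreover have "(\<Union>m. X (W m)) = X D"
  proof -
    have "(\<Union>m. W m) = range (from_nat_into D)" unfolding W_def by auto
    also have "\<dots> = D" by (rule range_from_nat_into[OF False D(1)])
    finally have "(\<Union>m. W m) = D" .
    then show ?thesis by (auto simp: X_def)
  qed
  ultimately have lim: "(\<lambda>m. measure (gauss (tidx n k)) (X (W m)) * measure std_gauss {\<tau> / sqrt (real k - 1)..}) \<longlonglongrightarrow>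
      measure (gauss (tidx n k)) (X D) * measure std_gauss {\<tau> / sqrt (real k - 1)..}"
    by (intro tendsto_mult_right) simp
  have "v \<in> D" if "v \<in> W m" for v m using that from_nat_into[OF False] by (auto simp: W_def)
  then have "measure (gauss (tidx n k)) (X (W m)) * measure std_gauss {\<tau> / sqrt (real k - 1)..}
      \<le> exp (- ((1 - b) / 2 * (t\<^sup>2 / real k))) * (1 / sqrt b) ^ n" for m
    unfolding X_def using D(2) by (intro tensor_sup_tail_finite k s b t) (auto simp: W_def)
  then show ?thesis using LIMSEQ_le_const2[OF lim] by (simp add: X_def)
qed

text \<open>
  The shift \<open>y\<close> given to the scalar Gaussian is the maximiser of the exponent for the given \<open>x\<close>
  and \<open>b\<close>; it turns the exponent \<open>\<rho>\<close> into half of \<open>ln (1 / b) - x\<^sup>2 / R\<close>.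
\<close>

lemma tensor_sup_tendsto_0:
  fixes D :: "nat \<Rightarrow> (nat \<Rightarrow> real) set"
  assumes k: "k \<ge> 2" and D: "\<And>n. countable (D n)" "\<And>n v. v \<in> D n \<Longrightarrow> vnorm n v = 1" and s: "s = 1 \<or> s = (- 1 :: real)"
    and b: "0 < b" "b < 1" and x: "x > 0" and rate: "ln (1 / b) * (real k + (real k)\<^sup>2 * b / (1 - b)) < x\<^sup>2"
  shows "(\<lambda>n. measure (gauss (tidx n k)) {g \<in> space (gauss (tidx n k)).
      \<exists>v\<in>D n. sqrt (real n / real k) * x < s * (\<Sum>is\<in>tidx n k. tpow k v is * g is)}) \<longlonglongrightarrow> 0"
proof -
  define K where "K = real k"
  have K: "K \<ge> 2" using k by (simp add: K_def)
  define R where "R = K + K\<^sup>2 * b / (1 - b)"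
  have R: "R > 0" unfolding R_def using K b by (intro add_pos_nonneg) auto
  \<comment> \<open>For K = k, stationarity of the exponent in the shift y reads y / (K (K - 1)) =
    (1 - b) (x + y) / K^2. The number \<sigma> is this common value, and solving for x gives x =
    \<sigma> R.\<close>
  define \<sigma> where "\<sigma> = x / R"
  define y where "y = \<sigma> * (K\<^sup>2 - K)"
  define c where "c = y / sqrt (K * (K - 1))"
  define \<rho> where "\<rho> = c\<^sup>2 / 2 - (1 - b) / 2 * ((x + y)\<^sup>2 / K\<^sup>2) + ln (1 / b) / 2"
  have \<sigma>: "\<sigma> > 0" using x R by (simp add: \<sigma>_def)
  have KK: "K\<^sup>2 - K = K * (K - 1)" by (simp add: power2_eq_square algebra_simps)
  have y: "y \<ge> 0" using \<sigma> K by (simp add: y_def KK)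
  have c0: "c \<ge> 0" using y K by (simp add: c_def)
  have \<rho>: "\<rho> < 0"
  proof -
    have c2: "c\<^sup>2 = \<sigma>\<^sup>2 * (K\<^sup>2 - K)"
      using K by (simp add: c_def y_def KK power_divide power_mult_distrib) (simp add: power2_eq_square)
    have "x + y = \<sigma> * (R + (K\<^sup>2 - K))" using R by (simp add: y_def \<sigma>_def distrib_left)
    also have "R + (K\<^sup>2 - K) = K\<^sup>2 / (1 - b)" unfolding R_def using b by (simp add: field_simps)
    finally have "(1 - b) * ((x + y)\<^sup>2 / K\<^sup>2) = \<sigma>\<^sup>2 * (K\<^sup>2 / (1 - b))"
      using b K by (simp add: power_mult_distrib power_divide power2_eq_square)
    also have "K\<^sup>2 / (1 - b) = R + (K\<^sup>2 - K)" unfolding R_def using b by (simp add: field_simps)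
    finally have eq: "(1 - b) * ((x + y)\<^sup>2 / K\<^sup>2) = \<sigma>\<^sup>2 * (R + (K\<^sup>2 - K))" .
    have "2 * \<rho> = c\<^sup>2 - (1 - b) * ((x + y)\<^sup>2 / K\<^sup>2) + ln (1 / b)" by (simp add: \<rho>_def)
    also have "\<dots> = ln (1 / b) - \<sigma>\<^sup>2 * R" unfolding c2 eq by (simp add: algebra_simps)
    also have "\<sigma>\<^sup>2 * R = x\<^sup>2 / R" using R by (simp add: \<sigma>_def power_divide power2_eq_square)
    finally have "2 * \<rho> = (ln (1 / b) * R - x\<^sup>2) / R" using R by (simp add: field_simps)
    moreover have "ln (1 / b) * R - x\<^sup>2 < 0" using rate by (simp add: R_def K_def)
    then have "(ln (1 / b) * R - x\<^sup>2) / R < 0" using R by (rule divide_neg_pos)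
    ultimately show ?thesis by linarith
  qed
  define p where "p n = measure (gauss (tidx n k)) {g \<in> space (gauss (tidx n k)).
      \<exists>v\<in>D n. sqrt (real n / real k) * x < s * (\<Sum>is\<in>tidx n k. tpow k v is * g is)}" for n
  have bound: "p n \<le> sqrt (2 * pi) * exp (real n * \<rho> + sqrt (real n) * c + 1 / 2)" if n: "n \<ge> 1" for n
  proof -
    \<comment> \<open>All levels are scaled by sqrt (n / k), which makes the exponents linear in n
      with slope \<rho>. The term sqrt n times c is the loss in the lower tail of the scalar
      Gaussian.\<close>
    define q where "q = sqrt (real n / K)"
    define t where "t = q * (x + y)"
    define \<tau> where "\<tau> = q * y"
    have q: "q > 0" "q\<^sup>2 = real n / K" using n K by (auto simp: q_def)
    have t0: "t > 0" using q x y by (simp add: t_def)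
    have tt: "t - \<tau> = sqrt (real n / real k) * x" by (simp add: t_def \<tau>_def q_def K_def algebra_simps)
    have \<tau>c: "\<tau> / sqrt (real k - 1) = sqrt (real n) * c"
      by (simp add: \<tau>_def q_def c_def K_def real_sqrt_divide real_sqrt_mult)
    have "p n * measure std_gauss {sqrt (real n) * c..} \<le> exp (- ((1 - b) / 2 * (t\<^sup>2 / real k))) * (1 / sqrt b) ^ n"
      using tensor_sup_tail[OF k D(1,2) s b t0, where \<tau> = \<tau> and n = n] by (simp add: p_def tt \<tau>c)
    moreover have "p n * (exp (- (sqrt (real n) * c + 1)\<^sup>2 / 2) / sqrt (2 * pi)) \<le> p n * measure std_gauss {sqrt (real n) * c..}"
      using c0 by (intro mult_left_mono std_gauss_lower_tail) (auto simp: p_def)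
    ultimately have "p n * (exp (- (sqrt (real n) * c + 1)\<^sup>2 / 2) / sqrt (2 * pi)) \<le>
        exp (- ((1 - b) / 2 * (t\<^sup>2 / real k))) * (1 / sqrt b) ^ n" by linarith
    then have "p n \<le> sqrt (2 * pi) * (exp ((sqrt (real n) * c + 1)\<^sup>2 / 2) * (exp (- ((1 - b) / 2 * (t\<^sup>2 / real k))) * (1 / sqrt b) ^ n))"
      by (simp add: exp_minus field_simps)
    also have "(1 / sqrt b) ^ n = exp (real n * (ln (1 / b) / 2))"
    proof -
      have "1 / sqrt b = exp (ln (1 / b) / 2)"
        using b by (simp add: ln_div ln_sqrt[symmetric] exp_minus inverse_eq_divide)
      then show ?thesis by (simp only: exp_of_nat_mult)
    qed
    also have "exp ((sqrt (real n) * c + 1)\<^sup>2 / 2) * (exp (- ((1 - b) / 2 * (t\<^sup>2 / real k))) * exp (real n * (ln (1 / b) / 2))) =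
        exp (real n * \<rho> + sqrt (real n) * c + 1 / 2)"
    proof -
      have "(sqrt (real n) * c + 1)\<^sup>2 / 2 = real n * (c\<^sup>2 / 2) + sqrt (real n) * c + 1 / 2"
        by (simp add: power2_sum power_mult_distrib add_divide_distrib)
      moreover have "t\<^sup>2 / real k = real n * ((x + y)\<^sup>2 / K\<^sup>2)"
        unfolding t_def power_mult_distrib q(2) K_def[symmetric] using K by (simp add: power2_eq_square)
      ultimately show ?thesis unfolding exp_add[symmetric] \<rho>_def
        by (intro arg_cong[where f = exp]) (simp add: algebra_simps)
    qed
    finally show ?thesis .
  qed
  have "(\<lambda>n. sqrt (2 * pi) * exp (real n * \<rho> + sqrt (real n) * c + 1 / 2)) \<longlonglongrightarrow> 0"
  proof -
    have "filterlim (\<lambda>n. real n * \<rho> + sqrt (real n) * c + 1 / 2) at_bot sequentially"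
      using \<rho> by real_asymp
    then have "(\<lambda>n. exp (real n * \<rho> + sqrt (real n) * c + 1 / 2)) \<longlonglongrightarrow> 0"
      by (rule filterlim_compose[OF exp_at_bot])
    then show ?thesis by (rule tendsto_mult_right_zero)
  qed
  then have "p \<longlonglongrightarrow> 0"
    by (rule Lim_null_comparison[rotated])
      (use eventually_ge_at_top[of 1] in \<open>eventually_elim, use bound in \<open>auto simp: p_def\<close>\<close>)
  then show ?thesis by (simp add: p_def[abs_def])
qed

section \<open>The symmetrised noise and the high-probability event\<close>

lemma sym_noise_permute_list:
  assumes "\<sigma> permutes {..<k}" "is \<in> tidx n k"
  shows "sym_noise n k G (permute_list \<sigma> is) = sym_noise n k G is"
proof -
  have len: "length is = k" using assms(2) by (simp add: tidx_def)
  have "(\<Sum>\<pi> | \<pi> permutes {..<k}. G (permute_list \<pi> is)) = (\<Sum>\<pi> | \<pi> permutes {..<k}. G (permute_list (\<sigma> \<circ> \<pi>) is))"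
    by (rule setum_permutations_compose_left[OF assms(1)])
  also have "\<dots> = (\<Sum>\<pi> | \<pi> permutes {..<k}. G (permute_list \<pi> (permute_list \<sigma> is)))"
    using len by (intro sum.cong) (auto simp: permute_list_compose)
  finally show ?thesis by (simp add: sym_noise_def)
qed

text \<open>The power of a single vector is invariant under permuting indices, so each of the k!
  terms of the symmetrisation contributes the same value and the form sees the independent entries
  directly.\<close>

lemma tinner_sym_noise_tpow:
  "tinner n k (sym_noise n k G) (tpow k v) = sqrt (real k / real n) * (\<Sum>is\<in>tidx n k. tpow k v is * G is)"
proof -
  define S where "S = (\<Sum>is\<in>tidx n k. tpow k v is * G is)"
  have "(\<Sum>is\<in>tidx n k. G (permute_list \<pi> is) * tpow k v is) = S" if \<pi>: "\<pi> permutes {..<k}" for \<pi>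
  proof -
    have "(\<lambda>_. v) \<circ> \<pi> = (\<lambda>_. v)" by auto
    then have "tpow k v (permute_list \<pi> is) = tpow k v is" if "is \<in> tidx n k" for "is"
      using outer_permute_list[OF \<pi>, of "is" "\<lambda>_. v"] that by (simp add: tpow_def tidx_def)
    then have "(\<Sum>is\<in>tidx n k. G (permute_list \<pi> is) * tpow k v is) =
        (\<Sum>is\<in>tidx n k. tpow k v (permute_list \<pi> is) * G (permute_list \<pi> is))"
      by (intro sum.cong) auto
    also have "\<dots> = S" unfolding S_def
      by (rule sum.reindex_bij_betw[OF bij_betw_permute_list_tidx[OF \<pi>]])
    finally show ?thesis .
  qed
  then have "(\<Sum>\<pi> | \<pi> permutes {..<k}. \<Sum>is\<in>tidx n k. G (permute_list \<pi> is) * tpow k v is) = fact k * S"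
    using card_permutations[of "{..<k}" k] by simp
  moreover have "tinner n k (sym_noise n k G) (tpow k v) = 1 / fact k * sqrt (real k / real n) *
      (\<Sum>\<pi> | \<pi> permutes {..<k}. \<Sum>is\<in>tidx n k. G (permute_list \<pi> is) * tpow k v is)"
    unfolding tinner_def sym_noise_def
    by (subst sum.swap) (simp add: sum_distrib_left sum_distrib_right mult_ac)
  ultimately show ?thesis by (simp add: S_def)
qed

text \<open>By Banach's theorem the norm is governed by single vectors, and the form is continuous
  in the vector, so a dense subset of the sphere decides. A countable one yields both measurability
  and the tail bound.\<close>

lemma opnorm_sym_noise_le_iff:
  assumes k: "k \<ge> 1" and n: "n \<ge> 1" and D: "D \<subseteq> {v. vnorm n v = 1}" "{v. vnorm n v = 1} \<subseteq> closure D"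
  shows "opnorm n k (sym_noise n k G) \<le> c \<longleftrightarrow>
    (\<forall>v\<in>D. \<bar>sqrt (real k / real n) * (\<Sum>is\<in>tidx n k. tpow k v is * G is)\<bar> \<le> c)"
proof
  assume le: "opnorm n k (sym_noise n k G) \<le> c"
  show "\<forall>v\<in>D. \<bar>sqrt (real k / real n) * (\<Sum>is\<in>tidx n k. tpow k v is * G is)\<bar> \<le> c"
  proof
    fix v assume "v \<in> D"
    then have "\<bar>tinner n k (sym_noise n k G) (outer k (\<lambda>_. v))\<bar> \<le> opnorm n k (sym_noise n k G)"
      using D by (intro abs_tinner_le_opnorm k) auto
    then show "\<bar>sqrt (real k / real n) * (\<Sum>is\<in>tidx n k. tpow k v is * G is)\<bar> \<le> c"
      using le unfolding tpow_def[symmetric] tinner_sym_noise_tpow by simp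
  qed
next
  assume le: "\<forall>v\<in>D. \<bar>sqrt (real k / real n) * (\<Sum>is\<in>tidx n k. tpow k v is * G is)\<bar> \<le> c"
  let ?C = "{v. \<bar>sqrt (real k / real n) * (\<Sum>is\<in>tidx n k. tpow k v is * G is)\<bar> \<le> c}"
  have "closed ?C"
    unfolding tpow_def outer_def
    by (intro closed_Collect_le continuous_intros continuous_on_product_coordinates)
  then have "closure D \<subseteq> ?C" using le by (intro closure_minimal) auto
  then show "opnorm n k (sym_noise n k G) \<le> c"
    using D(2) by (intro opnorm_symmetric_le k n sym_noise_permute_list) (auto simp: tinner_sym_noise_tpow)
qed

lemma iid_std_normal_distr:
  assumes iid: "iid_std_normal M n k G" and n: "n \<ge> 1"
  shows "distr M (PiM (tidx n k) (\<lambda>_. borel)) (\<lambda>\<omega>. \<lambda>is\<in>tidx n k. G is \<omega>) = gauss (tidx n k)"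
proof -
  interpret prob_space M using iid by (simp add: iid_std_normal_def)
  have d: "distr M lborel (G is) = std_gauss" "G is \<in> borel_measurable M" if "is \<in> tidx n k" for "is"
    using iid that by (auto simp: iid_std_normal_def distributed_def std_gauss_def)
  \<comment> \<open>The description of independence by the product law asks for a nonempty index
    set; n >= 1 provides an element.\<close>
  have "replicate k 0 \<in> tidx n k" using n by (auto simp: tidx_def set_replicate_conv_if)
  then have "distr M (PiM (tidx n k) (\<lambda>_. borel)) (\<lambda>\<omega>. \<lambda>is\<in>tidx n k. G is \<omega>) = PiM (tidx n k) (\<lambda>is. distr M borel (G is))"
    using iid d by (subst indep_vars_iff_distr_eq_PiM'[symmetric]) (auto simp: iid_std_normal_def)
  also have "\<dots> = gauss (tidx n k)"
    unfolding gauss_def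
  proof (rule PiM_cong)
    fix "is" assume "is \<in> tidx n k"
    then show "distr M borel (G is) = std_gauss" using d by (metis distr_cong sets_lborel)
  qed simp
  finally show ?thesis .
qed

text \<open>Both conditions follow from the single event that the norm is at most x, because then (k
  - 1) times the norm is at most k \<open>\<mu> k\<close>. The complement of that event is covered
  by two one-sided events, one for each sign of the form.\<close>

lemma high_probability_conditions:
  fixes M :: "nat \<Rightarrow> 'a measure" and G :: "nat \<Rightarrow> nat list \<Rightarrow> 'a \<Rightarrow> real"
    and \<beta> :: "nat \<Rightarrow> real" and v0 y :: "nat \<Rightarrow> nat \<Rightarrow> real"
  assumes k: "k \<ge> 2"
    and asm: "\<And>n. n \<ge> 1 \<Longrightarrow> iid_std_normal (M n) n k (G n) \<and> \<beta> n \<ge> 2 * exp 1 * real k * \<mu> k \<and>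
          vinner n (y n) (v0 n) / vnorm n (y n) \<ge> (real k * \<mu> k / \<beta> n) powr (1 / (real k - 1))"
  shows "(\<lambda>n. measure (M n) {\<omega> \<in> space (M n).
          signal_cond n k (\<beta> n) (sym_noise n k (\<lambda>is. G n is \<omega>)) \<and>
          init_cond n k (\<beta> n) (sym_noise n k (\<lambda>is. G n is \<omega>)) (v0 n) (y n)}) \<longlonglongrightarrow> 1"
proof -
  obtain b x where b: "0 < b" "b < 1" and x: "0 < x" "x < real k * \<mu> k / (real k - 1)"
    and rate: "ln (1 / b) * (real k + (real k)\<^sup>2 * b / (1 - b)) < x\<^sup>2"
    using rate_below_mu[OF k] .
  have "\<exists>D. countable D \<and> D \<subseteq> {v. vnorm n v = 1} \<and> {v. vnorm n v = 1} \<subseteq> closure D" for n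
    using separable[of "{v. vnorm n v = 1}"] by metis
  then obtain D where D: "\<And>n. countable (D n)" "\<And>n. D n \<subseteq> {v. vnorm n v = 1}" "\<And>n. {v. vnorm n v = 1} \<subseteq> closure (D n)"
    by metis
  define q where "q s n = measure (gauss (tidx n k)) {g \<in> space (gauss (tidx n k)).
      \<exists>v\<in>D n. sqrt (real n / real k) * x < s * (\<Sum>is\<in>tidx n k. tpow k v is * g is)}" for s n
  have q: "q 1 \<longlonglongrightarrow> 0" "q (- 1) \<longlonglongrightarrow> 0"
    unfolding q_def[abs_def] by (rule tensor_sup_tendsto_0[OF k D(1) _ _ b x(1) rate]; use D(2) in auto)+
  define p where "p n = measure (M n) {\<omega> \<in> space (M n).
          signal_cond n k (\<beta> n) (sym_noise n k (\<lambda>is. G n is \<omega>)) \<and>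
          init_cond n k (\<beta> n) (sym_noise n k (\<lambda>is. G n is \<omega>)) (v0 n) (y n)}" for n
  have bounds: "1 - (q 1 n + q (- 1) n) \<le> p n \<and> p n \<le> 1" if n: "n \<ge> 1" for n
  proof -
    interpret prob_space "M n" using asm[OF n] by (simp add: iid_std_normal_def)
    interpret g: prob_space "gauss (tidx n k)" by (rule prob_space_gauss)
    define N where "N \<omega> = opnorm n k (sym_noise n k (\<lambda>is. G n is \<omega>))" for \<omega>
    have k1: "k \<ge> 1" using k by simp
    note le_iff = opnorm_sym_noise_le_iff[OF k1 n D(2,3)]
    have Gm [measurable]: "G n is \<in> borel_measurable (M n)" if "is \<in> tidx n k" for "is"
      using asm[OF n] that by (auto simp: iid_std_normal_def distributed_def)
    have lin [measurable]: "(\<lambda>\<omega>. \<Sum>is\<in>tidx n k. a is * G n is \<omega>) \<in> borel_measurable (M n)" for a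
      using Gm by (intro borel_measurable_sum borel_measurable_times) auto
    \<comment> \<open>Monotonicity of the measure needs the larger event to be measurable, since
      \<open>measure\<close> is 0 on other sets. As \<open>N\<close> is defined by an uncountable
      supremum, this goes through the countable dense set.\<close>
    have Nm [measurable]: "N \<in> borel_measurable (M n)"
      unfolding borel_measurable_iff_le N_def le_iff
    proof
      fix c
      show "{\<omega> \<in> space (M n). \<forall>v\<in>D n. \<bar>sqrt (real k / real n) * (\<Sum>is\<in>tidx n k. tpow k v is * G n is \<omega>)\<bar> \<le> c} \<in> events"
      proof (rule sets.sets_Collect_countable_All'[OF _ D(1)])
        fix v
        have "(\<lambda>\<omega>. \<bar>sqrt (real k / real n) * (\<Sum>is\<in>tidx n k. tpow k v is * G n is \<omega>)\<bar>) \<in> borel_measurable (M n)"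
          by (intro borel_measurable_abs borel_measurable_times borel_measurable_const lin)
        then show "{\<omega> \<in> space (M n). \<bar>sqrt (real k / real n) * (\<Sum>is\<in>tidx n k. tpow k v is * G n is \<omega>)\<bar> \<le> c} \<in> events"
          unfolding borel_measurable_iff_le by blast
      qed
    qed
    have set_eq: "p n = prob {\<omega> \<in> space (M n). \<beta> n \<ge> 2 * exp 1 * (real k - 1) * N \<omega> \<and>
        vinner n (y n) (v0 n) / vnorm n (y n) \<ge> ((real k - 1) * N \<omega> / \<beta> n) powr (1 / (real k - 1))}"
      by (simp add: p_def signal_cond_def init_cond_def N_def)
    define F where "F = (\<lambda>\<omega>. \<lambda>is\<in>tidx n k. G n is \<omega>)"
    have Fm: "F \<in> measurable (M n) (PiM (tidx n k) (\<lambda>_. borel))"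
      unfolding F_def by (intro measurable_restrict) (use Gm in auto)
    have Fd: "distr (M n) (PiM (tidx n k) (\<lambda>_. borel)) F = gauss (tidx n k)"
      unfolding F_def using asm[OF n] by (intro iid_std_normal_distr[OF _ n]) auto
    define X where "X s = {g \<in> space (gauss (tidx n k)).
      \<exists>v\<in>D n. sqrt (real n / real k) * x < s * (\<Sum>is\<in>tidx n k. tpow k v is * g is)}" for s
    have Xs: "X s \<in> sets (gauss (tidx n k))" for s
      unfolding X_def
    proof (rule sets.sets_Collect_countable_Ex'[OF _ D(1)])
      fix v
      have "(\<lambda>g. s * (\<Sum>is\<in>tidx n k. tpow k v is * g is)) \<in> borel_measurable (gauss (tidx n k))"
        by (intro borel_measurable_times borel_measurable_const gauss_measurable_linear)
      then show "{g \<in> space (gauss (tidx n k)). sqrt (real n / real k) * x < s * (\<Sum>is\<in>tidx n k. tpow k v is * g is)}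
          \<in> sets (gauss (tidx n k))"
        unfolding borel_measurable_iff_greater by blast
    qed
    have Xq: "prob (F -` X s \<inter> space (M n)) = q s n" for s
    proof -
      have "q s n = measure (distr (M n) (PiM (tidx n k) (\<lambda>_. borel)) F) (X s)" by (simp add: Fd q_def X_def)
      also have "\<dots> = prob (F -` X s \<inter> space (M n))"
        by (rule measure_distr[OF Fm]) (use Xs sets_gauss in blast)
      finally show ?thesis by simp
    qed
    let ?bad = "(F -` X 1 \<inter> space (M n)) \<union> (F -` X (- 1) \<inter> space (M n))"
    have bads: "F -` X s \<inter> space (M n) \<in> events" for s
      using measurable_sets[OF Fm, of "X s"] Xs sets_gauss by blast
    have good: "\<beta> n \<ge> 2 * exp 1 * (real k - 1) * N \<omega> \<and>
        vinner n (y n) (v0 n) / vnorm n (y n) \<ge> ((real k - 1) * N \<omega> / \<beta> n) powr (1 / (real k - 1))"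
      if \<omega>: "\<omega> \<in> space (M n) - ?bad" for \<omega>
    proof -
      have Fs: "F \<omega> \<in> space (gauss (tidx n k))"
        using measurable_space[OF Fm] \<omega> sets_eq_imp_space_eq[OF sets_gauss] by blast
      have FG: "(\<Sum>is\<in>tidx n k. tpow k v is * F \<omega> is) = (\<Sum>is\<in>tidx n k. tpow k v is * G n is \<omega>)" for v
        by (intro sum.cong) (auto simp: F_def)
      have "N \<omega> \<le> x"
        unfolding N_def le_iff
      proof
        fix v assume v: "v \<in> D n"
        define S where "S = (\<Sum>is\<in>tidx n k. tpow k v is * G n is \<omega>)"
        have "S \<le> sqrt (real n / real k) * x" "- S \<le> sqrt (real n / real k) * x"
          using \<omega> v Fs by (auto simp: X_def FG S_def not_less)
        then have "\<bar>S\<bar> \<le> sqrt (real n / real k) * x" by linarith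
        then have "sqrt (real k / real n) * \<bar>S\<bar> \<le> sqrt (real k / real n) * (sqrt (real n / real k) * x)"
          by (intro mult_left_mono) auto
        also have "\<dots> = x" using k n by (simp add: real_sqrt_divide)
        finally show "\<bar>sqrt (real k / real n) * S\<bar> \<le> x" by (simp add: abs_mult)
      qed
      then have "(real k - 1) * N \<omega> \<le> (real k - 1) * (real k * \<mu> k / (real k - 1))"
        using x k by (intro mult_left_mono) auto
      then have le: "(real k - 1) * N \<omega> \<le> real k * \<mu> k" using k by simp
      have pos: "0 < real k * \<mu> k" using k mu_ge[OF k] by simp
      then have "0 < 2 * exp 1 * (real k * \<mu> k)" by simp
      then have \<beta>: "\<beta> n > 0" using asm[OF n] unfolding mult.assoc by linarith
      have "2 * exp 1 * ((real k - 1) * N \<omega>) \<le> 2 * exp 1 * (real k * \<mu> k)"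
        using le by (intro mult_left_mono) auto
      moreover have "2 * exp 1 * (real k * \<mu> k) \<le> \<beta> n" using asm[OF n] by (simp add: mult.assoc)
      ultimately have "2 * exp 1 * ((real k - 1) * N \<omega>) \<le> \<beta> n" by (rule order_trans)
      then have 1: "2 * exp 1 * (real k - 1) * N \<omega> \<le> \<beta> n" by (simp only: mult.assoc)
      have "((real k - 1) * N \<omega> / \<beta> n) powr (1 / (real k - 1)) \<le> (real k * \<mu> k / \<beta> n) powr (1 / (real k - 1))"
        using le \<beta> k opnorm_nonneg[OF k1] by (intro powr_mono2 divide_right_mono) (auto simp: N_def)
      then show ?thesis using 1 asm[OF n] by linarith
    qed
    have "1 - (q 1 n + q (- 1) n) \<le> 1 - prob ?bad"
      using measure_Un_le[OF bads bads, of 1 "- 1"] by (simp add: Xq)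
    also have "\<dots> = prob (space (M n) - ?bad)" using bads by (intro prob_compl[symmetric]) auto
    also have "\<dots> \<le> p n"
      unfolding set_eq
    proof (rule finite_measure_mono)
      show "{\<omega> \<in> space (M n). \<beta> n \<ge> 2 * exp 1 * (real k - 1) * N \<omega> \<and>
        vinner n (y n) (v0 n) / vnorm n (y n) \<ge> ((real k - 1) * N \<omega> / \<beta> n) powr (1 / (real k - 1))} \<in> events"
        by measurable
    qed (use good in blast)
    finally show ?thesis unfolding p_def by simp
  qed
  have "p \<longlonglongrightarrow> 1"
  proof (rule tendsto_sandwich)
    show "\<forall>\<^sub>F n in sequentially. 1 - (q 1 n + q (- 1) n) \<le> p n"
      using eventually_ge_at_top[of 1] by eventually_elim (use bounds in auto)
    show "\<forall>\<^sub>F n in sequentially. p n \<le> 1"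
      using eventually_ge_at_top[of 1] by eventually_elim (use bounds in auto)
    show "(\<lambda>n. 1 - (q 1 n + q (- 1) n)) \<longlonglongrightarrow> 1"
      using tendsto_diff[OF tendsto_const[of 1] tendsto_add[OF q]] by simp
  qed simp
  then show ?thesis by (simp add: p_def[abs_def])
qed

theorem theorem6:
  "(\<exists>t0 :: nat \<Rightarrow> nat. \<forall>k\<ge>3. \<forall>n\<ge>1. \<forall>(v0 :: nat \<Rightarrow> real) (y :: nat \<Rightarrow> real)
        (\<beta> :: real) (Z :: nat list \<Rightarrow> real).
      vnorm n v0 = 1 \<longrightarrow> vnorm n y \<noteq> 0 \<longrightarrow>
      (\<exists>is\<in>tidx n k. Z is \<noteq> 0) \<or> (\<exists>i<n. contract n k (spiked k \<beta> v0 Z) y i \<noteq> 0) \<longrightarrow>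
      signal_cond n k \<beta> Z \<longrightarrow> init_cond n k \<beta> Z v0 y \<longrightarrow>
      (\<forall>t\<ge>t0 k. Loss n (power_iter n k (spiked k \<beta> v0 Z) y t) v0
                   \<le> 2 * exp 1 * opnorm n k Z / \<beta>))
   \<and> (\<forall>k\<ge>2. \<forall>(M :: nat \<Rightarrow> 'a measure) (G :: nat \<Rightarrow> nat list \<Rightarrow> 'a \<Rightarrow> real)
        (\<beta> :: nat \<Rightarrow> real) (v0 :: nat \<Rightarrow> nat \<Rightarrow> real) (y :: nat \<Rightarrow> nat \<Rightarrow> real).
      (\<forall>n\<ge>1. iid_std_normal (M n) n k (G n) \<and> vnorm n (v0 n) = 1 \<and> vnorm n (y n) \<noteq> 0 \<and>
          \<beta> n \<ge> 2 * exp 1 * real k * \<mu> k \<and>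
          vinner n (y n) (v0 n) / vnorm n (y n) \<ge> (real k * \<mu> k / \<beta> n) powr (1 / (real k - 1))) \<longrightarrow>
      (\<lambda>n. measure (M n) {\<omega> \<in> space (M n).
          signal_cond n k (\<beta> n) (sym_noise n k (\<lambda>is. G n is \<omega>)) \<and>
          init_cond n k (\<beta> n) (sym_noise n k (\<lambda>is. G n is \<omega>)) (v0 n) (y n)}) \<longlonglongrightarrow> 1)
   \<and> (\<exists>\<epsilon> :: nat \<Rightarrow> real. \<epsilon> \<longlonglongrightarrow> 0 \<and> (\<forall>k\<ge>2.
        2 * exp 1 * real k * \<mu> k = 2 * exp 1 * sqrt (real k ^ 3 * ln (real k)) * (1 + \<epsilon> k) \<and>
        2 * exp 1 * real k * \<mu> k \<le> 6 * sqrt (real k ^ 3 * ln (real k)) * (1 + \<epsilon> k)))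
   \<and> (\<exists>\<epsilon> :: nat \<Rightarrow> real. \<epsilon> \<longlonglongrightarrow> 0 \<and> (\<forall>k\<ge>2. \<forall>\<beta>\<ge>2 * exp 1 * real k * \<mu> k.
        (real k * \<mu> k / \<beta>) powr (1 / (real k - 1)) = \<beta> powr (- 1 / (real k - 1)) * (1 + \<epsilon> k)))"
proof (intro conjI signal_threshold_asymp init_threshold_asymp)
  show "\<exists>t0 :: nat \<Rightarrow> nat. \<forall>k\<ge>3. \<forall>n\<ge>1. \<forall>(v0 :: nat \<Rightarrow> real) (y :: nat \<Rightarrow> real)
        (\<beta> :: real) (Z :: nat list \<Rightarrow> real).
      vnorm n v0 = 1 \<longrightarrow> vnorm n y \<noteq> 0 \<longrightarrow>
      (\<exists>is\<in>tidx n k. Z is \<noteq> 0) \<or> (\<exists>i<n. contract n k (spiked k \<beta> v0 Z) y i \<noteq> 0) \<longrightarrow>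
      signal_cond n k \<beta> Z \<longrightarrow> init_cond n k \<beta> Z v0 y \<longrightarrow>
      (\<forall>t\<ge>t0 k. Loss n (power_iter n k (spiked k \<beta> v0 Z) y t) v0
                   \<le> 2 * exp 1 * opnorm n k Z / \<beta>)"
    by (intro exI[of _ "\<lambda>_. 2"] allI impI) (rule power_iter_Loss)
qed (intro allI impI high_probability_conditions; blast)

end
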